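(* Let $s\geq 5$ be an integer and $\theta\in(1/s,1]$. There exist constants $M(s,\theta)$ and $c(s,\theta)>0$, depending only on $s$ and $\theta$, such that the following holds. Suppose $W=\prod_i p_i^{n_i}$ is a positive integer with $p_i\geq M(s,\theta)$ for all $i$, and $A$ is a subset of $(\mathbb{Z}/W)^{(2)}$ with $|A|\geq \theta\,|(\mathbb{Z}/W)^{(2)}|$. Then for every $y\in\mathbb{Z}/W$ there exist $x_1,\dots,x_s\in A$ with $y=x_1+\dots+x_s$; moreover, \[ |\{(x_1,\dots,x_s)\in A^s: y=x_1+\dots+x_s\}|\geq c(s,\theta)\,W^{-1}\,|(\mathbb{Z}/W)^{(2)}|^s . \]
   Context: For a positive integer $W$, $(\mathbb{Z}/W)^{(2)}=\{x\in\mathbb{Z}/W: x=y^2 \text{ for some } y\in\mathbb{Z}/W\}$ denotes the set of squares in $\mathbb{Z}/W$. *)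

theory Defs
  imports Complex_Main "HOL-Number_Theory.Number_Theory" "HOL-Library.FuncSet"
begin

text \<open>
  The ring of integers modulo \<open>W\<close> is represented by the least residues \<open>{..<W}\<close>,
  with equations read as congruences modulo \<open>W\<close>.
\<close>

definition squares_mod :: "nat \<Rightarrow> nat set" where
  "squares_mod W = {x \<in> {..<W}. \<exists>y\<in>{..<W}. [x = y ^ 2] (mod W)}"

definition representations_mod :: "nat \<Rightarrow> nat set \<Rightarrow> nat \<Rightarrow> nat \<Rightarrow> (nat \<Rightarrow> nat) set" where
  "representations_mod W A s y = {x \<in> {..<s} \<rightarrow>\<^sub>E A. [y = (\<Sum>i<s. x i)] (mod W)}"

end

theory Submission imports Defs "HOL-Analysis.Analysis" begin

text \<open>
  The squares modulo \<open>W\<close> contain an almost full subset \<open>R\<close>, defined prime by prime, whose Fourier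
  coefficients multiply over the prime powers dividing \<open>W\<close> and are \<open>O(p powr (-1/2))\<close> at each of them,
  by Gauss sums. So \<open>R\<close> behaves like a random set, and the density problem on \<open>R\<close> is transferred to
  \<open>\<int>/W\<close>: a function \<open>f\<close> below the indicator of \<open>R\<close> is convolved with the autocorrelation of a cell on
  which all its large frequencies are nearly constant, which makes it bounded by about the density of
  \<open>R\<close>. A level set then has density above \<open>1/s\<close> in \<open>\<int>/W\<close>, and Pollard's theorem, iterated on popular
  sums, gives the expected number of representations.

  The number of primes is unbounded, so the error terms need a restriction estimate uniform in \<open>W\<close>:
  the \<open>\<ell>\<close>-norm with exponent \<open>9/2 < 5\<close> of the transform of \<open>f\<close> is at most a constant times \<open>card R\<close>.
  By duality this is a bound for the bilinear form with kernel \<open>\<bar>ft R (k - l)\<bar>\<close>. Such bounds multiply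
  under the Chinese remainder theorem, and since \<open>9/2 > 4\<close> the local constants \<open>1 + O(p powr (-5/4))\<close>
  have a convergent product.
\<close>

section \<open>Fourier analysis on residues\<close>

text \<open>The exponent \<open>9/2\<close> is squeezed from both sides. With \<open>r\<close> in
  its place the local constant would be 1 + O(p powr (1 - r/2)), whose product converges over all
  integers only for r > 4, while the small frequencies gain a power s - r, which has to be positive
  for every \<open>s \<ge> 5\<close>.

  The threshold 1/s is the point at which \<open>s\<close> densities add up to 1, the limit of
  Pollard's theorem in a group without large proper subgroups. Half of the gap \<theta> - 1/s is
  given up when the squares are replaced by \<open>R\<close>; the other half pays for the level set
  and the popular sums.

  Large primes serve several purposes: they bring the product of the local constants close to 1,
  make the nonzero coefficients of \<open>R\<close> small, make the proper subgroups of the integers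
  mod \<open>W\<close> small, and supply the slack in the local kernel bound.

  Uniformity in \<open>W\<close> rests on the number of large frequencies: the moment bound limits
  it by a constant, so the total weight of the smoothing kernel on the frequency side is bounded
  too, and the decay demanded of \<open>R\<close> can be fixed in advance against that
  bound.\<close>

definition ee :: "int \<Rightarrow> int \<Rightarrow> complex" where
  "ee N k = cis (2 * pi * of_int k / of_int N)"

lemma ee_add: "ee N (a + b) = ee N a * ee N b"
  by (simp add: ee_def cis_mult add_divide_distrib ring_distribs)

lemma ee_0 [simp]: "ee N 0 = 1"
  by (simp add: ee_def)

lemma norm_ee [simp]: "norm (ee N k) = 1"
  by (simp add: ee_def)

lemma cnj_ee: "cnj (ee N k) = ee N (- k)"
  by (simp add: ee_def cis_cnj)

lemma ee_multiple: "N \<noteq> 0 \<Longrightarrow> ee N (N * j) = 1"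
  using cis_multiple_2pi[of "of_int j"] by (simp add: ee_def mult.assoc)

lemma ee_cong:
  assumes "N \<noteq> 0" "[a = b] (mod N)"
  shows "ee N a = ee N b"
proof -
  obtain j where "a = b + N * j"
    using assms(2) by (metis cong_iff_lin cong_sym)
  then show ?thesis using assms(1) by (simp add: ee_add ee_multiple)
qed

lemma ee_mult_mod: "N \<noteq> 0 \<Longrightarrow> ee N (k * (a mod N)) = ee N (k * a)"
  by (intro ee_cong) (auto simp: Cong.cong_def mod_simps)

lemma ee_mult_mod_left: "N \<noteq> 0 \<Longrightarrow> ee N ((k mod N) * a) = ee N (k * a)"
  by (intro ee_cong) (auto simp: Cong.cong_def mod_simps)

lemma ee_eq_1_iff:
  assumes "N \<noteq> 0"
  shows "ee N k = 1 \<longleftrightarrow> N dvd k"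
proof
  assume "ee N k = 1"
  then have "cos (2 * pi * of_int k / of_int N) = 1"
    by (simp add: ee_def complex_eq_iff)
  then obtain n :: int where "2 * pi * of_int k / of_int N = of_int n * 2 * pi"
    by (auto simp: cos_one_2pi_int)
  then have "real_of_int k = of_int (n * N)"
    using assms by (simp add: field_simps)
  then show "N dvd k" by (simp only: of_int_eq_iff dvd_triv_right)
qed (use assms ee_multiple in \<open>auto elim!: dvdE\<close>)

lemma bij_betw_residue_shift:
  fixes N :: int
  assumes "N > 0"
  shows "bij_betw (\<lambda>x. (x + a) mod N) {0..<N} {0..<N}"
proof (rule bij_betw_byWitness[where f' = "\<lambda>x. (x - a) mod N"])
qed (use assms in \<open>auto simp: mod_simps\<close>)

lemma bij_betw_residue_reflect:
  fixes N :: int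
  assumes "N > 0"
  shows "bij_betw (\<lambda>x. (a - x) mod N) {0..<N} {0..<N}"
proof (rule bij_betw_byWitness[where f' = "\<lambda>x. (a - x) mod N"])
qed (use assms in \<open>auto simp: mod_simps\<close>)

lemma sum_residue_shift:
  fixes N :: int
  assumes "N > 0"
  shows "(\<Sum>x\<in>{0..<N}. f ((x + a) mod N)) = (\<Sum>x\<in>{0..<N}. f x)"
  using sum.reindex_bij_betw[OF bij_betw_residue_shift[OF assms]] .

lemma sum_residue_reflect:
  fixes N :: int
  assumes "N > 0"
  shows "(\<Sum>x\<in>{0..<N}. f ((a - x) mod N)) = (\<Sum>x\<in>{0..<N}. f x)"
  using sum.reindex_bij_betw[OF bij_betw_residue_reflect[OF assms]] .

text \<open>The shift of \<open>k\<close> by one permutes the residues and multiplies the sum by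
  \<open>ee N x\<close>, so the sum vanishes unless that factor is 1.\<close>

lemma sum_ee:
  assumes "N > 0"
  shows "(\<Sum>k\<in>{0..<N}. ee N (k * x)) = (if N dvd x then of_int N else 0)"
proof (cases "N dvd x")
  case True
  then have "ee N (k * x) = 1" for k
    using assms by (simp add: ee_eq_1_iff)
  then show ?thesis using True assms by simp
next
  case False
  let ?S = "\<Sum>k\<in>{0..<N}. ee N (k * x)"
  have "?S = (\<Sum>k\<in>{0..<N}. ee N (((k + 1) mod N) * x))"
    using sum_residue_shift[OF assms, of "\<lambda>k. ee N (k * x)" 1] by simp
  also have "\<dots> = ?S * ee N x"
    using assms by (simp add: ee_mult_mod_left ee_add ring_distribs sum_distrib_right)
  finally have "?S * (ee N x - 1) = 0" by (simp add: algebra_simps)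
  then show ?thesis using False assms by (simp add: ee_eq_1_iff)
qed

lemma norm_ee_minus_1_le: "norm (ee N k - 1) \<le> 2 * pi * \<bar>of_int k / of_int N\<bar>"
proof -
  have "norm (ee N k - 1) = 2 * \<bar>sin (2 * pi * of_int k / of_int N / 2)\<bar>"
    using dist_exp_i_1[of "2 * pi * of_int k / of_int N"]
    by (simp add: ee_def cis_conv_exp dist_norm)
  also have "\<dots> \<le> 2 * \<bar>2 * pi * of_int k / of_int N / 2\<bar>"
    by (intro mult_left_mono abs_sin_x_le_abs_x) auto
  also have "\<dots> = 2 * pi * \<bar>of_int k / of_int N\<bar>"
    by (simp add: abs_mult)
  finally show ?thesis .
qed

section \<open>Transform, cyclic convolution and convolution powers\<close>

definition ft :: "int \<Rightarrow> (int \<Rightarrow> real) \<Rightarrow> int \<Rightarrow> complex" where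
  "ft N f k = (\<Sum>x\<in>{0..<N}. of_real (f x) * ee N (k * x))"

text \<open>For positive \<open>N\<close> both functions are sampled only on \<open>{0..<N}\<close>,
  so their values elsewhere never matter and the result is periodic in \<open>x\<close>.\<close>

definition conv :: "int \<Rightarrow> (int \<Rightarrow> real) \<Rightarrow> (int \<Rightarrow> real) \<Rightarrow> int \<Rightarrow> real" where
  "conv N f g x = (\<Sum>a\<in>{0..<N}. f a * g ((x - a) mod N))"

text \<open>For an indicator this counts ordered representations as sums of \<open>n\<close>
  elements. Power 0 is the point mass at residue 0, which is neutral for \<open>conv\<close> when
  the argument is reduced modulo \<open>N\<close>.\<close>

fun cpow :: "int \<Rightarrow> (int \<Rightarrow> real) \<Rightarrow> nat \<Rightarrow> int \<Rightarrow> real" where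
  "cpow N f 0 = indicator {0}"
| "cpow N f (Suc n) = conv N f (cpow N f n)"

lemma ft_0: "ft N f 0 = of_real (\<Sum>x\<in>{0..<N}. f x)"
  by (simp add: ft_def)

lemma ft_mod: "N \<noteq> 0 \<Longrightarrow> ft N f (k mod N) = ft N f k"
  unfolding ft_def by (simp add: ee_mult_mod_left)

lemma norm_ft_le: "(\<And>x. f x \<ge> 0) \<Longrightarrow> norm (ft N f k) \<le> (\<Sum>x\<in>{0..<N}. f x)"
  unfolding ft_def by (intro sum_norm_le) (simp add: norm_mult)

lemma ft_cmult: "ft N (\<lambda>x. c * f x) k = of_real c * ft N f k"
  by (simp add: ft_def sum_distrib_left mult.assoc)

lemma ft_uminus: "ft N f (- k) = cnj (ft N f k)"
  by (simp add: ft_def cnj_ee)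

lemma conv_nonneg: "(\<And>x. f x \<ge> 0) \<Longrightarrow> (\<And>x. g x \<ge> 0) \<Longrightarrow> conv N f g x \<ge> 0"
  unfolding conv_def by (intro sum_nonneg mult_nonneg_nonneg) auto

lemma conv_mono:
  "(\<And>x. f x \<le> f' x) \<Longrightarrow> (\<And>x. g x \<le> g' x) \<Longrightarrow> (\<And>x. 0 \<le> f x) \<Longrightarrow> (\<And>x. 0 \<le> g x)
    \<Longrightarrow> conv N f g x \<le> conv N f' g' x"
  unfolding conv_def by (intro sum_mono mult_mono) (auto intro: order_trans)

lemma conv_commute: "N > 0 \<Longrightarrow> conv N f g (x mod N) = conv N g f (x mod N)"
proof -
  assume "N > 0"
  have "conv N f g (x mod N) = (\<Sum>a\<in>{0..<N}. f ((x - a) mod N) * g ((x mod N - ((x - a) mod N)) mod N))"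
    unfolding conv_def by (rule sum_residue_reflect[OF \<open>N > 0\<close>, symmetric])
  also have "\<dots> = conv N g f (x mod N)"
    unfolding conv_def by (intro sum.cong) (auto simp: mod_simps)
  finally show ?thesis .
qed

lemma ft_conv:
  assumes "N > 0"
  shows "ft N (conv N f g) k = ft N f k * ft N g k"
proof -
  have "ft N (conv N f g) k
      = (\<Sum>a\<in>{0..<N}. \<Sum>x\<in>{0..<N}. of_real (f a) * ee N (k * a) * (of_real (g ((x - a) mod N)) * ee N (k * (x - a))))"
    unfolding ft_def conv_def of_real_sum sum_distrib_right
    by (subst sum.swap) (simp add: algebra_simps flip: ee_add)
  also have "\<dots> = (\<Sum>a\<in>{0..<N}. of_real (f a) * ee N (k * a) *
      (\<Sum>x\<in>{0..<N}. of_real (g ((x + - a) mod N)) * ee N (k * ((x + - a) mod N))))"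
    using assms by (simp add: sum_distrib_left ee_mult_mod)
  also have "\<dots> = ft N f k * ft N g k"
    unfolding ft_def sum_distrib_right
    by (subst sum_residue_shift[OF assms, of "\<lambda>x. of_real (g x) * ee N (k * x)"]) simp
  finally show ?thesis .
qed

lemma ft_cpow:
  assumes "N > 0"
  shows "ft N (cpow N f n) k = ft N f k ^ n"
proof (induction n)
  case 0
  have "ft N (indicator {0}) k = (\<Sum>x\<in>{0}. of_real (indicator {0} x) * ee N (k * x))"
    unfolding ft_def using assms by (intro sum.mono_neutral_right) auto
  then show ?case by simp
qed (simp add: ft_conv[OF assms])

lemma ft_reflect:
  assumes "N > 0"
  shows "ft N (\<lambda>x. f ((- x) mod N)) k = cnj (ft N f k)"
proof -
  have "ft N (\<lambda>x. f ((- x) mod N)) k = (\<Sum>x\<in>{0..<N}. of_real (f ((0 - x) mod N)) * ee N (- k * ((0 - x) mod N)))"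
    unfolding ft_def by (rule sum.cong[OF refl], subst ee_mult_mod) (use assms in auto)
  also have "\<dots> = ft N f (- k)"
    unfolding ft_def by (rule sum_residue_reflect[OF assms])
  finally show ?thesis by (simp add: ft_uminus)
qed

lemma ft_inversion:
  assumes "N > 0" "x \<in> {0..<N}"
  shows "(\<Sum>k\<in>{0..<N}. ft N f k * ee N (- (k * x))) = of_int N * of_real (f x)"
proof -
  have "(\<Sum>k\<in>{0..<N}. ft N f k * ee N (- (k * x)))
      = (\<Sum>z\<in>{0..<N}. of_real (f z) * (\<Sum>k\<in>{0..<N}. ee N (k * (z - x))))"
    unfolding ft_def sum_distrib_right sum_distrib_left
    by (subst sum.swap) (simp add: algebra_simps flip: ee_add)
  also have "\<dots> = (\<Sum>z\<in>{0..<N}. if z = x then of_real (f z) * of_int N else 0)"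
  proof (intro sum.cong refl)
    fix z assume "z \<in> {0..<N}"
    then have "N dvd z - x \<longleftrightarrow> z = x"
      using assms by (auto simp: mod_eq_dvd_iff[symmetric])
    then show "of_real (f z) * (\<Sum>k\<in>{0..<N}. ee N (k * (z - x)))
        = (if z = x then of_real (f z) * of_int N else 0)"
      by (simp add: sum_ee[OF assms(1)])
  qed
  finally show ?thesis using assms by simp
qed

lemma parseval:
  assumes "N > 0"
  shows "(\<Sum>k\<in>{0..<N}. (norm (ft N f k))\<^sup>2) = of_int N * (\<Sum>x\<in>{0..<N}. (f x)\<^sup>2)"
proof -
  have "complex_of_real (\<Sum>k\<in>{0..<N}. (norm (ft N f k))\<^sup>2) = (\<Sum>k\<in>{0..<N}. ft N f k * cnj (ft N f k))"
    by (simp add: complex_norm_square del: of_real_power)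
  also have "\<dots> = (\<Sum>k\<in>{0..<N}. \<Sum>x\<in>{0..<N}. of_real (f x) * (ft N f k * ee N (- (k * x))))"
    by (subst (2) ft_def) (simp add: sum_distrib_left cnj_ee algebra_simps)
  also have "\<dots> = (\<Sum>x\<in>{0..<N}. of_real (f x) * (\<Sum>k\<in>{0..<N}. ft N f k * ee N (- (k * x))))"
    by (subst sum.swap) (simp add: sum_distrib_left)
  also have "\<dots> = (\<Sum>x\<in>{0..<N}. of_real (f x) * (of_int N * of_real (f x)))"
    by (intro sum.cong refl) (simp only: ft_inversion[OF assms])
  also have "\<dots> = of_real (of_int N * (\<Sum>x\<in>{0..<N}. (f x)\<^sup>2))"
    by (simp add: sum_distrib_left power2_eq_square algebra_simps)
  finally show ?thesis using of_real_eq_iff by blast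
qed

section \<open>Pollard's theorem and popular sums\<close>

definition ind :: "'a set \<Rightarrow> 'a \<Rightarrow> real" where
  "ind A = indicator A"

lemma ind_nonneg [simp]: "ind A x \<ge> 0"
  by (simp add: ind_def)

lemma ind_le_1 [simp]: "ind A x \<le> 1"
  by (simp add: ind_def indicator_def)

lemma sum_ind:
  assumes "finite B" "A \<subseteq> B"
  shows "(\<Sum>x\<in>B. ind A x) = real (card A)"
proof -
  have "(\<Sum>x\<in>B. ind A x) = (\<Sum>x\<in>A. 1)"
    using assms by (intro sum.mono_neutral_cong_right) (auto simp: ind_def)
  then show ?thesis by simp
qed

lemma conv_ind_le_card_right:
  assumes "N > 0" "B \<subseteq> {0..<N}"
  shows "conv N (ind A) (ind B) x \<le> real (card B)"
proof -
  have "conv N (ind A) (ind B) x \<le> (\<Sum>a\<in>{0..<N}. ind B ((x - a) mod N))"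
    unfolding conv_def by (intro sum_mono mult_left_le_one_le) auto
  also have "\<dots> = (\<Sum>a\<in>{0..<N}. ind B a)"
    by (rule sum_residue_reflect[OF assms(1)])
  finally show ?thesis using assms by (simp add: sum_ind)
qed

lemma sum_conv:
  assumes "N > 0"
  shows "(\<Sum>x\<in>{0..<N}. conv N f g x) = (\<Sum>x\<in>{0..<N}. f x) * (\<Sum>x\<in>{0..<N}. g x)"
  using ft_conv[OF assms, of f g 0] by (simp only: ft_0 of_real_eq_iff flip: of_real_mult)

lemma conv_add_left: "conv N (\<lambda>x. f x + g x) h x = conv N f h x + conv N g h x"
  by (simp add: conv_def ring_distribs sum.distrib)

lemma conv_add_right: "conv N h (\<lambda>x. f x + g x) x = conv N h f x + conv N h g x"
  by (simp add: conv_def ring_distribs sum.distrib)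

text \<open>The identity behind Dyson's e-transform.\<close>

lemma conv_Un_Int:
  assumes "N > 0" "x \<in> {0..<N}"
  shows "conv N (ind A) (ind B) x
    = conv N (ind (A \<union> B)) (ind (A \<inter> B)) x + conv N (ind (A - B)) (ind (B - A)) x"
proof -
  define P Q I where "P = ind (A - B)" and "Q = ind (B - A)" and "I = ind (A \<inter> B)"
  have AB: "ind (A \<union> B) = (\<lambda>x. P x + (Q x + I x))" "ind A = (\<lambda>x. P x + I x)" "ind B = (\<lambda>x. Q x + I x)"
    by (auto simp: P_def Q_def I_def ind_def indicator_def fun_eq_iff)
  have "conv N I Q x = conv N Q I x"
    using conv_commute[OF assms(1), of I Q x] assms(2) by simp
  then show ?thesis
    unfolding AB P_def[symmetric] Q_def[symmetric] I_def[symmetric] conv_add_left conv_add_right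
    by simp
qed

section \<open>Translates, periods and the stable case of Pollard's theorem\<close>

definition translate :: "int \<Rightarrow> int \<Rightarrow> int set \<Rightarrow> int set" where
  "translate N e A = {x \<in> {0..<N}. (x - e) mod N \<in> A}"

lemma card_translate:
  assumes "N > 0" "A \<subseteq> {0..<N}"
  shows "card (translate N e A) = card A"
proof -
  have "bij_betw (\<lambda>x. (x - e) mod N) (translate N e A) A"
    by (rule bij_betw_byWitness[where f' = "\<lambda>x. (x + e) mod N"])
       (use assms in \<open>auto simp: translate_def mod_simps\<close>)
  then show ?thesis by (rule bij_betw_same_card)
qed

lemma conv_translate:
  assumes "N > 0"
  shows "conv N (ind (translate N e A)) (ind B) x = conv N (ind A) (ind B) ((x - e) mod N)"
proof -
  have "conv N (ind (translate N e A)) (ind B) x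
      = (\<Sum>a\<in>{0..<N}. ind A ((a + - e) mod N) * ind B (((x - e) mod N - (a + - e) mod N) mod N))"
    unfolding conv_def
  proof (intro sum.cong refl)
    fix a assume "a \<in> {0..<N}"
    then have "ind (translate N e A) a = ind A ((a + - e) mod N)"
      by (simp add: ind_def indicator_def translate_def)
    then show "ind (translate N e A) a * ind B ((x - a) mod N)
        = ind A ((a + - e) mod N) * ind B (((x - e) mod N - (a + - e) mod N) mod N)"
      by (simp add: mod_simps)
  qed
  also have "\<dots> = conv N (ind A) (ind B) ((x - e) mod N)"
    unfolding conv_def by (rule sum_residue_shift[OF assms])
  finally show ?thesis .
qed

text \<open>The periods of \<open>A\<close> are closed under addition and, after reducing the factor
  modulo \<open>N\<close>, under all integer multiples; by Bezout they contain every gcd of periods.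
  Including \<open>N\<close> makes the gcd a divisor of \<open>N\<close>, that is, the index of a
  subgroup.\<close>

lemma periods_dvd:
  fixes N :: int
  assumes "N > 0" "A \<subseteq> {0..<N}" "finite X" "\<And>h a. h \<in> X \<Longrightarrow> a \<in> A \<Longrightarrow> (a + h) mod N \<in> A"
    "a \<in> A"
  shows "(a + Gcd (insert N X)) mod N \<in> A"
proof -
  define P where "P h \<longleftrightarrow> (\<forall>a\<in>A. (a + h) mod N \<in> A)" for h
  have add: "P (g + h)" if "P g" "P h" for g h
    unfolding P_def
  proof
    fix a assume "a \<in> A"
    then have "((a + g) mod N + h) mod N \<in> A" using that by (auto simp: P_def)
    then show "(a + (g + h)) mod N \<in> A" by (simp add: mod_simps add.assoc)
  qed
  have zero: "P 0" using assms(2) by (auto simp: P_def)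
  have mult_nat: "P (int n * h)" if "P h" for n h
    by (induction n) (use that zero add in \<open>auto simp: ring_distribs\<close>)
  have mult: "P (m * h)" if "P h" for m h
  proof -
    have "P (int (nat (m mod N)) * h)" by (rule mult_nat[OF that])
    then have *: "P ((m mod N) * h)" using assms(1) by simp
    have "(a + (m mod N) * h) mod N = (a + m * h) mod N" for a
      by (metis mod_add_right_eq mod_mult_left_eq)
    with * show ?thesis by (simp add: P_def)
  qed
  have N: "P N" using zero by (simp add: P_def)
  have "P (Gcd (insert N X))"
    using assms(3,4)
  proof (induction X rule: finite_induct)
    case empty
    then show ?case using N assms(1) by simp
  next
    case (insert h X)
    obtain u v where "gcd h (Gcd (insert N X)) = u * h + v * Gcd (insert N X)"
      by (metis bezout_int)
    moreover have "P h" using insert.prems by (auto simp: P_def)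
    moreover have "P (Gcd (insert N X))" using insert by blast
    ultimately have "P (gcd h (Gcd (insert N X)))" using add mult by simp
    then show ?case by (simp add: insert_commute[of N h] del: Gcd_insert) (simp add: Gcd_insert)
  qed
  then show ?thesis using assms(5) by (simp add: P_def)
qed

lemma int_div_less:
  fixes p b m :: int
  assumes "p > 0" "b < p * m"
  shows "b div p < m"
proof (rule ccontr)
  assume "\<not> b div p < m"
  then have "p * m \<le> p * (b div p)" using assms(1) by simp
  also have "\<dots> = b - b mod p" by (simp add: minus_mod_eq_mult_div)
  also have "\<dots> \<le> b" using assms(1) by simp
  finally show False using assms(2) by simp
qed

text \<open>Elements of one class modulo \<open>p\<close> are determined by their quotients by
  \<open>p\<close>, which lie in \<open>{0..<N div p}\<close>. The bound is the size of a coset of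
  the subgroup of index \<open>p\<close>.\<close>

lemma card_residue_class_le:
  fixes p N :: int
  assumes "N > 0" "p > 0" "p dvd N" "B \<subseteq> {0..<N}" "\<And>b. b \<in> B \<Longrightarrow> p dvd b - c"
  shows "real (card B) \<le> of_int N / of_int p"
proof -
  have inj: "inj_on (\<lambda>b. b div p) B"
  proof (rule inj_onI)
    fix a b assume ab: "a \<in> B" "b \<in> B" "a div p = b div p"
    have "p dvd a - b" using dvd_diff[OF assms(5)[OF ab(1)] assms(5)[OF ab(2)]] by simp
    then have "a mod p = b mod p" by (simp add: mod_eq_dvd_iff)
    with ab(3) show "a = b" by (metis mult_div_mod_eq)
  qed
  have "(\<lambda>b. b div p) ` B \<subseteq> {0..<N div p}"
  proof
    fix z assume "z \<in> (\<lambda>b. b div p) ` B"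
    then obtain b where b: "b \<in> B" "z = b div p" by blast
    then have "0 \<le> b" "b < p * (N div p)" using assms by auto
    then show "z \<in> {0..<N div p}"
      using b assms(2) by (auto simp: pos_imp_zdiv_nonneg_iff intro: int_div_less)
  qed
  then have "card B \<le> card {0..<N div p}"
    using card_inj_on_le[OF inj] by blast
  also have "\<dots> = nat (N div p)" by simp
  finally have "card B \<le> nat (N div p)" .
  moreover have "N div p \<ge> 0" using assms(1,2) by (simp add: pos_imp_zdiv_nonneg_iff)
  moreover have "real_of_int (N div p) = of_int N / of_int p"
    using assms by (simp add: real_of_int_div)
  ultimately show ?thesis by linarith
qed

lemma full_of_unit_period:
  fixes N :: int
  assumes "N > 0" "A \<subseteq> {0..<N}" "a \<in> A" "\<And>a. a \<in> A \<Longrightarrow> (a + 1) mod N \<in> A"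
  shows "A = {0..<N}"
proof -
  have "(a + int n) mod N \<in> A" for n
  proof (induction n)
    case 0
    then show ?case using assms by auto
  next
    case (Suc n)
    then have "((a + int n) mod N + 1) mod N \<in> A" by (rule assms(4))
    then show ?case by (simp add: mod_simps algebra_simps)
  qed
  then have "(a + int (nat ((x - a) mod N))) mod N \<in> A" for x .
  then have "x mod N \<in> A" for x using assms(1) by (simp add: mod_simps)
  then have "x \<in> A" if "x \<in> {0..<N}" for x
    using that by (metis atLeastLessThan_iff mod_pos_pos_trivial)
  then show ?thesis using assms(2) by blast
qed

text \<open>Here no e-transform can shrink \<open>B\<close>, because \<open>A\<close> is invariant
  under all differences of \<open>B\<close>. The convolution then equals
  \<open>card B \<ge> t\<close> on a translate of \<open>A\<close>, which already gives
  \<open>t * card A\<close>. If \<open>A\<close> is not everything, the differences of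
  \<open>B\<close> generate a proper subgroup modulo \<open>N\<close>, so \<open>B\<close> sits in a
  coset of it, \<open>card B \<le> D\<close>, and \<open>t * card A\<close> is enough.\<close>

lemma pollard_stable:
  fixes N :: int
  assumes "N > 0" and D: "\<And>p. prime p \<Longrightarrow> p dvd N \<Longrightarrow> of_int N / of_int p \<le> D"
    and sub: "A \<subseteq> {0..<N}" "B \<subseteq> {0..<N}"
    and t: "0 < t" "t \<le> real (card A)" "t \<le> real (card B)"
    and stable: "\<And>a b b'. a \<in> A \<Longrightarrow> b \<in> B \<Longrightarrow> b' \<in> B \<Longrightarrow> (a + (b - b')) mod N \<in> A"
  shows "t * min (of_int N) (real (card A) + real (card B) - D - t)
    \<le> (\<Sum>x\<in>{0..<N}. min t (conv N (ind A) (ind B) x))"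
proof -
  have "B \<noteq> {}" "A \<noteq> {}" using t by auto
  then obtain a0 b0 where a0: "a0 \<in> A" and b0: "b0 \<in> B" by blast
  have fin: "finite A" "finite B" using sub finite_subset by blast+
  have const: "conv N (ind A) (ind B) x = real (card B)" if x: "x \<in> translate N b0 A" for x
  proof -
    have x': "x \<in> {0..<N}" "(x - b0) mod N \<in> A" using x by (auto simp: translate_def)
    have "conv N (ind A) (ind B) x = conv N (ind B) (ind A) x"
      using conv_commute[OF assms(1), of "ind A" "ind B" x] x' by simp
    also have "\<dots> = (\<Sum>b\<in>{0..<N}. ind B b)"
      unfolding conv_def
    proof (intro sum.cong refl)
      fix b assume "b \<in> {0..<N}"
      show "ind B b * ind A ((x - b) mod N) = ind B b"
      proof (cases "b \<in> B")
        case True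
        have "((x - b0) mod N + (b0 - b)) mod N \<in> A"
          by (rule stable[OF x'(2) b0 True])
        then have "(x - b) mod N \<in> A" by (simp add: mod_simps)
        then show ?thesis by (simp add: ind_def)
      qed (simp add: ind_def)
    qed
    finally show ?thesis using sub by (simp add: sum_ind)
  qed
  have "t * real (card A) = (\<Sum>x\<in>translate N b0 A. t)"
    using card_translate[OF assms(1) sub(1), of b0] by simp
  also have "\<dots> = (\<Sum>x\<in>translate N b0 A. min t (conv N (ind A) (ind B) x))"
    by (intro sum.cong) (use const t in auto)
  also have "\<dots> \<le> (\<Sum>x\<in>{0..<N}. min t (conv N (ind A) (ind B) x))"
    using t by (intro sum_mono2) (auto simp: translate_def intro!: conv_nonneg)
  finally have *: "t * real (card A) \<le> (\<Sum>x\<in>{0..<N}. min t (conv N (ind A) (ind B) x))" .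
  have "min (of_int N) (real (card A) + real (card B) - D - t) \<le> real (card A)"
  proof (cases "A = {0..<N}")
    case True
    then show ?thesis using assms(1) by simp
  next
    case False
    define X where "X = (\<lambda>b. b - b0) ` B"
    define d where "d = Gcd (insert N X)"
    have per: "(a + d) mod N \<in> A" if "a \<in> A" for a
      unfolding d_def by (rule periods_dvd) (use assms(1) sub fin stable b0 that in \<open>auto simp: X_def\<close>)
    have "d \<noteq> 1" using full_of_unit_period[OF assms(1) sub(1) a0] per False by metis
    have "d dvd N" by (simp add: d_def)
    moreover have "d \<ge> 0" by (simp add: d_def)
    ultimately have "\<not> is_unit d" using \<open>d \<noteq> 1\<close> by simp
    moreover have "d \<noteq> 0" using \<open>d dvd N\<close> assms(1) by auto
    ultimately obtain p where p: "prime p" "p dvd d"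
      using prime_divisor_exists by blast
    have "p dvd b - b0" if "b \<in> B" for b
    proof -
      have "d dvd b - b0" unfolding d_def using that by (intro Gcd_dvd) (auto simp: X_def)
      then show ?thesis using p dvd_trans by blast
    qed
    then have "real (card B) \<le> of_int N / of_int p"
      using p \<open>d dvd N\<close> sub assms(1) by (intro card_residue_class_le) (auto simp: prime_gt_0_int intro: dvd_trans)
    also have "\<dots> \<le> D" using D p \<open>d dvd N\<close> dvd_trans by blast
    finally show ?thesis using t by simp
  qed
  then have "t * min (of_int N) (real (card A) + real (card B) - D - t) \<le> t * real (card A)"
    using t by (intro mult_left_mono) auto
  with * show ?thesis by linarith
qed

text \<open>For composite \<open>N\<close> this is due to Green and Ruzsa; \<open>D\<close> bounds the order of the proper subgroups.\<close>

theorem pollard: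
  fixes N :: int
  assumes "N > 0" and D: "\<And>p. prime p \<Longrightarrow> p dvd N \<Longrightarrow> of_int N / of_int p \<le> D" "D \<ge> 0"
    and "A \<subseteq> {0..<N}" "B \<subseteq> {0..<N}" "0 < t" "t \<le> card A" "t \<le> card B"
  shows "real t * min (of_int N) (real (card A) + real (card B) - D - real t)
    \<le> (\<Sum>x\<in>{0..<N}. min (real t) (conv N (ind A) (ind B) x))"
  using assms(4-)
proof (induction "card B" arbitrary: A B t rule: less_induct)
  case less
  note sub = less.prems(1,2)
  have fin: "finite A" "finite B" using sub finite_subset by blast+
  show ?case
  proof (cases "\<exists>e. translate N e A \<inter> B \<noteq> {} \<and> \<not> B \<subseteq> translate N e A")
    case False
    \<comment> \<open>Every translate of \<open>A\<close> that meets \<open>B\<close> contains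
      \<open>B\<close>, which is the stable case: the shift by \<open>b' - a\<close> moves
      \<open>a\<close> onto \<open>b'\<close>.\<close>
    have "(a + (b - b')) mod N \<in> A" if "a \<in> A" "b \<in> B" "b' \<in> B" for a b b'
    proof -
      have "b' \<in> translate N (b' - a) A" using that sub by (auto simp: translate_def)
      then have "b \<in> translate N (b' - a) A" using False that by blast
      then show ?thesis by (simp add: translate_def algebra_simps)
    qed
    then show ?thesis
      using assms less.prems by (intro pollard_stable) auto
  next
    case True
    then obtain e where e: "translate N e A \<inter> B \<noteq> {}" "\<not> B \<subseteq> translate N e A" by blast
    define A' where "A' = translate N e A"
    define U where "U = A' \<union> B"
    define I where "I = A' \<inter> B"
    have A': "A' \<subseteq> {0..<N}" "card A' = card A"
      using card_translate[OF assms(1) sub(1)] by (auto simp: A'_def translate_def)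
    then have "finite A'" using finite_subset by blast
    note A' = A'(1) this A'(2)
    have "(\<Sum>x\<in>{0..<N}. min (real t) (conv N (ind A') (ind B) x))
        = (\<Sum>x\<in>{0..<N}. min (real t) (conv N (ind A) (ind B) ((x + - e) mod N)))"
      by (simp add: A'_def conv_translate[OF assms(1)])
    also have "\<dots> = (\<Sum>x\<in>{0..<N}. min (real t) (conv N (ind A) (ind B) x))"
      by (rule sum_residue_shift[OF assms(1)])
    finally have shift: "(\<Sum>x\<in>{0..<N}. min (real t) (conv N (ind A) (ind B) x))
        = (\<Sum>x\<in>{0..<N}. min (real t) (conv N (ind A') (ind B) x))" ..
    have subUI: "U \<subseteq> {0..<N}" "I \<subseteq> {0..<N}" "finite U" "finite I"
      using A' sub fin by (auto simp: U_def I_def)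
    have cardI: "0 < card I" "card I < card B"
      using e fin by (auto simp: I_def A'_def card_gt_0_iff intro!: psubset_card_mono)
    have cardUI: "card U + card I = card A + card B"
      using card_Un_Int[OF A'(2) fin(2)] A'(3) by (simp add: U_def I_def)
    have split: "conv N (ind A') (ind B) x = conv N (ind U) (ind I) x + conv N (ind (A' - B)) (ind (B - A')) x"
      if "x \<in> {0..<N}" for x
      unfolding U_def I_def by (rule conv_Un_Int[OF assms(1) that])
    show ?thesis
    proof (cases "t \<le> card I")
      case True
      \<comment> \<open>The pair \<open>U\<close>, \<open>I\<close> has the same total cardinality,
        a smaller second member and a pointwise smaller convolution, so induction applies at the
        same level \<open>t\<close>.\<close>
      have "card I \<le> card U" using subUI by (intro card_mono) (auto simp: U_def I_def)
      then have "real t * min (of_int N) (real (card U) + real (card I) - D - real t)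
          \<le> (\<Sum>x\<in>{0..<N}. min (real t) (conv N (ind U) (ind I) x))"
        using True less.prems subUI cardI by (intro less.hyps) auto
      also have "\<dots> \<le> (\<Sum>x\<in>{0..<N}. min (real t) (conv N (ind A') (ind B) x))"
        by (intro sum_mono min.mono order_refl) (simp add: split conv_nonneg)
      finally show ?thesis
        using cardUI unfolding shift by (simp flip: of_nat_add)
    next
      case False
      \<comment> \<open>The convolution of \<open>U\<close> and \<open>I\<close> never exceeds
        \<open>i\<close>, so truncating it at \<open>i\<close> loses nothing, and its sum is
        \<open>card U * i\<close>. The remaining level \<open>t - i\<close> is left to the two
        differences, whose second member has shrunk by \<open>i\<close>.\<close>
      define i where "i = card I"
      have i: "0 < i" "i < t" using False cardI by (auto simp: i_def)
      have cards: "card (A' - B) = card A - i" "card (B - A') = card B - i"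
        using A' fin by (simp_all add: i_def I_def card_Diff_subset_Int Int_commute)
      have "real (t - i) * min (of_int N) (real (card (A' - B)) + real (card (B - A')) - D - real (t - i))
          \<le> (\<Sum>x\<in>{0..<N}. min (real (t - i)) (conv N (ind (A' - B)) (ind (B - A')) x))"
        using less.prems A' cardI i cards by (intro less.hyps) auto
      moreover have "(\<Sum>x\<in>{0..<N}. min (real i) (conv N (ind U) (ind I) x)) = real (card U) * real i"
      proof -
        have "(\<Sum>x\<in>{0..<N}. min (real i) (conv N (ind U) (ind I) x)) = (\<Sum>x\<in>{0..<N}. conv N (ind U) (ind I) x)"
          using conv_ind_le_card_right[OF assms(1) subUI(2), of U]
          by (intro sum.cong) (auto simp: i_def min_def intro: antisym)
        then show ?thesis using subUI by (simp add: sum_conv[OF assms(1)] sum_ind i_def)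
      qed
      moreover have "(\<Sum>x\<in>{0..<N}. min (real i) (conv N (ind U) (ind I) x))
          + (\<Sum>x\<in>{0..<N}. min (real (t - i)) (conv N (ind (A' - B)) (ind (B - A')) x))
          \<le> (\<Sum>x\<in>{0..<N}. min (real t) (conv N (ind A') (ind B) x))"
        unfolding sum.distrib[symmetric] using i
        by (intro sum_mono) (auto simp: split of_nat_diff)
      moreover have "min (of_int N) (real (card (A' - B)) + real (card (B - A')) - D - real (t - i))
          = real (card U) - D - real t"
      proof -
        have "card U \<le> card {0..<N}" using subUI by (intro card_mono) auto
        then have "real (card U) \<le> of_int N" using assms(1) by simp
        moreover have "real (card (A' - B)) + real (card (B - A')) - D - real (t - i) = real (card U) - D - real t"
          using cards cardUI i less.prems by (simp add: of_nat_diff i_def[symmetric] flip: of_nat_add)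
        ultimately show ?thesis using D(2) by simp
      qed
      moreover have "real (card U) = real (card A) + real (card B) - real i"
        using cardUI by (simp add: i_def flip: of_nat_add)
      ultimately have "(real (card A) + real (card B) - real i) * real i
          + (real t - real i) * (real (card A) + real (card B) - real i - D - real t)
          \<le> (\<Sum>x\<in>{0..<N}. min (real t) (conv N (ind A') (ind B) x))"
        using i by (simp add: of_nat_diff)
      \<comment> \<open>The right-hand side exceeds the left one by exactly
        \<open>i * D\<close>.\<close>
      moreover have "real t * (real (card A) + real (card B) - D - real t)
          \<le> (real (card A) + real (card B) - real i) * real i
          + (real t - real i) * (real (card A) + real (card B) - real i - D - real t)"
        using D(2) by (simp add: algebra_simps)
      moreover have "real t * min (of_int N) (real (card A) + real (card B) - D - real t)
          \<le> real t * (real (card A) + real (card B) - D - real t)"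
        by (intro mult_left_mono) auto
      ultimately show ?thesis unfolding shift by linarith
    qed
  qed
qed

text \<open>Pollard at a level \<open>t\<close> between \<xi>N/8 and \<xi>N/4. A popular residue
  contributes at most about \<open>t\<close>, and all the others together at most \<xi>^2 N^2 / 32,
  which is at most \<open>t\<close> times \<xi>N/4; this fixes the constant 32. The losses from
  \<open>D\<close>, from \<open>t\<close> and from the unpopular residues are each at most
  \<xi>N/4.\<close>

lemma popular_sums:
  fixes N :: int and \<xi> :: real
  assumes "N > 0" "0 < \<xi>" "8 / \<xi> \<le> of_int N"
    and D: "\<And>p. prime p \<Longrightarrow> p dvd N \<Longrightarrow> 4 / \<xi> \<le> of_int p"
    and sub: "A \<subseteq> {0..<N}" "B \<subseteq> {0..<N}"
    and card: "\<xi> * of_int N / 4 \<le> real (card A)" "\<xi> * of_int N / 4 \<le> real (card B)"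
  defines "P \<equiv> {x \<in> {0..<N}. conv N (ind A) (ind B) x \<ge> \<xi>\<^sup>2 / 32 * of_int N}"
  shows "real (card P) \<ge> min (of_int N) (real (card A) + real (card B)) - \<xi> * of_int N"
proof -
  \<comment> \<open>Pollard needs an integral level; since \<xi>N/4 is at least 2, rounding down
    costs at most half of it.\<close>
  define t where "t = nat \<lfloor>\<xi> * of_int N / 4\<rfloor>"
  define D' where "D' = \<xi> * of_int N / 4"
  have D'0: "D' \<ge> 0" using assms by (simp add: D'_def)
  have t_le: "real t \<le> D'"
  proof -
    have "real t = of_int \<lfloor>D'\<rfloor>" using D'0 by (simp add: t_def D'_def)
    then show ?thesis by simp
  qed
  have N8: "8 \<le> \<xi> * of_int N" using assms(2,3) by (simp add: field_simps)
  have "real t > D' - 1"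
    unfolding t_def D'_def using N8 by linarith
  then have t_ge: "real t \<ge> \<xi> * of_int N / 8" using N8 by (simp add: D'_def)
  then have t0: "real t > 0" using N8 by simp
  have "of_int N / of_int p \<le> D'" if p: "prime p" "p dvd N" for p
  proof -
    have "p > 0" using p prime_gt_0_int by blast
    have "4 \<le> \<xi> * of_int p" using D[OF p] assms(2) by (simp add: field_simps)
    then have "of_int N * 4 \<le> of_int N * (\<xi> * of_int p)" using assms(1) by (intro mult_left_mono) auto
    then show ?thesis using \<open>p > 0\<close> by (simp add: D'_def field_simps)
  qed
  then have "real t * min (of_int N) (real (card A) + real (card B) - D' - real t)
      \<le> (\<Sum>x\<in>{0..<N}. min (real t) (conv N (ind A) (ind B) x))"
    using D'0 t0 t_le card sub assms(1) by (intro pollard) (auto simp: D'_def)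
  also have "\<dots> \<le> (\<Sum>x\<in>{0..<N}. real t * ind P x + \<xi>\<^sup>2 / 32 * of_int N)"
  proof (intro sum_mono)
    fix x assume "x \<in> {0..<N}"
    have "0 \<le> \<xi>\<^sup>2 / 32 * of_int N" using assms(1) by simp
    then have "min (real t) (conv N (ind A) (ind B) x) \<le> real t + \<xi>\<^sup>2 / 32 * of_int N" by linarith
    with \<open>x \<in> {0..<N}\<close> show "min (real t) (conv N (ind A) (ind B) x) \<le> real t * ind P x + \<xi>\<^sup>2 / 32 * of_int N"
      by (cases "x \<in> P") (auto simp: P_def ind_def)
  qed
  also have "\<dots> = real t * real (card P) + \<xi>\<^sup>2 / 32 * of_int N * of_int N"
  proof -
    have "(\<Sum>x\<in>{0..<N}. ind P x) = real (card P)" by (rule sum_ind) (auto simp: P_def)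
    then show ?thesis using assms(1) by (simp add: sum.distrib algebra_simps flip: sum_distrib_left)
  qed
  also have "\<xi>\<^sup>2 / 32 * of_int N * of_int N \<le> real t * (\<xi> * of_int N / 4)"
  proof -
    have "\<xi> * of_int N / 8 * (\<xi> * of_int N / 4) \<le> real t * (\<xi> * of_int N / 4)"
      using t_ge assms(1,2) by (intro mult_right_mono) auto
    then show ?thesis by (simp add: power2_eq_square algebra_simps)
  qed
  finally have "real t * min (of_int N) (real (card A) + real (card B) - D' - real t)
      \<le> real t * (real (card P) + \<xi> * of_int N / 4)"
    by (simp add: algebra_simps)
  then have "min (of_int N) (real (card A) + real (card B) - D' - real t) \<le> real (card P) + \<xi> * of_int N / 4"
    using t0 by (simp only: mult_le_cancel_left_pos)
  then show ?thesis using t_le assms(1,2) by (simp add: D'_def min_def split: if_splits)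
qed

section \<open>Iterated convolutions and the s-fold count\<close>

lemma conv_indicator_0:
  assumes "N > 0" "x \<in> {0..<N}"
  shows "conv N f (indicator {0}) x = f x"
proof -
  have "conv N f (indicator {0}) x = (\<Sum>a\<in>{0..<N}. if a = x then f a else 0)"
    unfolding conv_def
  proof (intro sum.cong refl)
    fix a assume "a \<in> {0..<N}"
    then have "(x - a) mod N = 0 \<longleftrightarrow> a = x"
      using assms by (auto simp: mod_eq_0_iff_dvd mod_eq_dvd_iff[symmetric])
    then show "f a * indicator {0} ((x - a) mod N) = (if a = x then f a else 0)"
      by auto
  qed
  then show ?thesis using assms by simp
qed

lemma conv_cmult_right: "conv N f (\<lambda>x. c * g x) x = c * conv N f g x"
  by (simp add: conv_def sum_distrib_left algebra_simps)

lemma cpow_nonneg: "(\<And>x. f x \<ge> 0) \<Longrightarrow> cpow N f n x \<ge> 0"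
  by (induction n arbitrary: x) (auto intro: conv_nonneg)

lemma cpow_mono: "(\<And>x. 0 \<le> f x) \<Longrightarrow> (\<And>x. f x \<le> g x) \<Longrightarrow> cpow N f n x \<le> cpow N g n x"
  by (induction n arbitrary: x) (auto intro!: conv_mono cpow_nonneg)

lemma cpow_cmult: "cpow N (\<lambda>x. c * f x) n x = c ^ n * cpow N f n x"
proof (induction n arbitrary: x)
  case (Suc n)
  have "cpow N (\<lambda>x. c * f x) (Suc n) x = conv N (\<lambda>x. c * f x) (\<lambda>x. c ^ n * cpow N f n x) x"
    by (simp add: conv_def Suc.IH)
  then show ?case by (simp add: conv_def sum_distrib_left algebra_simps)
qed simp

lemma conv_ge_popular:
  assumes "\<And>x. f x \<ge> 0" "\<And>x. g x \<ge> 0" "c \<ge> 0" "\<And>x. x \<in> P \<Longrightarrow> c \<le> g x"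
  shows "conv N f g x \<ge> c * conv N f (ind P) x"
proof -
  have "conv N f (\<lambda>x. c * ind P x) x \<le> conv N f g x"
    using assms by (intro conv_mono) (auto simp: ind_def indicator_def)
  then show ?thesis by (simp add: conv_cmult_right)
qed

text \<open>Pigeonhole in pointwise form: a product of two indicator values is at least their sum
  minus 1.\<close>

lemma conv_ind_ge:
  assumes "N > 0" "A \<subseteq> {0..<N}" "B \<subseteq> {0..<N}"
  shows "conv N (ind A) (ind B) x \<ge> real (card A) + real (card B) - of_int N"
proof -
  have "(\<Sum>a\<in>{0..<N}. ind A a + ind B ((x - a) mod N) - 1) \<le> conv N (ind A) (ind B) x"
    unfolding conv_def by (intro sum_mono) (auto simp: ind_def indicator_def)
  moreover have "(\<Sum>a\<in>{0..<N}. ind B ((x - a) mod N)) = real (card B)"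
    using sum_residue_reflect[OF assms(1), of "ind B"] assms(3) by (simp add: sum_ind)
  ultimately show ?thesis using assms by (simp add: sum.distrib sum_subtractf sum_ind)
qed

text \<open>Popular sums are iterated: on a set of density at least
  \<open>min 1 (j * \<beta>) - (j - 1) * \<xi>\<close> there are at least
  \<open>\<tau> ^ (j - 1)\<close> representations by \<open>j\<close> elements of \<open>B\<close>,
  each further summand costing density \<open>\<xi>\<close> and gaining a factor
  \<open>\<tau>\<close>.\<close>

lemma cpow_ind_lower_bound:
  fixes N :: int and \<xi> \<beta> :: real
  assumes "N > 0" "0 < \<xi>" "8 / \<xi> \<le> of_int N"
    and D: "\<And>p. prime p \<Longrightarrow> p dvd N \<Longrightarrow> 4 / \<xi> \<le> of_int p"
    and B: "B \<subseteq> {0..<N}" "\<beta> * of_int N \<le> real (card B)"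
    and \<xi>: "2 * (real s + 1) * \<xi> \<le> \<beta>" "2 * (real s + 1) * \<xi> \<le> real s * \<beta> - 1"
    and s: "s \<ge> 2" and x: "x \<in> {0..<N}"
  shows "cpow N (ind B) s x \<ge> (\<xi>\<^sup>2 / 32) ^ (s - 2) * \<xi> * of_int N ^ (s - 1)"
proof -
  define \<tau> where "\<tau> = \<xi>\<^sup>2 / 32 * of_int N"
  have \<tau>: "\<tau> \<ge> 0" using assms(1) by (simp add: \<tau>_def)
  have N: "real_of_int N > 0" using assms(1) by simp
  have "card B \<le> card {0..<N}" using B(1) by (intro card_mono) auto
  then have "real (card B) \<le> of_int N" using assms(1) by simp
  with B(2) have "\<beta> * of_int N \<le> 1 * of_int N" by simp
  then have \<beta>1: "\<beta> \<le> 1" using N by (simp only: mult_le_cancel_right_pos)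
  have \<xi>\<beta>: "\<xi> \<le> \<beta>"
  proof -
    have "1 * \<xi> \<le> 2 * (real s + 1) * \<xi>" using assms(2) by (intro mult_right_mono) auto
    with \<xi>(1) show ?thesis by simp
  qed
  have "\<exists>P. P \<subseteq> {0..<N} \<and> (min 1 (real j * \<beta>) - real (j - 1) * \<xi>) * of_int N \<le> real (card P)
      \<and> (\<forall>x\<in>P. cpow N (ind B) j x \<ge> \<tau> ^ (j - 1))" if "1 \<le> j" "j \<le> s" for j
    using that
  proof (induction j rule: dec_induct)
    case base
    have "(min 1 (real 1 * \<beta>) - real (1 - 1) * \<xi>) * of_int N = \<beta> * of_int N" using \<beta>1 by simp
    then show ?case using B assms(1)
      by (intro exI[of _ B]) (auto simp: conv_indicator_0 ind_def)
  next
    case (step j)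
    then obtain P where P: "P \<subseteq> {0..<N}"
      "(min 1 (real j * \<beta>) - real (j - 1) * \<xi>) * of_int N \<le> real (card P)"
      "\<And>x. x \<in> P \<Longrightarrow> cpow N (ind B) j x \<ge> \<tau> ^ (j - 1)"
      by auto
    define Q where "Q = {x \<in> {0..<N}. conv N (ind B) (ind P) x \<ge> \<xi>\<^sup>2 / 32 * of_int N}"
    have "real (card Q) \<ge> min (of_int N) (real (card B) + real (card P)) - \<xi> * of_int N"
      unfolding Q_def
    proof (rule popular_sums[OF assms(1-3) D B(1) P(1)])
      have "\<xi> * of_int N \<le> \<beta> * of_int N" using \<xi>\<beta> N by simp
      moreover have "\<xi> * of_int N \<ge> 0" using N assms(2) by simp
      ultimately show "\<xi> * of_int N / 4 \<le> real (card B)" using B(2) by linarith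
      have "1 * \<beta> \<le> real j * \<beta>" using step \<xi>\<beta> assms(2) by (intro mult_right_mono) auto
      then have "\<beta> \<le> min 1 (real j * \<beta>)" using \<beta>1 by simp
      moreover have "real (j - 1) * \<xi> \<le> real s * \<xi>" using step assms(2) by (intro mult_right_mono) auto
      moreover have "real s * \<xi> + \<xi> \<le> \<beta>"
      proof -
        have "0 \<le> real s * \<xi>" using assms(2) by simp
        moreover have "2 * (real s + 1) * \<xi> = 2 * (real s * \<xi>) + 2 * \<xi>" by (simp add: algebra_simps)
        ultimately show ?thesis using \<xi>(1) assms(2) by linarith
      qed
      ultimately have "\<xi> / 4 \<le> min 1 (real j * \<beta>) - real (j - 1) * \<xi>" using assms(2) by linarith
      then have "\<xi> / 4 * of_int N \<le> (min 1 (real j * \<beta>) - real (j - 1) * \<xi>) * of_int N"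
        using N by (intro mult_right_mono) auto
      then show "\<xi> * of_int N / 4 \<le> real (card P)" using P(2) by simp
    qed
    moreover have "(min 1 (real (Suc j) * \<beta>) - real (Suc j - 1) * \<xi>) * of_int N
        \<le> min (of_int N) (real (card B) + real (card P)) - \<xi> * of_int N"
    proof -
      have "min 1 (real (Suc j) * \<beta>) - real (Suc j - 1) * \<xi> + \<xi> \<le> 1"
      proof -
        have "1 * \<xi> \<le> real j * \<xi>" using assms(2) step by (intro mult_right_mono) auto
        moreover have "min 1 (real (Suc j) * \<beta>) \<le> 1" by simp
        ultimately show ?thesis by (simp only: diff_Suc_1)
      qed
      then have 1: "(min 1 (real (Suc j) * \<beta>) - real (Suc j - 1) * \<xi> + \<xi>) * of_int N \<le> 1 * of_int N"
        using N by (intro mult_right_mono) auto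
      have "min 1 (real (Suc j) * \<beta>) - real (Suc j - 1) * \<xi> + \<xi> \<le> \<beta> + (min 1 (real j * \<beta>) - real (j - 1) * \<xi>)"
        using step assms(2) \<xi>\<beta> by (auto simp: of_nat_diff algebra_simps min_def)
      then have "(min 1 (real (Suc j) * \<beta>) - real (Suc j - 1) * \<xi> + \<xi>) * of_int N
          \<le> (\<beta> + (min 1 (real j * \<beta>) - real (j - 1) * \<xi>)) * of_int N"
        using N by (intro mult_right_mono) auto
      then show ?thesis using 1 B(2) P(2) by (simp add: algebra_simps)
    qed
    moreover have "cpow N (ind B) (Suc j) x \<ge> \<tau> ^ (Suc j - 1)" if "x \<in> Q" for x
    proof -
      have "\<tau> ^ j = \<tau> ^ (j - 1) * \<tau>" using step by (metis Suc_diff_1 less_eq_Suc_le One_nat_def power_Suc2)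
      also have "\<dots> \<le> \<tau> ^ (j - 1) * conv N (ind B) (ind P) x"
        using that \<tau> by (intro mult_left_mono) (auto simp: Q_def \<tau>_def)
      also have "\<dots> \<le> cpow N (ind B) (Suc j) x"
        using P(3) \<tau> by (auto intro!: conv_ge_popular cpow_nonneg)
      finally show ?thesis by simp
    qed
    ultimately show ?case by (intro exI[of _ Q]) (auto simp: Q_def)
  qed
  \<comment> \<open>A further popular sum would reach only most residues. Stopping at
    \<open>s - 1\<close> leaves \<open>B\<close> and the popular set with total density at least
    \<open>1 + \<xi>\<close>, so pigeonhole reaches every \<open>x\<close>.\<close>
  note this[of "s - 1"]
  moreover have "s - 1 - 1 = s - 2" "1 \<le> s - 1" "s - 1 \<le> s" using s by auto
  ultimately obtain P where P: "P \<subseteq> {0..<N}"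
      "(min 1 (real (s - 1) * \<beta>) - real (s - 2) * \<xi>) * of_int N \<le> real (card P)"
      "\<And>x. x \<in> P \<Longrightarrow> cpow N (ind B) (s - 1) x \<ge> \<tau> ^ (s - 2)"
    by auto
  have "\<xi> \<le> \<beta> + (min 1 (real (s - 1) * \<beta>) - real (s - 2) * \<xi>) - 1"
  proof -
    have "0 \<le> real s * \<xi>" using assms(2) by simp
    moreover have "2 * (real s + 1) * \<xi> = 2 * (real s * \<xi>) + 2 * \<xi>" by (simp add: algebra_simps)
    moreover have "real (s - 2) * \<xi> = real s * \<xi> - 2 * \<xi>" "real (s - 1) * \<beta> = real s * \<beta> - \<beta>"
      using s by (simp_all add: of_nat_diff algebra_simps)
    ultimately show ?thesis using \<xi> assms(2) by linarith
  qed
  then have "\<xi> * of_int N \<le> (\<beta> + (min 1 (real (s - 1) * \<beta>) - real (s - 2) * \<xi>) - 1) * of_int N"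
    using N by (intro mult_right_mono) auto
  also have "\<dots> \<le> conv N (ind B) (ind P) x"
    using conv_ind_ge[OF assms(1) B(1) P(1), of x] B(2) P(2) by (simp add: algebra_simps)
  finally have "\<tau> ^ (s - 2) * (\<xi> * of_int N) \<le> \<tau> ^ (s - 2) * conv N (ind B) (ind P) x"
    using \<tau> by (intro mult_left_mono) auto
  also have "\<dots> \<le> conv N (ind B) (cpow N (ind B) (s - 1)) x"
    using P(3) \<tau> by (auto intro!: conv_ge_popular cpow_nonneg)
  also have "\<dots> = cpow N (ind B) (Suc (s - 1)) x" by simp
  also have "Suc (s - 1) = s" using s by simp
  finally have "\<tau> ^ (s - 2) * (\<xi> * of_int N) \<le> cpow N (ind B) s x" .
  moreover have "\<tau> ^ (s - 2) * (\<xi> * of_int N) = (\<xi>\<^sup>2 / 32) ^ (s - 2) * \<xi> * of_int N ^ (s - 1)"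
  proof -
    have "s - 1 = Suc (s - 2)" using s by simp
    then show ?thesis by (simp add: \<tau>_def power_mult_distrib power_divide)
  qed
  ultimately show ?thesis by simp
qed

section \<open>Smoothing on a cell\<close>

lemma norm_ft_ind_sq:
  assumes "N > 0" "C \<subseteq> {0..<N}"
  shows "of_real ((norm (ft N (ind C) k))\<^sup>2) = (\<Sum>a\<in>C. \<Sum>b\<in>C. ee N (k * (a - b)))"
proof -
  have "ft N (ind C) k = (\<Sum>a\<in>C. ee N (k * a))"
    unfolding ft_def using assms by (intro sum.mono_neutral_cong_right) (auto simp: ind_def)
  then show ?thesis
    by (simp add: complex_norm_square sum_product cnj_ee cnj_sum algebra_simps del: of_real_power flip: ee_add)
qed

text \<open>Dirichlet's pigeonhole argument: \<open>x\<close> is labelled by the arc of length 1/m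
  that contains the fractional part of kx/N, for each \<open>k\<close> in \<open>\<Lambda>\<close>.
  There are \<open>m ^ card \<Lambda>\<close> labels, and \<open>C\<close> is a most popular
  class.\<close>

lemma cell_exists:
  fixes N :: int and m :: nat and \<Lambda> :: "int set"
  assumes "N > 0" "m > 0" "finite \<Lambda>"
  shows "\<exists>C\<subseteq>{0..<N}. of_int N \<le> real (card C) * real m ^ card \<Lambda> \<and>
    (\<forall>k\<in>\<Lambda>. \<forall>a\<in>C. \<forall>b\<in>C. norm (ee N (k * (a - b)) - 1) \<le> 2 * pi / real m)"
proof -
  define \<phi> where "\<phi> x = (\<lambda>k\<in>\<Lambda>. (int m * ((k * x) mod N)) div N)" for x
  have \<phi>: "\<phi> \<in> {0..<N} \<rightarrow> PiE \<Lambda> (\<lambda>_. {0..<int m})"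
  proof (intro Pi_I)
    fix x
    have "(int m * ((k * x) mod N)) div N \<in> {0..<int m}" for k
      using assms by (auto simp: pos_imp_zdiv_nonneg_iff mult.commute intro: int_div_less)
    then show "\<phi> x \<in> PiE \<Lambda> (\<lambda>_. {0..<int m})" by (auto simp: \<phi>_def)
  qed
  have "(\<lambda>k\<in>\<Lambda>. 0) \<in> PiE \<Lambda> (\<lambda>_. {0..<int m})" using assms by auto
  then have "PiE \<Lambda> (\<lambda>_. {0..<int m}) \<noteq> {}" by blast
  moreover have "finite (PiE \<Lambda> (\<lambda>_. {0..<int m}))" using assms by (intro finite_PiE) auto
  ultimately obtain c where c: "card {0..<N} \<le> card (\<phi> -` {c} \<inter> {0..<N}) * card (PiE \<Lambda> (\<lambda>_. {0..<int m}))"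
    using pigeonhole_card[OF \<phi>] by auto
  define C where "C = \<phi> -` {c} \<inter> {0..<N}"
  have "nat N \<le> card C * m ^ card \<Lambda>"
    using c assms by (simp add: C_def card_PiE)
  then have "real (nat N) \<le> real (card C * m ^ card \<Lambda>)" by (simp only: of_nat_le_iff)
  then have "of_int N \<le> real (card C) * real m ^ card \<Lambda>" using assms(1) by simp
  moreover have "norm (ee N (k * (a - b)) - 1) \<le> 2 * pi / real m" if "k \<in> \<Lambda>" "a \<in> C" "b \<in> C" for k a b
  proof -
    define u v where "u = int m * ((k * a) mod N)" and "v = int m * ((k * b) mod N)"
    have "\<phi> a = \<phi> b" using that by (simp add: C_def)
    then have "\<phi> a k = \<phi> b k" by simp
    then have eq: "u div N = v div N" using that by (simp add: \<phi>_def u_def v_def)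
    have "u - v = u mod N - v mod N"
      by (metis eq add_diff_cancel_left mult_div_mod_eq)
    moreover have "u mod N < N" "v mod N < N" "u mod N \<ge> 0" "v mod N \<ge> 0" using assms by auto
    ultimately have "\<bar>u - v\<bar> \<le> N" by linarith
    then have uv: "real_of_int \<bar>u - v\<bar> \<le> of_int N" by (simp only: of_int_le_iff)
    define d where "d = (k * a) mod N - (k * b) mod N"
    have "u - v = int m * d" by (simp add: u_def v_def d_def right_diff_distrib)
    then have "real_of_int \<bar>u - v\<bar> = real m * \<bar>of_int d\<bar>" by (simp add: abs_mult)
    with uv have "real m * \<bar>of_int d\<bar> \<le> of_int N" by simp
    then have *: "\<bar>of_int d / of_int N\<bar> \<le> 1 / real m"
      using assms by (simp add: abs_divide pos_divide_le_eq pos_le_divide_eq mult.commute)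
    have "k * (a - b) mod N = d mod N"
      unfolding d_def by (simp only: mod_diff_eq right_diff_distrib)
    then have "ee N (k * (a - b)) = ee N d"
      using assms by (intro ee_cong) (auto simp: Cong.cong_def)
    then have "norm (ee N (k * (a - b)) - 1) \<le> 2 * pi * \<bar>of_int d / of_int N\<bar>"
      using norm_ee_minus_1_le[of N d] by simp
    also have "\<dots> \<le> 2 * pi * (1 / real m)" by (intro mult_left_mono *) auto
    finally show ?thesis by simp
  qed
  ultimately show ?thesis by (intro exI[of _ C]) (auto simp: C_def)
qed

text \<open>The kernel is the autocorrelation of the uniform measure on a cell, so its transform is the squared
  modulus of the transform of that measure.\<close>

lemma smoothing_kernel:
  fixes N :: int and m :: nat and \<Lambda> :: "int set"
  assumes "N > 0" "m > 0" "finite \<Lambda>"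
  obtains K w where "\<And>x. K x \<ge> 0" "\<And>k. ft N K k = of_real (w k)"
    "\<And>k. 0 \<le> w k" "\<And>k. w k \<le> 1" "w 0 = (1::real)"
    "\<And>k. k \<in> \<Lambda> \<Longrightarrow> 1 - 2 * pi / real m \<le> w k"
    "(\<Sum>k\<in>{0..<N}. w k) \<le> real m ^ card \<Lambda>"
proof -
  obtain C where C: "C \<subseteq> {0..<N}" "of_int N \<le> real (card C) * real m ^ card \<Lambda>"
    "\<And>k a b. k \<in> \<Lambda> \<Longrightarrow> a \<in> C \<Longrightarrow> b \<in> C \<Longrightarrow> norm (ee N (k * (a - b)) - 1) \<le> 2 * pi / real m"
    using cell_exists[OF assms] by blast
  define n where "n = real (card C)"
  have finC: "finite C" using C(1) finite_subset by blast
  have "card C \<noteq> 0"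
  proof
    assume "card C = 0"
    then show False using C(2) assms(1) by simp
  qed
  then have n: "n > 0" by (simp add: n_def)
  define \<mu> where "\<mu> x = 1 / n * ind C x" for x
  define K where "K = conv N \<mu> (\<lambda>x. \<mu> ((- x) mod N))"
  define w where "w k = (norm (ft N \<mu> k))\<^sup>2" for k
  have ft\<mu>: "ft N \<mu> k = of_real (1 / n) * ft N (ind C) k" for k
    unfolding \<mu>_def by (rule ft_cmult)
  have w_eq: "w k = (norm (ft N (ind C) k))\<^sup>2 / n\<^sup>2" for k
    using n by (simp add: w_def ft\<mu> norm_mult power_mult_distrib norm_divide power_divide)
  have sum_C: "(\<Sum>x\<in>{0..<N}. ind C x) = n" using C(1) by (simp add: sum_ind n_def)
  show ?thesis
  proof (rule that)
    show "K x \<ge> 0" for x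
      unfolding K_def using n by (intro conv_nonneg) (auto simp: \<mu>_def)
    show "ft N K k = of_real (w k)" for k
      by (simp add: K_def ft_conv[OF assms(1)] ft_reflect[OF assms(1)] w_def complex_norm_square del: of_real_power)
    show "0 \<le> w k" for k by (simp add: w_def)
    show "w k \<le> 1" for k
    proof -
      have "norm (ft N (ind C) k) \<le> n" using norm_ft_le[of "ind C" N k] sum_C by simp
      then have "(norm (ft N (ind C) k))\<^sup>2 \<le> n\<^sup>2" by (intro power_mono) auto
      then show ?thesis using n by (simp add: w_eq)
    qed
    show "w 0 = 1" using n by (simp add: w_eq ft_0 sum_C flip: of_real_sum)
    show "1 - 2 * pi / real m \<le> w k" if "k \<in> \<Lambda>" for k
    proof -
      \<comment> \<open>The squared modulus is a double sum over the cell whose \<open>n^2\<close>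
        terms all lie within \<open>2 * pi / m\<close> of 1.\<close>
      have "of_real ((norm (ft N (ind C) k))\<^sup>2 - n\<^sup>2) = (\<Sum>a\<in>C. \<Sum>b\<in>C. ee N (k * (a - b)) - 1)"
        using norm_ft_ind_sq[OF assms(1) C(1), of k]
        by (simp add: sum_subtractf n_def power2_eq_square)
      then have "\<bar>(norm (ft N (ind C) k))\<^sup>2 - n\<^sup>2\<bar> = norm (\<Sum>a\<in>C. \<Sum>b\<in>C. ee N (k * (a - b)) - 1)"
        by (metis norm_of_real)
      also have "\<dots> \<le> (\<Sum>a\<in>C. \<Sum>b\<in>C. 2 * pi / real m)"
        using C(3)[OF that] by (intro sum_norm_le) auto
      also have "\<dots> = n\<^sup>2 * (2 * pi / real m)" by (simp add: n_def power2_eq_square)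
      finally have "n\<^sup>2 * (1 - 2 * pi / real m) \<le> (norm (ft N (ind C) k))\<^sup>2"
        by (simp add: algebra_simps abs_if split: if_splits)
      then show ?thesis using n by (simp add: w_eq field_simps)
    qed
    \<comment> \<open>By Parseval the total weight is N/n; this is where the lower bound on the size
      of the cell is used.\<close>
    have "(\<Sum>k\<in>{0..<N}. w k) = of_int N * (\<Sum>x\<in>{0..<N}. (\<mu> x)\<^sup>2)"
      unfolding w_def by (rule parseval[OF assms(1)])
    also have "(\<Sum>x\<in>{0..<N}. (\<mu> x)\<^sup>2) = (\<Sum>x\<in>{0..<N}. 1 / n\<^sup>2 * ind C x)"
      by (intro sum.cong) (auto simp: \<mu>_def ind_def indicator_def power_divide)
    also have "\<dots> = 1 / n"
      using n by (simp add: sum_C power2_eq_square flip: sum_divide_distrib)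
    finally have "n * (\<Sum>k\<in>{0..<N}. w k) \<le> n * real m ^ card \<Lambda>"
      using C(2) n by (simp add: n_def)
    then show "(\<Sum>k\<in>{0..<N}. w k) \<le> real m ^ card \<Lambda>"
      using n by (simp only: mult_le_cancel_left_pos)
  qed
qed

section \<open>Bilinear kernel bounds\<close>

text \<open>The kernel maps \<open>\<ell>\<close> with exponent \<open>9/7\<close> to its dual, of exponent \<open>9/2\<close>. Any exponent strictly between
  \<open>4\<close> and \<open>5\<close> could replace \<open>9/2\<close>.\<close>

definition kbound :: "'a set \<Rightarrow> ('a \<Rightarrow> 'a \<Rightarrow> real) \<Rightarrow> real \<Rightarrow> bool" where
  "kbound X K A \<longleftrightarrow> (\<forall>u v. (\<forall>x. u x \<ge> 0) \<longrightarrow> (\<forall>x. v x \<ge> 0) \<longrightarrow>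
    (\<Sum>x\<in>X. \<Sum>y\<in>X. K x y * u x * v y)
      \<le> A * (\<Sum>x\<in>X. u x powr (9/7)) powr (7/9) * (\<Sum>x\<in>X. v x powr (9/7)) powr (7/9))"

lemma kboundD:
  "kbound X K A \<Longrightarrow> (\<And>x. u x \<ge> 0) \<Longrightarrow> (\<And>x. v x \<ge> 0) \<Longrightarrow>
    (\<Sum>x\<in>X. \<Sum>y\<in>X. K x y * u x * v y)
      \<le> A * (\<Sum>x\<in>X. u x powr (9/7)) powr (7/9) * (\<Sum>x\<in>X. v x powr (9/7)) powr (7/9)"
  unfolding kbound_def by blast

lemma kbound_mono: "kbound X K A \<Longrightarrow> A \<le> B \<Longrightarrow> kbound X K B"
  unfolding kbound_def by (meson mult_right_mono order_trans powr_ge_zero)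

lemma kbound_cmult: "kbound X K A \<Longrightarrow> c \<ge> 0 \<Longrightarrow> kbound X (\<lambda>x y. c * K x y) (c * A)"
proof -
  assume *: "kbound X K A" "c \<ge> 0"
  show ?thesis
    unfolding kbound_def
  proof (intro allI impI)
    fix u v :: "'a \<Rightarrow> real"
    assume uv: "\<forall>x. u x \<ge> 0" "\<forall>x. v x \<ge> 0"
    have "c * (\<Sum>x\<in>X. \<Sum>y\<in>X. K x y * u x * v y)
      \<le> c * (A * (\<Sum>x\<in>X. u x powr (9/7)) powr (7/9) * (\<Sum>x\<in>X. v x powr (9/7)) powr (7/9))"
      using * uv by (intro mult_left_mono kboundD) auto
    then show "(\<Sum>x\<in>X. \<Sum>y\<in>X. c * K x y * u x * v y)
      \<le> c * A * (\<Sum>x\<in>X. u x powr (9/7)) powr (7/9) * (\<Sum>x\<in>X. v x powr (9/7)) powr (7/9)"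
      by (simp add: sum_distrib_left mult.assoc)
  qed
qed

text \<open>Besides renaming the index set this passes to a smaller kernel, which is harmless
  because the test functions are nonnegative.\<close>

lemma kbound_reindex:
  assumes "kbound X K A" "bij_betw h X Z"
    and "\<And>x y. x \<in> X \<Longrightarrow> y \<in> X \<Longrightarrow> L (h x) (h y) \<le> K x y"
  shows "kbound Z L A"
  unfolding kbound_def
proof (intro allI impI)
  fix u v :: "'b \<Rightarrow> real"
  assume uv: "\<forall>x. u x \<ge> 0" "\<forall>x. v x \<ge> 0"
  note re = sum.reindex_bij_betw[OF assms(2), symmetric]
  have "(\<Sum>x\<in>Z. \<Sum>y\<in>Z. L x y * u x * v y) = (\<Sum>x\<in>X. \<Sum>y\<in>X. L (h x) (h y) * u (h x) * v (h y))"
    by (simp add: re)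
  also have "\<dots> \<le> (\<Sum>x\<in>X. \<Sum>y\<in>X. K x y * u (h x) * v (h y))"
    using assms(3) uv by (intro sum_mono mult_right_mono) auto
  also have "\<dots> \<le> A * (\<Sum>x\<in>X. u (h x) powr (9/7)) powr (7/9) * (\<Sum>x\<in>X. v (h x) powr (9/7)) powr (7/9)"
    using uv by (intro kboundD[OF assms(1)]) auto
  finally show "(\<Sum>x\<in>Z. \<Sum>y\<in>Z. L x y * u x * v y)
      \<le> A * (\<Sum>x\<in>Z. u x powr (9/7)) powr (7/9) * (\<Sum>x\<in>Z. v x powr (9/7)) powr (7/9)"
    by (simp add: re)
qed

text \<open>For fixed \<open>y\<close> and \<open>y'\<close> the bound for \<open>K\<close> replaces
  the functions by their fibre norms \<open>U y\<close> and \<open>V y'\<close>; nonnegativity of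
  \<open>L\<close> keeps the inequality when summing. The bound for \<open>L\<close> then applies to
  \<open>U\<close> and \<open>V\<close>, and the norm of the fibre norms is the norm on the product.
  Hence the constants multiply with no loss, which an unbounded number of primes requires.\<close>

lemma kbound_tensor:
  assumes K: "kbound X K A" and L: "kbound Y L B" "A \<ge> 0"
    and Lnn: "\<And>y y'. y \<in> Y \<Longrightarrow> y' \<in> Y \<Longrightarrow> L y y' \<ge> 0"
  shows "kbound (X \<times> Y) (\<lambda>(x, y) (x', y'). K x x' * L y y') (A * B)"
  unfolding kbound_def
proof (intro allI impI)
  fix u v :: "'a \<times> 'b \<Rightarrow> real"
  assume uv: "\<forall>x. u x \<ge> 0" "\<forall>x. v x \<ge> 0"
  define U where "U y = (\<Sum>x\<in>X. u (x, y) powr (9/7)) powr (7/9)" for y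
  define V where "V y = (\<Sum>x\<in>X. v (x, y) powr (9/7)) powr (7/9)" for y
  have pw: "(\<Sum>y\<in>Y. U y powr (9/7)) = (\<Sum>z\<in>X\<times>Y. u z powr (9/7))"
           "(\<Sum>y\<in>Y. V y powr (9/7)) = (\<Sum>z\<in>X\<times>Y. v z powr (9/7))"
    by (subst sum.cartesian_product', subst sum.swap,
        simp add: U_def V_def powr_powr sum_nonneg)+
  have "(\<Sum>z\<in>X\<times>Y. \<Sum>z'\<in>X\<times>Y. (\<lambda>(x, y) (x', y'). K x x' * L y y') z z' * u z * v z')
      = (\<Sum>x\<in>X. \<Sum>y\<in>Y. \<Sum>x'\<in>X. \<Sum>y'\<in>Y. K x x' * L y y' * u (x, y) * v (x', y'))"
    by (simp add: sum.cartesian_product')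
  also have "\<dots> = (\<Sum>y\<in>Y. \<Sum>x\<in>X. \<Sum>x'\<in>X. \<Sum>y'\<in>Y. K x x' * L y y' * u (x, y) * v (x', y'))"
    by (rule sum.swap)
  also have "\<dots> = (\<Sum>y\<in>Y. \<Sum>y'\<in>Y. \<Sum>x\<in>X. \<Sum>x'\<in>X. K x x' * L y y' * u (x, y) * v (x', y'))"
    by (subst (2) sum.swap, subst (3) sum.swap) simp
  also have "\<dots> = (\<Sum>y\<in>Y. \<Sum>y'\<in>Y. L y y' * (\<Sum>x\<in>X. \<Sum>x'\<in>X. K x x' * u (x, y) * v (x', y')))"
    by (simp add: sum_distrib_left algebra_simps)
  also have "\<dots> \<le> (\<Sum>y\<in>Y. \<Sum>y'\<in>Y. L y y' * (A * U y * V y'))"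
    unfolding U_def V_def using uv Lnn
    by (intro sum_mono mult_left_mono kboundD[OF K]) auto
  also have "\<dots> = A * (\<Sum>y\<in>Y. \<Sum>y'\<in>Y. L y y' * U y * V y')"
    by (simp add: sum_distrib_left algebra_simps)
  also have "\<dots> \<le> A * (B * (\<Sum>y\<in>Y. U y powr (9/7)) powr (7/9) * (\<Sum>y\<in>Y. V y powr (9/7)) powr (7/9))"
    using L(2) by (intro mult_left_mono kboundD[OF L(1)]) (auto simp: U_def V_def)
  finally show "(\<Sum>z\<in>X\<times>Y. \<Sum>z'\<in>X\<times>Y. (\<lambda>(x, y) (x', y'). K x x' * L y y') z z' * u z * v z')
      \<le> A * B * (\<Sum>z\<in>X\<times>Y. u z powr (9/7)) powr (7/9) * (\<Sum>z\<in>X\<times>Y. v z powr (9/7)) powr (7/9)"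
    by (simp only: pw mult.assoc)
qed

text \<open>Both sides are homogeneous and the kernels below are positive semidefinite, so it suffices to
  bound the quadratic form on the unit sphere.\<close>

lemma kbound_of_normalized:
  assumes "finite X" "A \<ge> 0"
    and psd: "\<And>u v. (\<And>x. u x \<ge> 0) \<Longrightarrow> (\<And>x. v x \<ge> 0) \<Longrightarrow>
      2 * (\<Sum>x\<in>X. \<Sum>y\<in>X. K x y * u x * v y)
        \<le> (\<Sum>x\<in>X. \<Sum>y\<in>X. K x y * u x * u y) + (\<Sum>x\<in>X. \<Sum>y\<in>X. K x y * v x * v y)"
    and bd: "\<And>u. (\<And>x. u x \<ge> 0) \<Longrightarrow> (\<Sum>x\<in>X. u x powr (9/7)) = 1 \<Longrightarrow>
      (\<Sum>x\<in>X. \<Sum>y\<in>X. K x y * u x * u y) \<le> A"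
  shows "kbound X K A"
  unfolding kbound_def
proof (intro allI impI)
  fix u v :: "'a \<Rightarrow> real"
  assume uv: "\<forall>x. u x \<ge> 0" "\<forall>x. v x \<ge> 0"
  define U where "U = (\<Sum>x\<in>X. u x powr (9/7)) powr (7/9)"
  define V where "V = (\<Sum>x\<in>X. v x powr (9/7)) powr (7/9)"
  show "(\<Sum>x\<in>X. \<Sum>y\<in>X. K x y * u x * v y)
      \<le> A * (\<Sum>x\<in>X. u x powr (9/7)) powr (7/9) * (\<Sum>x\<in>X. v x powr (9/7)) powr (7/9)"
  proof (cases "U = 0 \<or> V = 0")
    case True
    then have "(\<forall>x\<in>X. u x = 0) \<or> (\<forall>x\<in>X. v x = 0)"
      using assms(1) by (auto simp: U_def V_def powr_eq_0_iff sum_nonneg_eq_0_iff)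
    then have "(\<Sum>x\<in>X. \<Sum>y\<in>X. K x y * u x * v y) = 0" by auto
    then show ?thesis using assms(2) by simp
  next
    case False
    then have U: "U > 0" and V: "V > 0" by (auto simp: U_def V_def less_le)
    have nrm: "(\<Sum>x\<in>X. (f x / F) powr (9/7)) = 1"
      if "\<forall>x. f x \<ge> 0" "F = (\<Sum>x\<in>X. f x powr (9/7)) powr (7/9)" "F > 0" for f :: "'a \<Rightarrow> real" and F
    proof -
      have "F powr (9/7) = (\<Sum>x\<in>X. f x powr (9/7))"
        unfolding that(2) by (simp add: powr_powr sum_nonneg)
      moreover have "F powr (9/7) > 0" using that by simp
      moreover have "(\<Sum>x\<in>X. (f x / F) powr (9/7)) = (\<Sum>x\<in>X. f x powr (9/7)) / F powr (9/7)"
        using that by (simp add: powr_divide sum_divide_distrib)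
      ultimately show ?thesis by simp
    qed
    have "2 * (\<Sum>x\<in>X. \<Sum>y\<in>X. K x y * (u x / U) * (v y / V)) \<le> A + A"
      using uv U V by (intro order_trans[OF psd add_mono[OF bd bd]] nrm) (auto simp: U_def V_def)
    moreover have "(\<Sum>x\<in>X. \<Sum>y\<in>X. K x y * (u x / U) * (v y / V)) = (\<Sum>x\<in>X. \<Sum>y\<in>X. K x y * u x * v y) / (U * V)"
      by (simp add: sum_divide_distrib)
    ultimately have "(\<Sum>x\<in>X. \<Sum>y\<in>X. K x y * u x * v y) / (U * V) \<le> A" by simp
    then have "(\<Sum>x\<in>X. \<Sum>y\<in>X. K x y * u x * v y) \<le> A * (U * V)"
      using U V by (simp add: pos_divide_le_eq)
    then show ?thesis by (simp add: U_def V_def mult.assoc)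
  qed
qed

section \<open>The local kernel at one prime\<close>

lemma powr_sum_le_1:
  fixes u :: "'a \<Rightarrow> real"
  assumes "finite X" "\<And>x. u x \<ge> 0" "(\<Sum>x\<in>X. u x powr (9/7)) = 1" "x \<in> X"
  shows "u x \<le> 1"
proof (rule ccontr)
  assume "\<not> u x \<le> 1"
  then have "1 < u x powr (9/7)" by (simp add: gr_one_powr)
  also have "\<dots> \<le> (\<Sum>x\<in>X. u x powr (9/7))" using assms by (intro member_le_sum) auto
  finally show False using assms by simp
qed

text \<open>The diagonal kernel is the Euclidean inner product, and the norm of exponent 2 is at
  most that of exponent \<open>9/7\<close>.\<close>

lemma kbound_identity:
  assumes "finite X"
  shows "kbound X (\<lambda>x y. if x = y then 1 else 0) 1"
proof (rule kbound_of_normalized[OF assms])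
  have diag: "(\<Sum>x\<in>X. \<Sum>y\<in>X. (if x = y then 1 else 0) * u x * v y) = (\<Sum>x\<in>X. u x * v x)" for u v :: "'a \<Rightarrow> real"
    using assms by (intro sum.cong refl) (simp add: if_distrib[of "\<lambda>c. c * _"] cong: if_cong)
  show "2 * (\<Sum>x\<in>X. \<Sum>y\<in>X. (if x = y then 1 else 0) * u x * v y)
        \<le> (\<Sum>x\<in>X. \<Sum>y\<in>X. (if x = y then 1 else 0) * u x * u y)
        + (\<Sum>x\<in>X. \<Sum>y\<in>X. (if x = y then 1 else 0) * v x * v y)" for u v :: "'a \<Rightarrow> real"
  proof -
    have "0 \<le> (\<Sum>x\<in>X. (u x - v x)\<^sup>2)" by (intro sum_nonneg) auto
    then show ?thesis
      unfolding diag by (simp add: power2_diff sum.distrib sum_subtractf power2_eq_square sum_distrib_left algebra_simps)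
  qed
  show "(\<Sum>x\<in>X. \<Sum>y\<in>X. (if x = y then 1 else 0) * u x * u y) \<le> 1"
    if u: "\<And>x. u x \<ge> 0" "(\<Sum>x\<in>X. u x powr (9/7)) = 1" for u :: "'a \<Rightarrow> real"
  proof -
    have "u x * u x \<le> u x powr (9/7)" if "x \<in> X" for x
    proof -
      have "u x * u x = u x powr 2" using u by (simp add: power2_eq_square)
      also have "\<dots> \<le> u x powr (9/7)"
        using powr_sum_le_1[OF assms u that] u(1)[of x] by (intro powr_mono') auto
      finally show ?thesis .
    qed
    then have "(\<Sum>x\<in>X. u x * u x) \<le> (\<Sum>x\<in>X. u x powr (9/7))" by (intro sum_mono) auto
    then show ?thesis using u unfolding diag by simp
  qed
qed simp

text \<open>Hoelder up to a factor 2, by splitting at height \<open>t\<close>: values below are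
  bounded by \<open>t\<close>, values above by \<open>t powr (-2/7)\<close> times their power
  \<open>9/7\<close>. The choice of \<open>t\<close> makes both contributions equal to
  \<open>n powr (2/9) * w powr (7/9)\<close>.\<close>

lemma sum_le_powr_sum:
  fixes u :: "'a \<Rightarrow> real"
  assumes "finite X" "\<And>x. u x \<ge> 0" "real (card X) \<le> n" "n > 0"
  shows "(\<Sum>x\<in>X. u x) \<le> 2 * n powr (2/9) * (\<Sum>x\<in>X. u x powr (9/7)) powr (7/9)"
proof -
  define w where "w = (\<Sum>x\<in>X. u x powr (9/7))"
  show ?thesis
  proof (cases "w = 0")
    case True
    then have "\<forall>x\<in>X. u x = 0"
      using assms(1) by (auto simp: w_def sum_nonneg_eq_0_iff)
    then show ?thesis by simp
  next
    case False
    then have w: "w > 0" by (simp add: w_def sum_nonneg less_le)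
    define t where "t = (w / n) powr (7/9)"
    have t: "t > 0" using w assms(4) by (simp add: t_def)
    have "u x \<le> t + t powr (-2/7) * u x powr (9/7)" for x
    proof (cases "u x \<le> t")
      case True
      then show ?thesis using t by (simp add: add_increasing2)
    next
      case False
      have "u x powr (-2/7) \<le> t powr (-2/7)"
        using False t by (intro powr_mono2') auto
      then have "u x powr (-2/7) * u x powr (9/7) \<le> t powr (-2/7) * u x powr (9/7)"
        by (rule mult_right_mono) simp
      moreover have "u x powr (-2/7) * u x powr (9/7) = u x"
        using False t by (simp flip: powr_add)
      ultimately show ?thesis using t by linarith
    qed
    then have "(\<Sum>x\<in>X. u x) \<le> (\<Sum>x\<in>X. t + t powr (-2/7) * u x powr (9/7))"
      by (intro sum_mono)
    also have "\<dots> = real (card X) * t + t powr (-2/7) * w"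
      by (simp add: sum.distrib w_def sum_distrib_left)
    also have "\<dots> \<le> n * t + t powr (-2/7) * w"
      using assms(3) t by (intro add_right_mono mult_right_mono) auto
    also have "n * t = n powr (2/9) * w powr (7/9)"
    proof -
      have "n = n powr (2/9) * n powr (7/9)" using assms(4) by (simp flip: powr_add)
      then have "n * t = n powr (2/9) * (n powr (7/9) * (w / n) powr (7/9))" by (simp add: t_def)
      also have "n powr (7/9) * (w / n) powr (7/9) = w powr (7/9)"
        using w assms(4) by (simp flip: powr_mult)
      finally show ?thesis .
    qed
    also have "t powr (-2/7) * w = n powr (2/9) * w powr (7/9)"
    proof -
      have "t powr (-2/7) = (w / n) powr (-2/9)" by (simp add: t_def powr_powr)
      also have "\<dots> = n powr (2/9) * w powr (-2/9)"
        using w assms(4) by (simp add: powr_divide powr_minus field_simps)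
      finally have "t powr (-2/7) * w = n powr (2/9) * (w powr (-2/9) * w powr 1)" using w by simp
      also have "w powr (-2/9) * w powr 1 = w powr (7/9)" by (subst powr_add[symmetric]) simp
      finally show ?thesis .
    qed
    finally show ?thesis by (simp add: w_def)
  qed
qed

text \<open>Young's inequality for the dual exponents \<open>9/2\<close> and \<open>9/7\<close>, by
  cases on which term dominates. The 60 is 12 * 5, chosen to leave only
  \<open>w / 5\<close>.\<close>

lemma powr_trade_off:
  fixes q w :: real
  assumes "q \<ge> 0" "w \<ge> 0"
  shows "12 * q * w powr (7/9) \<le> w / 5 + 12 * 60 powr (7/2) * q powr (9/2)"
proof (cases "60 * q \<le> w powr (2/9)")
  case True
  then have "60 * q * w powr (7/9) \<le> w powr (2/9) * w powr (7/9)" by (intro mult_right_mono) auto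
  also have "\<dots> = w" using assms by (simp flip: powr_add)
  finally show ?thesis by (simp add: add_increasing2)
next
  case False
  have "w powr (7/9) = (w powr (2/9)) powr (7/2)" by (simp add: powr_powr)
  also have "\<dots> \<le> (60 * q) powr (7/2)" using False by (intro powr_mono2) auto
  also have "\<dots> = 60 powr (7/2) * q powr (7/2)" using assms by (simp add: powr_mult)
  finally have "12 * q * w powr (7/9) \<le> 12 * q * (60 powr (7/2) * q powr (7/2))"
    using assms by (intro mult_left_mono) auto
  also have "\<dots> = 12 * 60 powr (7/2) * (q powr 1 * q powr (7/2))" using assms by simp
  also have "q powr 1 * q powr (7/2) = q powr (9/2)" by (subst powr_add[symmetric]) simp
  finally show ?thesis using assms by simp
qed

text \<open>The kernel is \<open>1 - \<beta>\<close> times the identity plus \<open>\<beta>\<close>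
  times the all-ones matrix, both positive semidefinite when \<open>\<beta>\<close> lies in
  [0, 1].\<close>

lemma sum_local_kernel:
  fixes u v :: "'a \<Rightarrow> real"
  assumes "finite X"
  shows "(\<Sum>x\<in>X. \<Sum>y\<in>X. (if x = y then 1 else \<beta>) * u x * v y)
    = (1 - \<beta>) * (\<Sum>x\<in>X. u x * v x) + \<beta> * ((\<Sum>x\<in>X. u x) * (\<Sum>x\<in>X. v x))"
proof -
  have "(\<Sum>x\<in>X. \<Sum>y\<in>X. (if x = y then 1 else \<beta>) * u x * v y)
      = (\<Sum>x\<in>X. \<Sum>y\<in>X. (if x = y then (1 - \<beta>) * (u x * v x) else 0) + \<beta> * (u x * v y))"
    by (intro sum.cong) (auto simp: algebra_simps)
  also have "\<dots> = (1 - \<beta>) * (\<Sum>x\<in>X. u x * v x) + \<beta> * (\<Sum>x\<in>X. \<Sum>y\<in>X. u x * v y)"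
    using assms by (simp add: sum.distrib sum_distrib_left)
  finally show ?thesis by (simp add: sum_product)
qed

lemma le_powr_inverse:
  fixes c p n :: real
  assumes "0 \<le> c" "0 < n" "c powr n \<le> p"
  shows "c \<le> p powr (1 / n)"
proof -
  have "(c powr n) powr (1 / n) \<le> p powr (1 / n)" using assms by (intro powr_mono2) auto
  then show ?thesis using assms by (simp add: powr_powr)
qed

text \<open>The excess over 1 must be summable over primes, so the diagonal has to pay for most of
  the off-diagonal part. The largest coordinate \<open>a\<close> is separated, and \<open>w\<close>
  is the mass of the others. Then \<open>a * a \<le> 1 - w\<close>, while the other squares use only
  \<open>7/10 * w\<close>. Of the spare \<open>3/10 * w\<close>, the term
  \<open>\<beta> * (S * S)\<close> takes \<open>w / 10\<close> and the cross term
  \<open>2 * \<beta> * S * a\<close> takes \<open>w / 5\<close>; what Young's inequality leaves of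
  the cross term is the excess.\<close>

lemma kbound_local:
  fixes p :: real
  assumes "finite X" "real (card X) \<le> p" "120 powr 18 \<le> p"
  shows "kbound X (\<lambda>x y. if x = y then 1 else 3 / sqrt p) (1 + 12 * 60 powr (7/2) * p powr (-5/4))"
proof (rule kbound_of_normalized[OF assms(1)])
  define \<beta> where "\<beta> = 3 / sqrt p"
  have "(1::real) \<le> 120 powr 18" by (rule ge_one_powr_ge_zero) auto
  then have p: "p \<ge> 1" using assms(3) by linarith
  \<comment> \<open>\<open>1/18 = 1/2 - 4/9\<close> is what remains of the decay of
    \<open>\<beta>\<close> after Hoelder is applied to both factors of \<open>S * S\<close>; 120
    brings \<open>12 * p powr (-1/18)\<close> down to \<open>1/10\<close>.\<close>
  have p': "120 \<le> p powr (1/18)" using le_powr_inverse[OF _ _ assms(3)] by simp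
  have \<beta>eq: "\<beta> = 3 * p powr (-1/2)"
    using p powr_minus_divide[of p "1/2"] by (simp add: \<beta>_def powr_half_sqrt)
  have "p powr (-1/2) \<le> p powr (-1/18)" using p by (intro powr_mono) auto
  also have "\<dots> = 1 / p powr (1/18)" using powr_minus_divide[of p "1/18"] by simp
  also have "\<dots> \<le> 1 / 120" using p' by (intro divide_left_mono) auto
  finally have \<beta>1: "\<beta> \<le> 1" "\<beta> \<ge> 0" by (simp_all add: \<beta>eq)
  show "0 \<le> 1 + 12 * 60 powr (7/2) * p powr (-5/4)" by (simp add: add_nonneg_nonneg)
  show "2 * (\<Sum>x\<in>X. \<Sum>y\<in>X. (if x = y then 1 else 3 / sqrt p) * u x * v y)
        \<le> (\<Sum>x\<in>X. \<Sum>y\<in>X. (if x = y then 1 else 3 / sqrt p) * u x * u y)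
        + (\<Sum>x\<in>X. \<Sum>y\<in>X. (if x = y then 1 else 3 / sqrt p) * v x * v y)" for u v :: "'a \<Rightarrow> real"
  proof -
    have "0 \<le> (1 - \<beta>) * (\<Sum>x\<in>X. (u x - v x)\<^sup>2) + \<beta> * ((\<Sum>x\<in>X. u x) - (\<Sum>x\<in>X. v x))\<^sup>2"
      using \<beta>1 by (intro add_nonneg_nonneg mult_nonneg_nonneg sum_nonneg) auto
    also have "(\<Sum>x\<in>X. (u x - v x)\<^sup>2) = (\<Sum>x\<in>X. u x * u x) + (\<Sum>x\<in>X. v x * v x) - 2 * (\<Sum>x\<in>X. u x * v x)"
      by (simp add: power2_diff sum.distrib sum_subtractf power2_eq_square sum_distrib_left algebra_simps)
    finally show ?thesis
      unfolding sum_local_kernel[OF assms(1)] \<beta>_def[symmetric]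
      by (simp add: power2_eq_square algebra_simps)
  qed
  show "(\<Sum>x\<in>X. \<Sum>y\<in>X. (if x = y then 1 else 3 / sqrt p) * u x * u y) \<le> 1 + 12 * 60 powr (7/2) * p powr (-5/4)"
    if u: "\<And>x. u x \<ge> 0" "(\<Sum>x\<in>X. u x powr (9/7)) = 1" for u :: "'a \<Rightarrow> real"
  proof -
    have "X \<noteq> {}" using u(2) by auto
    then obtain x0 where x0: "x0 \<in> X" "\<And>x. x \<in> X \<Longrightarrow> u x \<le> u x0"
      using obtains_MAX[OF assms(1), of u] by (metis Max_ge assms(1) finite_imageI imageI)
    define Y where "Y = X - {x0}"
    define a where "a = u x0"
    define w where "w = (\<Sum>x\<in>Y. u x powr (9/7))"
    define S where "S = (\<Sum>x\<in>Y. u x)"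
    have finY: "finite Y" using assms(1) by (simp add: Y_def)
    have rem: "(\<Sum>x\<in>X. g x) = g x0 + (\<Sum>x\<in>Y. g x)" for g :: "'a \<Rightarrow> real"
      using x0(1) assms(1) by (simp add: Y_def sum.remove)
    have a: "a \<ge> 0" "a \<le> 1" using u x0(1) powr_sum_le_1[OF assms(1) u] by (auto simp: a_def)
    have aw: "a powr (9/7) + w = 1" using u(2) by (simp add: rem w_def a_def)
    have w0: "w \<ge> 0" by (simp add: w_def sum_nonneg)
    have w1: "w \<le> 1" using aw powr_ge_zero[of a "9/7"] by linarith
    have S0: "S \<ge> 0" using u by (simp add: S_def sum_nonneg)
    have a2: "a * a \<le> 1 - w"
    proof -
      have "a * a = a powr 2" using a by (simp add: power2_eq_square)
      also have "\<dots> \<le> a powr (9/7)" using a by (intro powr_mono') auto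
      finally show ?thesis using aw by simp
    qed
    have sq: "(\<Sum>x\<in>Y. u x * u x) \<le> 7/10 * w"
    proof -
      have "u x * u x \<le> 7/10 * u x powr (9/7)" if "x \<in> Y" for x
      proof -
        \<comment> \<open>A coordinate other than the largest has mass at most \<open>w\<close> and
          at most \<open>a powr (9/7) = 1 - w\<close>, hence at most \<open>1/2\<close>.\<close>
        have "u x powr (9/7) \<le> w" unfolding w_def using that finY by (intro member_le_sum) auto
        moreover have "u x powr (9/7) \<le> a powr (9/7)"
          using that u x0 by (intro powr_mono2) (auto simp: a_def Y_def)
        ultimately have "u x powr (9/7) \<le> 1/2" using aw by linarith
        then have "(u x powr (9/7)) powr (5/9) \<le> (1/2) powr (5/9)" by (intro powr_mono2) auto
        also have "(1/2::real) powr (5/9) \<le> 7/10"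
        proof -
          have "(1/2::real) powr 5 \<le> (7/10) powr 9" by (simp add: power_divide)
          then have "((1/2::real) powr 5) powr (1/9) \<le> ((7/10) powr 9) powr (1/9)" by (intro powr_mono2) auto
          then show ?thesis unfolding powr_powr by simp
        qed
        finally have "u x powr (5/7) \<le> 7/10" by (simp add: powr_powr)
        then have "u x powr (5/7) * u x powr (9/7) \<le> 7/10 * u x powr (9/7)" by (rule mult_right_mono) simp
        moreover have "u x powr (5/7) * u x powr (9/7) = u x * u x"
          using u(1)[of x] by (simp add: power2_eq_square flip: powr_add)
        ultimately show ?thesis by simp
      qed
      then have "(\<Sum>x\<in>Y. u x * u x) \<le> (\<Sum>x\<in>Y. 7/10 * u x powr (9/7))" by (rule sum_mono)
      then show ?thesis by (simp add: w_def sum_distrib_left)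
    qed
    have cardY: "real (card Y) \<le> p"
      using assms(1,2) card_mono[of X Y] by (simp add: Y_def)
    have S: "S \<le> 2 * p powr (2/9) * w powr (7/9)"
      unfolding S_def w_def using u p cardY finY by (intro sum_le_powr_sum) auto
    have \<beta>S: "2 * \<beta> * S \<le> 12 * p powr (-5/18) * w powr (7/9)"
    proof -
      have "2 * \<beta> * S \<le> 2 * \<beta> * (2 * p powr (2/9) * w powr (7/9))"
        using S \<beta>1 by (intro mult_left_mono) auto
      also have "\<dots> = 12 * (p powr (-1/2) * p powr (2/9)) * w powr (7/9)" by (simp add: \<beta>eq)
      also have "p powr (-1/2) * p powr (2/9) = p powr (-5/18)" by (simp flip: powr_add)
      finally show ?thesis .
    qed
    have \<beta>SS: "\<beta> * (S * S) \<le> w / 10"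
    proof -
      have "S * S \<le> (2 * p powr (2/9) * w powr (7/9)) * (2 * p powr (2/9) * w powr (7/9))"
        using S S0 by (intro mult_mono) auto
      also have "\<dots> = 4 * (p powr (2/9) * p powr (2/9)) * (w powr (7/9) * w powr (7/9))" by simp
      also have "\<dots> = 4 * p powr (4/9) * w powr (14/9)" unfolding powr_add[symmetric] by simp
      also have "\<dots> \<le> 4 * p powr (4/9) * w powr 1"
        using w0 w1 by (intro mult_left_mono powr_mono') auto
      finally have "S * S \<le> 4 * p powr (4/9) * w" using w0 by simp
      then have "\<beta> * (S * S) \<le> \<beta> * (4 * p powr (4/9) * w)" using \<beta>1 by (intro mult_left_mono)
      also have "\<dots> = 12 * (p powr (-1/2) * p powr (4/9)) * w" by (simp add: \<beta>eq)
      also have "p powr (-1/2) * p powr (4/9) = p powr (-1/18)" by (simp flip: powr_add)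
      also have "\<dots> = 1 / p powr (1/18)" using powr_minus_divide[of p "1/18"] by simp
      also have "12 * (1 / p powr (1/18)) * w \<le> 12 * (1 / 120) * w"
        using p' w0 by (intro mult_right_mono mult_left_mono divide_left_mono) auto
      finally show ?thesis by simp
    qed
    \<comment> \<open>\<open>-5/18 = -1/2 + 2/9\<close> is the decay of the cross term, and its
      multiple by \<open>9/2\<close> is the exponent \<open>-5/4\<close> of the local
      constant.\<close>
    have trade: "12 * p powr (-5/18) * w powr (7/9) \<le> w / 5 + 12 * 60 powr (7/2) * p powr (-5/4)"
      using powr_trade_off[of "p powr (-5/18)" w] w0 by (simp add: powr_powr)
    have "(\<Sum>x\<in>X. \<Sum>y\<in>X. (if x = y then 1 else 3 / sqrt p) * u x * u y)
        = (1 - \<beta>) * (a * a + (\<Sum>x\<in>Y. u x * u x)) + \<beta> * ((a + S) * (a + S))"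
      unfolding sum_local_kernel[OF assms(1)] \<beta>_def[symmetric] by (simp add: rem a_def S_def)
    also have "\<dots> = a * a + (\<Sum>x\<in>Y. u x * u x) - \<beta> * (\<Sum>x\<in>Y. u x * u x) + 2 * \<beta> * S * a + \<beta> * (S * S)"
      by (simp add: algebra_simps)
    also have "\<dots> \<le> a * a + (\<Sum>x\<in>Y. u x * u x) + 2 * \<beta> * S + \<beta> * (S * S)"
    proof -
      have "0 \<le> \<beta> * (\<Sum>x\<in>Y. u x * u x)" using \<beta>1 u by (intro mult_nonneg_nonneg sum_nonneg) auto
      moreover have "2 * \<beta> * S * a \<le> 2 * \<beta> * S" using a \<beta>1 S0 by (intro mult_left_le) auto
      ultimately show ?thesis by linarith
    qed
    also have "\<dots> \<le> 1 + 12 * 60 powr (7/2) * p powr (-5/4)"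
      using a2 sq \<beta>S \<beta>SS trade by linarith
    finally show ?thesis .
  qed
qed

section \<open>Restriction and transference\<close>

lemma mult_cnj_sgn: "z * cnj (sgn z) = of_real (norm z)"
proof (cases "z = 0")
  case False
  then show ?thesis
    using complex_norm_square[of z] by (simp add: sgn_eq power2_eq_square field_simps)
qed simp

text \<open>Duality: \<open>Y\<close> is the pairing of the transform of \<open>f\<close> with
  coefficients \<open>c\<close> of modulus \<open>w\<close>. On the physical side \<open>f\<close>
  is majorised by \<open>R\<close>, Cauchy-Schwarz is applied on \<open>R\<close>, and expanding
  \<open>norm (G x)\<close> squared produces the kernel. Since \<open>7/2 * 9/7 = 9/2\<close>, both
  norms of \<open>w\<close> are again \<open>Y powr (7/9)\<close>, so the inequality is quadratic in
  \<open>Y\<close> on the left with \<open>Y powr (14/9)\<close> on the right, and can be solved for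
  \<open>Y\<close>.\<close>

lemma restriction_estimate:
  fixes N :: int
  assumes "N > 0" "R \<subseteq> {0..<N}" "A \<ge> 0"
    and kb: "kbound {0..<N} (\<lambda>k l. norm (ft N (ind R) (k - l))) (A * real (card R))"
    and f: "\<And>x. 0 \<le> f x" "\<And>x. f x \<le> ind R x"
  shows "(\<Sum>k\<in>{0..<N}. norm (ft N f k) powr (9/2)) \<le> A powr (9/4) * real (card R) powr (9/2)"
proof -
  define \<rho> where "\<rho> = real (card R)"
  define \<phi> where "\<phi> k = norm (ft N f k)" for k
  define w where "w k = \<phi> k powr (7/2)" for k
  define c where "c k = of_real (w k) * cnj (sgn (ft N f k))" for k
  define G where "G x = (\<Sum>k\<in>{0..<N}. c k * ee N (k * x))" for x
  define Y where "Y = (\<Sum>k\<in>{0..<N}. \<phi> k powr (9/2))"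
  have \<phi>0: "\<phi> k \<ge> 0" for k by (simp add: \<phi>_def)
  have Y0: "Y \<ge> 0" by (simp add: Y_def sum_nonneg)
  have norm_c: "norm (c k) \<le> w k" for k
    by (simp add: c_def w_def norm_mult norm_sgn)
  have "w k * \<phi> k = \<phi> k powr (9/2)" for k
    using \<phi>0[of k] powr_add[of "\<phi> k" "7/2" 1] by (simp add: w_def)
  then have "complex_of_real Y = (\<Sum>k\<in>{0..<N}. c k * ft N f k)"
    by (simp add: Y_def c_def \<phi>_def mult_cnj_sgn mult.assoc mult.commute[of "cnj _"] flip: of_real_mult)
  also have "\<dots> = (\<Sum>x\<in>{0..<N}. of_real (f x) * G x)"
    unfolding ft_def G_def sum_distrib_left by (subst sum.swap) (simp add: algebra_simps)
  finally have "norm (complex_of_real Y) \<le> (\<Sum>x\<in>{0..<N}. f x * norm (G x))"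
    using f(1) by (simp add: norm_mult sum_norm_le)
  then have "Y \<le> (\<Sum>x\<in>{0..<N}. f x * norm (G x))" using Y0 by simp
  also have "\<dots> \<le> (\<Sum>x\<in>{0..<N}. ind R x * norm (G x))"
    using f(2) by (intro sum_mono mult_right_mono) auto
  finally have "Y\<^sup>2 \<le> (\<Sum>x\<in>{0..<N}. ind R x * norm (G x))\<^sup>2"
    using Y0 by (intro power_mono) auto
  also have "(\<Sum>x\<in>{0..<N}. ind R x * norm (G x)) = (\<Sum>x\<in>{0..<N}. ind R x * (ind R x * norm (G x)))"
    by (intro sum.cong) (auto simp: ind_def indicator_def)
  also have "\<dots>\<^sup>2 \<le> (\<Sum>x\<in>{0..<N}. (ind R x)\<^sup>2) * (\<Sum>x\<in>{0..<N}. (ind R x * norm (G x))\<^sup>2)"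
    by (rule Cauchy_Schwarz_ineq_sum)
  also have "(\<Sum>x\<in>{0..<N}. (ind R x)\<^sup>2) = (\<Sum>x\<in>{0..<N}. ind R x)"
    by (intro sum.cong) (auto simp: ind_def indicator_def)
  also have "\<dots> = \<rho>" using assms(2) by (simp add: sum_ind \<rho>_def)
  also have "(\<Sum>x\<in>{0..<N}. (ind R x * norm (G x))\<^sup>2) = (\<Sum>x\<in>{0..<N}. ind R x * (norm (G x))\<^sup>2)"
    by (intro sum.cong) (auto simp: ind_def indicator_def)
  also have "\<dots> \<le> A * \<rho> * Y powr (7/9) * Y powr (7/9)"
  proof -
    have G2: "of_real ((norm (G x))\<^sup>2) = (\<Sum>k\<in>{0..<N}. \<Sum>l\<in>{0..<N}. c k * cnj (c l) * ee N ((k - l) * x))" for x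
      by (simp add: G_def complex_norm_square sum_product cnj_ee cnj_sum algebra_simps del: of_real_power flip: ee_add)
    have "complex_of_real (\<Sum>x\<in>{0..<N}. ind R x * (norm (G x))\<^sup>2)
        = (\<Sum>x\<in>{0..<N}. \<Sum>k\<in>{0..<N}. \<Sum>l\<in>{0..<N}. c k * cnj (c l) * (of_real (ind R x) * ee N ((k - l) * x)))"
      by (simp add: G2 sum_distrib_left algebra_simps del: of_real_power)
    also have "\<dots> = (\<Sum>k\<in>{0..<N}. \<Sum>l\<in>{0..<N}. \<Sum>x\<in>{0..<N}. c k * cnj (c l) * (of_real (ind R x) * ee N ((k - l) * x)))"
      by (subst sum.swap, rule sum.cong[OF refl], rule sum.swap)
    also have "\<dots> = (\<Sum>k\<in>{0..<N}. \<Sum>l\<in>{0..<N}. c k * cnj (c l) * ft N (ind R) (k - l))"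
      by (simp add: ft_def sum_distrib_left)
    finally have eq: "complex_of_real (\<Sum>x\<in>{0..<N}. ind R x * (norm (G x))\<^sup>2) = (\<Sum>k\<in>{0..<N}. \<Sum>l\<in>{0..<N}. c k * cnj (c l) * ft N (ind R) (k - l))" .
    have "(\<Sum>x\<in>{0..<N}. ind R x * (norm (G x))\<^sup>2) \<ge> 0" by (intro sum_nonneg) simp
    then have "(\<Sum>x\<in>{0..<N}. ind R x * (norm (G x))\<^sup>2) = norm (complex_of_real (\<Sum>x\<in>{0..<N}. ind R x * (norm (G x))\<^sup>2))"
      by (simp only: norm_of_real abs_of_nonneg)
    also have "\<dots> = norm (\<Sum>k\<in>{0..<N}. \<Sum>l\<in>{0..<N}. c k * cnj (c l) * ft N (ind R) (k - l))"
      by (simp only: eq)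
    also have "\<dots> \<le> (\<Sum>k\<in>{0..<N}. \<Sum>l\<in>{0..<N}. norm (ft N (ind R) (k - l)) * w k * w l)"
    proof (intro sum_norm_le)
      fix k l
      have "norm (c k) * norm (c l) \<le> w k * w l"
        by (intro mult_mono norm_c) (simp_all add: w_def)
      then have "norm (ft N (ind R) (k - l)) * (norm (c k) * norm (c l)) \<le> norm (ft N (ind R) (k - l)) * (w k * w l)"
        by (rule mult_left_mono) simp
      then show "norm (c k * cnj (c l) * ft N (ind R) (k - l)) \<le> norm (ft N (ind R) (k - l)) * w k * w l"
        by (simp add: norm_mult ac_simps)
    qed
    also have "\<dots> \<le> A * \<rho> * (\<Sum>k\<in>{0..<N}. w k powr (9/7)) powr (7/9) * (\<Sum>k\<in>{0..<N}. w k powr (9/7)) powr (7/9)"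
      unfolding \<rho>_def by (rule kboundD[OF kb]) (simp_all add: w_def)
    also have "(\<Sum>k\<in>{0..<N}. w k powr (9/7)) = Y" by (simp add: w_def Y_def powr_powr)
    finally show ?thesis .
  qed
  finally have "Y\<^sup>2 \<le> \<rho> * (A * \<rho> * Y powr (7/9) * Y powr (7/9))"
    by (simp add: \<rho>_def mult_left_mono)
  then have main: "Y powr (4/9) * Y powr (14/9) \<le> (A * \<rho>\<^sup>2) * Y powr (14/9)"
    using Y0 by (simp add: power2_eq_square ac_simps flip: powr_add)
  have "Y \<le> (A * \<rho>\<^sup>2) powr (9/4)"
  proof (cases "Y = 0")
    case False
    then have "Y > 0" using Y0 by simp
    with main have "Y powr (4/9) \<le> A * \<rho>\<^sup>2" by (simp add: mult_le_cancel_right)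
    then have "(Y powr (4/9)) powr (9/4) \<le> (A * \<rho>\<^sup>2) powr (9/4)"
      by (intro powr_mono2) auto
    then show ?thesis using \<open>Y > 0\<close> by (simp add: powr_powr)
  qed simp
  also have "\<dots> = A powr (9/4) * \<rho> powr (9/2)"
  proof -
    have "\<rho>\<^sup>2 powr (9/4) = \<rho> powr (9/2)"
      by (cases "\<rho> = 0") (simp_all add: \<rho>_def powr_powr flip: powr_numeral)
    then show ?thesis using assms(3) by (simp add: powr_mult)
  qed
  finally show ?thesis by (simp add: Y_def \<phi>_def \<rho>_def)
qed

section \<open>Counts before and after smoothing\<close>

lemma cpow_fourier:
  assumes "N > 0" "y \<in> {0..<N}"
  shows "of_real (of_int N * cpow N f s y) = (\<Sum>k\<in>{0..<N}. ft N f k ^ s * ee N (- (k * y)))"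
  using ft_inversion[OF assms, of "cpow N f s"] by (simp add: ft_cpow[OF assms(1)])

text \<open>Frequency by frequency the difference is
  \<open>norm (ft N f k) ^ s * (1 - w k ^ s)\<close>. The power \<open>9/2\<close> is set aside for
  the moment bound. At a large frequency Bernoulli bounds the last factor by
  \<open>s * \<eta>\<close>; at a small one the spare power \<open>s - 9/2 \<ge> 1/2\<close> gives
  \<open>sqrt \<delta>\<close>. This is where \<open>s \<ge> 5\<close> enters.\<close>

lemma smoothing_error:
  fixes N :: int and w :: "int \<Rightarrow> real"
  assumes "N > 0" "s \<ge> 5" "y \<in> {0..<N}" "\<rho> > 0" "A \<ge> 0" "0 < \<delta>" "\<delta> \<le> 1" "\<eta> \<ge> 0"
    and L: "(\<Sum>k\<in>{0..<N}. norm (ft N f k) powr (9/2)) \<le> A * \<rho> powr (9/2)"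
    and le: "\<And>k. norm (ft N f k) \<le> \<rho>"
    and w: "\<And>k. 0 \<le> w k" "\<And>k. w k \<le> 1"
      "\<And>k. k \<in> {0..<N} \<Longrightarrow> \<delta> * \<rho> \<le> norm (ft N f k) \<Longrightarrow> 1 - \<eta> \<le> w k"
    and h: "\<And>k. ft N h k = ft N f k * of_real (w k)"
  shows "\<bar>of_int N * cpow N f s y - of_int N * cpow N h s y\<bar> \<le> A * \<rho> ^ s * (real s * \<eta> + sqrt \<delta>)"
proof -
  define E where "E = real s * \<eta> + sqrt \<delta>"
  define \<phi> where "\<phi> k = norm (ft N f k)" for k
  have E0: "real s * \<eta> \<ge> 0" "sqrt \<delta> \<ge> 0" using assms by auto
  have "complex_of_real (of_int N * cpow N f s y - of_int N * cpow N h s y)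
      = (\<Sum>k\<in>{0..<N}. ft N f k ^ s * of_real (1 - w k ^ s) * ee N (- (k * y)))"
    unfolding of_real_diff cpow_fourier[OF assms(1,3)] h
    by (simp add: sum_subtractf power_mult_distrib algebra_simps)
  then have "\<bar>of_int N * cpow N f s y - of_int N * cpow N h s y\<bar>
      = norm (\<Sum>k\<in>{0..<N}. ft N f k ^ s * of_real (1 - w k ^ s) * ee N (- (k * y)))"
    by (metis norm_of_real)
  also have "\<dots> \<le> (\<Sum>k\<in>{0..<N}. \<phi> k powr (9/2) * (\<rho> powr (real s - 9/2) * E))"
  proof (rule sum_norm_le)
    fix k assume k: "k \<in> {0..<N}"
    have ws: "0 \<le> 1 - w k ^ s" "1 - w k ^ s \<le> 1" using w[of k] by (auto intro: power_le_one)
    have eq: "norm (ft N f k ^ s * of_real (1 - w k ^ s) * ee N (- (k * y))) = \<phi> k ^ s * (1 - w k ^ s)"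
      using ws(1) norm_of_real[of "1 - w k ^ s", where 'a = complex]
      by (simp add: norm_mult norm_power \<phi>_def del: of_real_diff)
    show "norm (ft N f k ^ s * of_real (1 - w k ^ s) * ee N (- (k * y))) \<le> \<phi> k powr (9/2) * (\<rho> powr (real s - 9/2) * E)"
    proof (cases "\<phi> k = 0")
      case True
      then show ?thesis using eq assms(2) by (simp add: zero_power)
    next
      case False
      then have pos: "\<phi> k > 0" by (simp add: \<phi>_def)
      have split: "\<phi> k ^ s = \<phi> k powr (9/2) * \<phi> k powr (real s - 9/2)"
        using pos by (simp add: powr_realpow flip: powr_add)
      have "\<phi> k powr (real s - 9/2) * (1 - w k ^ s) \<le> \<rho> powr (real s - 9/2) * E"
      proof (cases "\<delta> * \<rho> \<le> \<phi> k")
        case True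
        have "1 + real s * (w k - 1) \<le> (1 + (w k - 1)) ^ s"
          using w(1)[of k] by (intro Bernoulli_inequality) auto
        moreover have "real s * (1 - w k) \<le> real s * \<eta>"
          using w(3)[OF k] True by (intro mult_left_mono) (auto simp: \<phi>_def)
        moreover have "(1 + (w k - 1)) ^ s = w k ^ s" "real s * (w k - 1) = - (real s * (1 - w k))"
          by (simp_all add: algebra_simps)
        ultimately have "1 - w k ^ s \<le> E" using E0 unfolding E_def by linarith
        moreover have "\<phi> k powr (real s - 9/2) \<le> \<rho> powr (real s - 9/2)"
          using le[of k] assms(2) by (intro powr_mono2) (auto simp: \<phi>_def)
        ultimately show ?thesis using ws by (intro mult_mono) auto
      next
        case False
        then have "\<phi> k powr (real s - 9/2) \<le> (\<delta> * \<rho>) powr (real s - 9/2)"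
          using assms(2) by (intro powr_mono2) (auto simp: \<phi>_def)
        also have "\<dots> = \<rho> powr (real s - 9/2) * \<delta> powr (real s - 9/2)"
          using assms by (simp add: powr_mult)
        also have "\<delta> powr (real s - 9/2) \<le> \<delta> powr (1/2)"
          using assms by (intro powr_mono') auto
        also have "\<delta> powr (1/2) = sqrt \<delta>" using assms by (simp add: powr_half_sqrt)
        finally have "\<phi> k powr (real s - 9/2) \<le> \<rho> powr (real s - 9/2) * E"
          using E0 by (simp add: E_def mult_left_mono order_trans[OF _ mult_left_mono])
        moreover have "\<phi> k powr (real s - 9/2) * (1 - w k ^ s) \<le> \<phi> k powr (real s - 9/2)"
          using ws by (intro mult_left_le) auto
        ultimately show ?thesis by linarith
      qed
      then have "\<phi> k powr (9/2) * (\<phi> k powr (real s - 9/2) * (1 - w k ^ s)) \<le> \<phi> k powr (9/2) * (\<rho> powr (real s - 9/2) * E)"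
        by (rule mult_left_mono) simp
      then show ?thesis unfolding eq split by (simp only: mult.assoc)
    qed
  qed
  also have "\<dots> = (\<Sum>k\<in>{0..<N}. \<phi> k powr (9/2)) * (\<rho> powr (real s - 9/2) * E)"
    by (simp add: sum_distrib_right)
  also have "\<dots> \<le> A * \<rho> powr (9/2) * (\<rho> powr (real s - 9/2) * E)"
    using L E0 by (intro mult_right_mono) (auto simp: \<phi>_def E_def)
  also have "\<dots> = A * (\<rho> powr (9/2) * \<rho> powr (real s - 9/2)) * E" by (simp only: mult.assoc)
  also have "\<rho> powr (9/2) * \<rho> powr (real s - 9/2) = \<rho> ^ s"
    by (subst powr_add[symmetric]) (simp add: powr_realpow assms(4))
  finally show ?thesis by (simp add: E_def)
qed

text \<open>Monotonicity replaces \<open>f\<close> by the indicator of \<open>R\<close>. In the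
  inversion formula frequency 0 gives the density of \<open>R\<close>, and the others gain
  \<open>\<delta>\<close> against the total weight of the kernel.\<close>

lemma smoothed_le:
  fixes N :: int and w :: "int \<Rightarrow> real"
  assumes "N > 0" "R \<subseteq> {0..<N}" "x \<in> {0..<N}" "\<delta> \<ge> 0"
    and f: "\<And>x. 0 \<le> f x" "\<And>x. f x \<le> ind R x"
    and R: "\<And>k. k \<in> {1..<N} \<Longrightarrow> norm (ft N (ind R) k) \<le> \<delta> * real (card R)"
    and K: "\<And>x. K x \<ge> 0" "\<And>k. ft N K k = of_real (w k)" "\<And>k. 0 \<le> w k" "w 0 = 1"
      "(\<Sum>k\<in>{0..<N}. w k) \<le> L"
  shows "conv N f K x \<le> real (card R) / of_int N * (1 + \<delta> * L)"
proof -
  define \<rho> where "\<rho> = real (card R)"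
  have "of_int N * of_real (conv N (ind R) K x) = (\<Sum>k\<in>{0..<N}. ft N (ind R) k * of_real (w k) * ee N (- (k * x)))"
    using ft_inversion[OF assms(1,3), of "conv N (ind R) K"] by (simp add: ft_conv[OF assms(1)] K(2))
  then have "norm (of_int N * complex_of_real (conv N (ind R) K x))
      = norm (\<Sum>k\<in>{0..<N}. ft N (ind R) k * of_real (w k) * ee N (- (k * x)))" by simp
  also have "\<dots> \<le> (\<Sum>k\<in>{0..<N}. norm (ft N (ind R) k) * w k)"
    using K(3) by (intro sum_norm_le) (simp add: norm_mult)
  also have "\<dots> \<le> (\<Sum>k\<in>{0..<N}. (if k = 0 then \<rho> else 0) + \<delta> * \<rho> * w k)"
  proof (intro sum_mono)
    fix k assume "k \<in> {0..<N}"
    show "norm (ft N (ind R) k) * w k \<le> (if k = 0 then \<rho> else 0) + \<delta> * \<rho> * w k"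
    proof (cases "k = 0")
      case True
      have "norm (ft N (ind R) 0) \<le> \<rho>"
        using norm_ft_le[of "ind R" N 0] assms(2) by (simp add: sum_ind \<rho>_def)
      then show ?thesis using True K(4) assms(4) by (simp add: \<rho>_def add_increasing2)
    next
      case False
      then show ?thesis using R[of k] \<open>k \<in> {0..<N}\<close> K(3) by (simp add: \<rho>_def mult_right_mono)
    qed
  qed
  also have "\<dots> = \<rho> + \<delta> * \<rho> * (\<Sum>k\<in>{0..<N}. w k)"
    using assms(1) by (simp add: sum.distrib sum_distrib_left)
  also have "\<dots> \<le> \<rho> + \<delta> * \<rho> * L"
    using K(5) assms(4) by (intro add_left_mono mult_left_mono) (auto simp: \<rho>_def)
  finally have "of_int N * conv N (ind R) K x \<le> \<rho> * (1 + \<delta> * L)"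
    using assms(1) K(1) by (simp add: norm_mult conv_nonneg algebra_simps)
  then have "conv N (ind R) K x \<le> \<rho> / of_int N * (1 + \<delta> * L)"
    using assms(1) by (simp add: field_simps)
  moreover have "conv N f K x \<le> conv N (ind R) K x"
    using f K(1) by (intro conv_mono) auto
  ultimately show ?thesis by (simp add: \<rho>_def)
qed

text \<open>Since \<open>h\<close> is at most \<open>1 + \<xi>\<close> times the density \<rho>/N
  and has relative mean at least \<open>\<alpha>\<close>, its level set at height
  \<open>\<xi>\<close> times that density has density at least
  \<open>\<beta> = \<alpha> - 2 * \<xi>\<close>. The two conditions on \<open>\<xi>\<close> are
  those of the count on a dense set, rewritten for this \<open>\<beta>\<close>.\<close>

lemma bounded_density_count:
  fixes N :: int and \<xi> \<alpha> \<rho> :: real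
  assumes "N > 0" "0 < \<xi>" "8 / \<xi> \<le> of_int N" "\<And>p. prime p \<Longrightarrow> p dvd N \<Longrightarrow> 4 / \<xi> \<le> of_int p"
    and h: "\<And>x. 0 \<le> h x" "\<And>x. x \<in> {0..<N} \<Longrightarrow> h x \<le> \<rho> / of_int N * (1 + \<xi>)"
    and sum: "\<alpha> * \<rho> \<le> (\<Sum>x\<in>{0..<N}. h x)" and "\<rho> > 0" "\<alpha> \<le> 1"
    and \<xi>: "(2 * real s + 4) * \<xi> \<le> \<alpha>" "(4 * real s + 2) * \<xi> \<le> real s * \<alpha> - 1"
    and s: "s \<ge> 2" and y: "y \<in> {0..<N}"
  shows "of_int N * cpow N h s y \<ge> \<xi> ^ s * ((\<xi>\<^sup>2 / 32) ^ (s - 2) * \<xi>) * \<rho> ^ s"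
proof -
  define \<sigma> where "\<sigma> = \<rho> / of_int N"
  have N: "real_of_int N > 0" using assms(1) by simp
  have \<sigma>: "\<sigma> > 0" using assms by (simp add: \<sigma>_def)
  define B where "B = {x \<in> {0..<N}. \<xi> * \<sigma> \<le> h x}"
  have B: "B \<subseteq> {0..<N}" by (auto simp: B_def)
  have "\<alpha> * (of_int N * \<sigma>) \<le> (\<Sum>x\<in>{0..<N}. h x)" using sum N by (simp add: \<sigma>_def)
  also have "\<dots> \<le> (\<Sum>x\<in>{0..<N}. \<sigma> * (1 + \<xi>) * ind B x + \<xi> * \<sigma>)"
  proof (intro sum_mono)
    fix x assume x: "x \<in> {0..<N}"
    have "0 \<le> \<xi> * \<sigma>" using \<sigma> assms(2) by simp
    then show "h x \<le> \<sigma> * (1 + \<xi>) * ind B x + \<xi> * \<sigma>"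
      using h(2)[OF x] x by (cases "x \<in> B") (auto simp: B_def ind_def \<sigma>_def)
  qed
  also have "\<dots> = \<sigma> * ((1 + \<xi>) * real (card B) + \<xi> * of_int N)"
    using assms(1) sum_ind[OF _ B] by (simp add: sum.distrib algebra_simps flip: sum_distrib_left)
  finally have "\<sigma> * (\<alpha> * of_int N) \<le> \<sigma> * ((1 + \<xi>) * real (card B) + \<xi> * of_int N)"
    by (simp add: algebra_simps)
  then have 1: "\<alpha> * of_int N \<le> (1 + \<xi>) * real (card B) + \<xi> * of_int N" using \<sigma> by (simp only: mult_le_cancel_left_pos)
  have "card B \<le> card {0..<N}" using B by (intro card_mono) auto
  then have "real (card B) \<le> of_int N" using assms(1) by simp
  then have "\<xi> * real (card B) \<le> \<xi> * of_int N" using assms(2) by simp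
  with 1 have 2: "(\<alpha> - 2 * \<xi>) * of_int N \<le> real (card B)" by (simp add: algebra_simps)
  have "(\<xi>\<^sup>2 / 32) ^ (s - 2) * \<xi> * of_int N ^ (s - 1) \<le> cpow N (ind B) s y"
  proof (rule cpow_ind_lower_bound[OF assms(1-4) B 2])
    show "2 * (real s + 1) * \<xi> \<le> \<alpha> - 2 * \<xi>" using \<xi>(1) by (simp add: algebra_simps)
    show "2 * (real s + 1) * \<xi> \<le> real s * (\<alpha> - 2 * \<xi>) - 1" using \<xi>(2) by (simp add: algebra_simps)
  qed (use s y in auto)
  then have "(\<xi> * \<sigma>) ^ s * ((\<xi>\<^sup>2 / 32) ^ (s - 2) * \<xi> * of_int N ^ (s - 1)) \<le> (\<xi> * \<sigma>) ^ s * cpow N (ind B) s y"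
    using \<sigma> assms(2) by (intro mult_left_mono) auto
  also have "\<dots> = cpow N (\<lambda>x. \<xi> * \<sigma> * ind B x) s y" by (simp add: cpow_cmult)
  also have "\<dots> \<le> cpow N h s y"
    using \<sigma> assms(2) h(1) by (intro cpow_mono) (auto simp: B_def ind_def indicator_def)
  finally have "of_int N * ((\<xi> * \<sigma>) ^ s * ((\<xi>\<^sup>2 / 32) ^ (s - 2) * \<xi> * of_int N ^ (s - 1))) \<le> of_int N * cpow N h s y"
    using N by (intro mult_left_mono) auto
  moreover have "of_int N * ((\<xi> * \<sigma>) ^ s * ((\<xi>\<^sup>2 / 32) ^ (s - 2) * \<xi> * of_int N ^ (s - 1)))
      = \<xi> ^ s * ((\<xi>\<^sup>2 / 32) ^ (s - 2) * \<xi>) * (\<sigma> * of_int N) ^ s"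
  proof -
    have "real_of_int N * of_int N ^ (s - 1) = of_int N ^ s" using s by (cases s) auto
    then show ?thesis by (simp add: power_mult_distrib algebra_simps)
  qed
  moreover have "\<sigma> * of_int N = \<rho>" using N by (simp add: \<sigma>_def)
  ultimately show ?thesis by (simp only:)
qed

text \<open>The constants depend on \<open>s\<close>, \<open>\<alpha>\<close> and \<open>A\<close>
  only, and their order matters: the mesh \<open>m\<close> and the bound \<open>n\<close> on the
  number of large frequencies are fixed before the decay \<open>\<delta>\<close> of
  \<open>R\<close>, which has to beat \<open>m ^ n\<close>.\<close>

lemma transference:
  fixes s :: nat and \<alpha> A :: real
  assumes "s \<ge> 5" "1 / real s < \<alpha>" "\<alpha> \<le> 1" "A > 0"
  shows "\<exists>c>0. \<exists>\<delta>>0. \<exists>P>(0::real). \<forall>(N::int) R f y.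
    N > 0 \<longrightarrow> R \<subseteq> {0..<N} \<longrightarrow> R \<noteq> {} \<longrightarrow> P \<le> of_int N \<longrightarrow> (\<forall>p. prime p \<longrightarrow> p dvd N \<longrightarrow> P \<le> of_int p) \<longrightarrow>
    (\<forall>k\<in>{1..<N}. norm (ft N (ind R) k) \<le> \<delta> * real (card R)) \<longrightarrow>
    (\<forall>x. 0 \<le> f x \<and> f x \<le> ind R x) \<longrightarrow>
    (\<Sum>k\<in>{0..<N}. norm (ft N f k) powr (9/2)) \<le> A * real (card R) powr (9/2) \<longrightarrow>
    \<alpha> * real (card R) \<le> (\<Sum>x\<in>{0..<N}. f x) \<longrightarrow> y \<in> {0..<N} \<longrightarrow>
    c * real (card R) ^ s \<le> of_int N * cpow N f s y"
proof -
  \<comment> \<open>The denominator dominates both coefficients \<open>2 * s + 4\<close> and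
    \<open>4 * s + 2\<close> required later.\<close>
  define \<xi> where "\<xi> = min (real s * \<alpha> - 1) \<alpha> / (4 * real s + 4)"
  have s0: "real s > 0" using assms(1) by simp
  have s\<alpha>: "real s * \<alpha> > 1" using assms(2) s0 by (simp add: field_simps)
  have \<alpha>0: "\<alpha> > 0" using assms(2) s0 by (meson less_trans zero_less_divide_1_iff)
  have \<xi>0: "\<xi> > 0" using s\<alpha> \<alpha>0 s0 by (simp add: \<xi>_def)
  have \<xi>eq: "(4 * real s + 4) * \<xi> = min (real s * \<alpha> - 1) \<alpha>" using s0 by (simp add: \<xi>_def)
  have "(2 * real s + 4) * \<xi> \<le> (4 * real s + 4) * \<xi>" "(4 * real s + 2) * \<xi> \<le> (4 * real s + 4) * \<xi>"
    using \<xi>0 s0 by (auto intro!: mult_right_mono)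
  then have \<xi>1: "(2 * real s + 4) * \<xi> \<le> \<alpha>" "(4 * real s + 2) * \<xi> \<le> real s * \<alpha> - 1"
    unfolding \<xi>eq by linarith+
  define c1 where "c1 = \<xi> ^ s * ((\<xi>\<^sup>2 / 32) ^ (s - 2) * \<xi>)"
  have c1: "c1 > 0" using \<xi>0 by (simp add: c1_def)
  \<comment> \<open>Relative to \<open>card R ^ s\<close>, small frequencies cost
    \<open>A * sqrt \<delta>1\<close> and large ones \<open>A * s * \<eta>\<close>. Each is kept
    below \<open>c1 / 4\<close>, so half of the main term survives.\<close>
  define \<delta>1 where "\<delta>1 = min 1 ((c1 / (4 * A))\<^sup>2)"
  have \<delta>1: "0 < \<delta>1" "\<delta>1 \<le> 1" using c1 assms(4) by (auto simp: \<delta>1_def)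
  have "sqrt \<delta>1 \<le> sqrt ((c1 / (4 * A))\<^sup>2)"
    unfolding \<delta>1_def by (rule real_sqrt_le_mono) simp
  then have "sqrt \<delta>1 \<le> c1 / (4 * A)" using c1 assms(4) by simp
  then have A\<delta>: "A * sqrt \<delta>1 \<le> c1 / 4" using assms(4) by (simp add: field_simps)
  obtain m :: nat where m: "real m > 2 * pi * real s * A * 4 / c1" using reals_Archimedean2 by blast
  moreover have "2 * pi * real s * A * 4 / c1 \<ge> 0" using c1 assms(4) by simp
  ultimately have m0: "m > 0" by (metis of_nat_0_less_iff order_le_less_trans)
  define \<eta> where "\<eta> = 2 * pi / real m"
  have \<eta>0: "\<eta> \<ge> 0" by (simp add: \<eta>_def)
  have A\<eta>: "A * (real s * \<eta>) \<le> c1 / 4"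
    using m m0 c1 by (simp add: \<eta>_def field_simps)
  \<comment> \<open>At most \<open>n\<close> frequencies can reach
    \<open>\<delta>1 * card R\<close>, so the smoothing kernel has total weight at most
    \<open>m ^ n\<close>, and \<open>\<delta>\<close> brings this down to
    \<open>\<xi>\<close>.\<close>
  define n where "n = nat \<lceil>A / \<delta>1 powr (9/2)\<rceil>"
  define \<delta> where "\<delta> = \<xi> / real m ^ n"
  define P where "P = 8 / \<xi>"
  have goal: "c1 / 2 * real (card R) ^ s \<le> of_int N * cpow N f s y"
    if N: "N > 0" "R \<subseteq> {0..<N}" "R \<noteq> {}" "P \<le> of_int N" and p: "\<And>p. prime p \<Longrightarrow> p dvd N \<Longrightarrow> P \<le> of_int p"
    and R: "\<And>k. k \<in> {1..<N} \<Longrightarrow> norm (ft N (ind R) k) \<le> \<delta> * real (card R)"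
    and f: "\<And>x. 0 \<le> f x" "\<And>x. f x \<le> ind R x"
    and L: "(\<Sum>k\<in>{0..<N}. norm (ft N f k) powr (9/2)) \<le> A * real (card R) powr (9/2)"
    and dens: "\<alpha> * real (card R) \<le> (\<Sum>x\<in>{0..<N}. f x)" and y: "y \<in> {0..<N}"
    for N R f y
  proof -
    define \<rho> where "\<rho> = real (card R)"
    have "finite R" using N(2) finite_subset by blast
    then have \<rho>0: "\<rho> > 0" using N(3) by (simp add: \<rho>_def card_gt_0_iff)
    define \<Lambda> where "\<Lambda> = {k \<in> {0..<N}. \<delta>1 * \<rho> \<le> norm (ft N f k)}"
    have fin: "finite \<Lambda>" by (rule finite_subset[of _ "{0..<N}"]) (auto simp: \<Lambda>_def)
    \<comment> \<open>Chebyshev's inequality for the moment of order \<open>9/2\<close>.\<close>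
    have "real (card \<Lambda>) * (\<delta>1 powr (9/2) * \<rho> powr (9/2)) = (\<Sum>k\<in>\<Lambda>. (\<delta>1 * \<rho>) powr (9/2))"
      using \<delta>1 \<rho>0 by (simp add: powr_mult)
    also have "\<dots> \<le> (\<Sum>k\<in>\<Lambda>. norm (ft N f k) powr (9/2))"
      using \<delta>1 \<rho>0 by (intro sum_mono powr_mono2) (auto simp: \<Lambda>_def)
    also have "\<dots> \<le> (\<Sum>k\<in>{0..<N}. norm (ft N f k) powr (9/2))"
      by (intro sum_mono2) (auto simp: \<Lambda>_def)
    also have "\<dots> \<le> A * \<rho> powr (9/2)" using L by (simp add: \<rho>_def)
    finally have "(real (card \<Lambda>) * \<delta>1 powr (9/2)) * \<rho> powr (9/2) \<le> A * \<rho> powr (9/2)"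
      by (simp only: mult.assoc)
    then have "real (card \<Lambda>) * \<delta>1 powr (9/2) \<le> A"
      using \<rho>0 by (simp add: mult_le_cancel_right)
    then have "real (card \<Lambda>) \<le> A / \<delta>1 powr (9/2)" using \<delta>1 by (simp add: field_simps)
    then have card\<Lambda>: "card \<Lambda> \<le> n" unfolding n_def by linarith
    obtain K w where K: "\<And>x. K x \<ge> 0" "\<And>k. ft N K k = of_real (w k)"
      "\<And>k. 0 \<le> w k" "\<And>k. w k \<le> 1" "w 0 = (1::real)"
      "\<And>k. k \<in> \<Lambda> \<Longrightarrow> 1 - 2 * pi / real m \<le> w k"
      "(\<Sum>k\<in>{0..<N}. w k) \<le> real m ^ card \<Lambda>"
      using smoothing_kernel[OF N(1) m0 fin] by blast
    define h where "h = conv N f K"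
    have ft_h: "ft N h k = ft N f k * of_real (w k)" for k
      by (simp add: h_def ft_conv[OF N(1)] K(2))
    have sum_h: "(\<Sum>x\<in>{0..<N}. h x) = (\<Sum>x\<in>{0..<N}. f x)"
    proof -
      have "complex_of_real (\<Sum>x\<in>{0..<N}. h x) = of_real (\<Sum>x\<in>{0..<N}. f x)"
        using ft_h[of 0] by (simp add: ft_0 K(5) del: of_real_sum)
      then show ?thesis using of_real_eq_iff by blast
    qed
    have "real m ^ card \<Lambda> \<le> real m ^ n"
      using card\<Lambda> m0 by (intro power_increasing) auto
    then have "\<delta> * real m ^ card \<Lambda> \<le> \<delta> * real m ^ n"
      using \<xi>0 by (intro mult_left_mono) (auto simp: \<delta>_def)
    also have "\<dots> = \<xi>" using m0 by (simp add: \<delta>_def)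
    finally have \<delta>m: "\<delta> * real m ^ card \<Lambda> \<le> \<xi>" .
    have h_le: "h x \<le> \<rho> / of_int N * (1 + \<xi>)" if "x \<in> {0..<N}" for x
    proof -
      have "h x \<le> \<rho> / of_int N * (1 + \<delta> * real m ^ card \<Lambda>)"
        unfolding h_def \<rho>_def using K f \<xi>0
        by (intro smoothed_le[OF N(1,2) that _ f R K(1,2,3,5,7)]) (auto simp: \<delta>_def)
      also have "\<dots> \<le> \<rho> / of_int N * (1 + \<xi>)"
        using \<delta>m \<rho>0 N(1) by (intro mult_left_mono) auto
      finally show ?thesis .
    qed
    have "c1 * \<rho> ^ s \<le> of_int N * cpow N h s y"
      unfolding c1_def
    proof (rule bounded_density_count[OF N(1) \<xi>0, where \<alpha> = \<alpha>])
      show "8 / \<xi> \<le> of_int N" using N(4) by (simp add: P_def)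
      show "4 / \<xi> \<le> of_int p" if "prime p" "p dvd N" for p
      proof -
        have "4 / \<xi> \<le> 8 / \<xi>" using \<xi>0 by (simp add: divide_right_mono)
        then show ?thesis using p[OF that] by (simp add: P_def)
      qed
      show "h x \<ge> 0" for x unfolding h_def using f K by (intro conv_nonneg) auto
    qed (use h_le sum_h dens \<rho>0 \<xi>1 assms y in \<open>auto simp: \<rho>_def\<close>)
    moreover have "\<bar>of_int N * cpow N f s y - of_int N * cpow N h s y\<bar> \<le> A * \<rho> ^ s * (real s * \<eta> + sqrt \<delta>1)"
    proof (rule smoothing_error[OF N(1) assms(1) y \<rho>0 _ \<delta>1 \<eta>0 _ _ K(3,4) _ ft_h])
      show "norm (ft N f k) \<le> \<rho>" for k
      proof -
        have "norm (ft N f k) \<le> (\<Sum>x\<in>{0..<N}. f x)" using f by (intro norm_ft_le) auto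
        also have "\<dots> \<le> (\<Sum>x\<in>{0..<N}. ind R x)" using f by (intro sum_mono) auto
        finally show ?thesis using N(2) by (simp add: sum_ind \<rho>_def)
      qed
      show "1 - \<eta> \<le> w k" if "k \<in> {0..<N}" "\<delta>1 * \<rho> \<le> norm (ft N f k)" for k
        using K(6)[of k] that by (simp add: \<Lambda>_def \<eta>_def)
    qed (use assms(4) L in \<open>auto simp: \<rho>_def\<close>)
    moreover have "A * \<rho> ^ s * (real s * \<eta> + sqrt \<delta>1) \<le> c1 / 2 * \<rho> ^ s"
    proof -
      have "(A * (real s * \<eta>) + A * sqrt \<delta>1) * \<rho> ^ s \<le> (c1 / 4 + c1 / 4) * \<rho> ^ s"
        using A\<eta> A\<delta> \<rho>0 by (intro mult_right_mono add_mono) auto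
      then show ?thesis by (simp add: algebra_simps)
    qed
    moreover have "c1 * \<rho> ^ s = c1 / 2 * \<rho> ^ s + c1 / 2 * \<rho> ^ s" by simp
    ultimately show ?thesis unfolding \<rho>_def[symmetric] by linarith
  qed
  have pos: "0 < c1 / 2" "0 < \<delta>" "0 < P" using c1 \<xi>0 m0 by (auto simp: \<delta>_def P_def)
  show ?thesis
  proof (rule exI[of _ "c1 / 2"], rule conjI[OF pos(1)], rule exI[of _ \<delta>], rule conjI[OF pos(2)],
      rule exI[of _ P], rule conjI[OF pos(3)], intro allI impI)
  qed (rule goal; blast)
qed

section \<open>Squares modulo prime powers\<close>

text \<open>The root ranges over all integers, so that witnesses from Hensel lifting and from the
  Chinese remainder theorem need no reduction.\<close>

definition sq :: "int \<Rightarrow> int set" where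
  "sq N = {x \<in> {0..<N}. \<exists>y. [x = y\<^sup>2] (mod N)}"

text \<open>After squaring the modulus, the substitution of \<open>d + z\<close> for
  \<open>y\<close> makes the exponent linear in \<open>z\<close>; orthogonality then leaves only
  \<open>d = 0\<close>, as \<open>2 * k\<close> is a unit modulo \<open>p\<close>.\<close>

lemma norm_gauss_sum:
  fixes p k :: int
  assumes "prime p" "odd p" "\<not> p dvd k"
  shows "norm (\<Sum>y\<in>{0..<p}. ee p (k * y\<^sup>2)) = sqrt (of_int p)"
proof -
  have p: "p > 0" "p \<noteq> 0" using assms(1) prime_gt_0_int by force+
  let ?G = "\<Sum>y\<in>{0..<p}. ee p (k * y\<^sup>2)"
  have "of_real ((norm ?G)\<^sup>2) = (\<Sum>z\<in>{0..<p}. \<Sum>y\<in>{0..<p}. ee p (k * (y\<^sup>2 - z\<^sup>2)))"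
    by (subst sum.swap)
       (simp add: complex_norm_square sum_product cnj_ee cnj_sum right_diff_distrib ee_add[symmetric] del: of_real_power)
  also have "\<dots> = (\<Sum>z\<in>{0..<p}. \<Sum>d\<in>{0..<p}. ee p (k * d\<^sup>2) * ee p (z * (2 * k * d)))"
  proof (rule sum.cong[OF refl])
    fix z
    have "(\<Sum>y\<in>{0..<p}. ee p (k * (y\<^sup>2 - z\<^sup>2))) = (\<Sum>d\<in>{0..<p}. ee p (k * (((d + z) mod p)\<^sup>2 - z\<^sup>2)))"
      by (rule sum_residue_shift[OF p(1), symmetric])
    also have "\<dots> = (\<Sum>d\<in>{0..<p}. ee p (k * ((d + z)\<^sup>2 - z\<^sup>2)))"
    proof (intro sum.cong refl ee_cong p)
      fix d
      have "[((d + z) mod p)\<^sup>2 = (d + z)\<^sup>2] (mod p)" by (intro cong_pow) simp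
      then show "[k * (((d + z) mod p)\<^sup>2 - z\<^sup>2) = k * ((d + z)\<^sup>2 - z\<^sup>2)] (mod p)"
        by (intro cong_mult cong_diff cong_refl)
    qed
    also have "\<dots> = (\<Sum>d\<in>{0..<p}. ee p (k * d\<^sup>2) * ee p (z * (2 * k * d)))"
      unfolding ee_add[symmetric] by (intro sum.cong refl arg_cong[of _ _ "ee p"]) (simp add: power2_eq_square algebra_simps)
    finally show "(\<Sum>y\<in>{0..<p}. ee p (k * (y\<^sup>2 - z\<^sup>2)))
        = (\<Sum>d\<in>{0..<p}. ee p (k * d\<^sup>2) * ee p (z * (2 * k * d)))" .
  qed
  also have "\<dots> = (\<Sum>d\<in>{0..<p}. ee p (k * d\<^sup>2) * (\<Sum>z\<in>{0..<p}. ee p (z * (2 * k * d))))"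
    by (subst sum.swap) (simp add: sum_distrib_left)
  also have "\<dots> = (\<Sum>d\<in>{0..<p}. if d = 0 then of_int p else 0)"
  proof (intro sum.cong refl)
    fix d assume d: "d \<in> {0..<p}"
    have "\<not> p dvd 2" using assms(1,2) by (metis dvd_refl prime_int_numeral_eq primes_dvd_imp_eq two_is_prime_nat)
    then have "p dvd 2 * k * d \<longleftrightarrow> p dvd d"
      using assms by (simp add: prime_dvd_mult_iff)
    also have "\<dots> \<longleftrightarrow> d = 0" using d by (auto dest: zdvd_imp_le)
    finally show "ee p (k * d\<^sup>2) * (\<Sum>z\<in>{0..<p}. ee p (z * (2 * k * d))) = (if d = 0 then of_int p else 0)"
      by (auto simp: sum_ee[OF p(1)])
  qed
  also have "\<dots> = of_real (of_int p)" using p by simp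
  finally have "(norm ?G)\<^sup>2 = of_int p" using of_real_eq_iff by blast
  then show ?thesis by (metis norm_ge_zero real_sqrt_unique)
qed

text \<open>Squaring is two-to-one away from 0, the roots being \<open>y0\<close> and
  \<open>p - y0\<close>. With an additive character for \<open>h\<close> this turns Gauss sums into
  sums over squares; with the constant 1 it counts them.\<close>

lemma sum_over_squares:
  fixes h :: "int \<Rightarrow> complex"
  assumes "prime p" "odd p"
  shows "(\<Sum>y\<in>{0..<p}. h (y\<^sup>2 mod p)) = h 0 + 2 * (\<Sum>x\<in>sq p - {0}. h x)"
proof -
  have p: "p > 0" "p \<noteq> 0" using assms(1) prime_gt_0_int by force+
  have im: "(\<lambda>y. y\<^sup>2 mod p) ` {0..<p} = sq p"
  proof (intro equalityI subsetI)
    fix x assume "x \<in> sq p"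
    then obtain y where y: "x \<in> {0..<p}" "x mod p = y\<^sup>2 mod p" by (auto simp: sq_def Cong.cong_def)
    then have "x = (y mod p)\<^sup>2 mod p" by (simp add: power_mod)
    then show "x \<in> (\<lambda>y. y\<^sup>2 mod p) ` {0..<p}" using p by auto
  qed (use p in \<open>auto simp: sq_def Cong.cong_def\<close>)
  have fibre: "card {y \<in> {0..<p}. y\<^sup>2 mod p = x} = 2" if x: "x \<in> sq p - {0}" for x
  proof -
    obtain y0 where y0: "y0 \<in> {0..<p}" "x = y0\<^sup>2 mod p" using x im by blast
    then have "y0 \<noteq> 0" using x by auto
    have "{y \<in> {0..<p}. y\<^sup>2 mod p = x} = {y0, p - y0}"
    proof (intro equalityI subsetI)
      fix y assume "y \<in> {y \<in> {0..<p}. y\<^sup>2 mod p = x}"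
      then have y: "y \<in> {0..<p}" "y\<^sup>2 mod p = y0\<^sup>2 mod p" using y0 by auto
      then have "p dvd (y - y0) * (y + y0)"
        by (simp add: mod_eq_dvd_iff power2_eq_square algebra_simps)
      then have "p dvd y - y0 \<or> p dvd y + y0" using assms(1) by (simp add: prime_dvd_mult_iff)
      then show "y \<in> {y0, p - y0}"
      proof
        assume "p dvd y - y0"
        then have "y mod p = y0 mod p" by (simp add: mod_eq_dvd_iff)
        then show ?thesis using y y0 by simp
      next
        assume "p dvd y + y0"
        then obtain j where j: "y + y0 = p * j" by blast
        have "y + y0 < p * 2" "0 < y + y0" using y y0 \<open>y0 \<noteq> 0\<close> by auto
        then have "p * j < p * 2" "0 < p * j" using j by simp_all
        then have "j < 2" "0 < j" using p(1) by (simp_all only: mult_less_cancel_left_pos zero_less_mult_iff) auto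
        then have "j = 1" by simp
        then show ?thesis using j by simp
      qed
    next
      fix y assume "y \<in> {y0, p - y0}"
      moreover have "(p - y0)\<^sup>2 mod p = y0\<^sup>2 mod p"
        by (simp add: mod_eq_dvd_iff power2_eq_square algebra_simps)
      ultimately show "y \<in> {y \<in> {0..<p}. y\<^sup>2 mod p = x}" using y0 \<open>y0 \<noteq> 0\<close> by auto
    qed
    moreover have "y0 \<noteq> p - y0" using assms(2) by presburger
    ultimately show ?thesis by simp
  qed
  have zero: "{y \<in> {0..<p}. y\<^sup>2 mod p = 0} = {0}"
    using assms(1) p by (auto simp: mod_eq_0_iff_dvd prime_dvd_power_iff dest: zdvd_imp_le)
  have "0 \<in> sq p" using p by (auto simp: sq_def intro: exI[of _ 0])
  have fin: "finite (sq p)" by (rule finite_subset[of _ "{0..<p}"]) (auto simp: sq_def)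
  have "(\<Sum>y\<in>{0..<p}. h (y\<^sup>2 mod p)) = (\<Sum>x\<in>sq p. \<Sum>y\<in>{y \<in> {0..<p}. y\<^sup>2 mod p = x}. h (y\<^sup>2 mod p))"
    unfolding im[symmetric] by (rule sum.image_gen) simp
  also have "\<dots> = (\<Sum>x\<in>sq p. of_nat (card {y \<in> {0..<p}. y\<^sup>2 mod p = x}) * h x)"
    by (intro sum.cong refl) simp
  also have "\<dots> = h 0 + (\<Sum>x\<in>sq p - {0}. of_nat (card {y \<in> {0..<p}. y\<^sup>2 mod p = x}) * h x)"
    unfolding sum.remove[OF fin \<open>0 \<in> sq p\<close>] zero by simp
  also have "(\<Sum>x\<in>sq p - {0}. of_nat (card {y \<in> {0..<p}. y\<^sup>2 mod p = x}) * h x) = 2 * (\<Sum>x\<in>sq p - {0}. h x)"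
    unfolding sum_distrib_left by (intro sum.cong refl) (simp only: fibre of_nat_numeral)
  finally show ?thesis .
qed

lemma sq_subset: "sq N \<subseteq> {0..<N}"
  by (auto simp: sq_def)

lemma finite_sq [simp]: "finite (sq N)"
  using sq_subset finite_subset by blast

lemma card_nonzero_squares:
  assumes "prime p" "odd p"
  shows "2 * real (card (sq p - {0})) + 1 = of_int p"
proof -
  have p: "p > 0" using assms(1) prime_gt_0_int by force
  have "complex_of_real (2 * real (card (sq p - {0})) + 1) = of_real (of_int p)"
    using sum_over_squares[OF assms, of "\<lambda>_. 1"] p by simp
  then show ?thesis using of_real_eq_iff by blast
qed

text \<open>If \<open>F\<close> is the sum over nonzero squares, the Gauss sum is
  \<open>1 + 2 * F\<close>. With or without the zero class the coefficient is \<open>F + 1\<close>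
  or \<open>F\<close>, hence at most (sqrt p + 1)/2 in modulus.\<close>

lemma norm_ft_squares_le:
  assumes "prime p" "odd p" "\<not> p dvd k" "R = sq p \<or> R = sq p - {0}"
  shows "norm (ft p (ind R) k) \<le> sqrt (of_int p)"
proof -
  have p: "p > 0" "p \<noteq> 0" using assms(1) prime_gt_0_int by force+
  define F where "F = (\<Sum>x\<in>sq p - {0}. ee p (k * x))"
  have ft: "ft p (ind T) k = (\<Sum>x\<in>T. ee p (k * x))" if "T \<subseteq> {0..<p}" for T
    unfolding ft_def using that by (intro sum.mono_neutral_cong_right) (auto simp: ind_def)
  have "0 \<in> sq p" using p by (auto simp: sq_def intro: exI[of _ 0])
  then have cases: "ft p (ind R) k = F \<or> ft p (ind R) k = F + 1"
    using assms(4) sq_subset[of p] by (auto simp: ft F_def sum.remove[of _ 0] subset_iff)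
  have "(\<Sum>y\<in>{0..<p}. ee p (k * y\<^sup>2)) = 1 + 2 * F"
    using sum_over_squares[OF assms(1,2), of "\<lambda>x. ee p (k * x)"] p by (simp add: F_def ee_mult_mod)
  then have G: "norm (1 + 2 * F) = sqrt (of_int p)" using norm_gauss_sum[OF assms(1-3)] by simp
  have "1 \<le> sqrt (of_int p)" using p by simp
  moreover have "norm (2 * F) \<le> norm (1 + 2 * F) + 1"
    using norm_triangle_ineq4[of "1 + 2 * F" 1] by simp
  moreover have "norm (2 * (F + 1)) \<le> norm (1 + 2 * F) + 1"
    using norm_triangle_ineq[of "1 + 2 * F" 1] by (simp add: algebra_simps)
  moreover have "norm (2 * F) = 2 * norm F" "norm (2 * (F + 1)) = 2 * norm (F + 1)"
    by (simp_all only: norm_mult norm_numeral)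
  ultimately have "norm F \<le> sqrt (of_int p)" "norm (F + 1) \<le> sqrt (of_int p)"
    unfolding G by linarith+
  with cases show ?thesis by auto
qed

section \<open>Lifting from a prime to its powers\<close>

lemma bij_betw_mixed_radix:
  fixes p q :: int
  assumes "p > 0" "q > 0"
  shows "bij_betw (\<lambda>(a, b). a + p * b) ({0..<p} \<times> {0..<q}) {0..<p * q}"
proof (rule bij_betw_byWitness[where f' = "\<lambda>x. (x mod p, x div p)"])
  show "(\<lambda>(a, b). a + p * b) ` ({0..<p} \<times> {0..<q}) \<subseteq> {0..<p * q}"
  proof safe
    fix a b :: int assume ab: "a \<in> {0..<p}" "b \<in> {0..<q}"
    then have "p * b \<le> p * (q - 1)" using assms by (intro mult_left_mono) auto
    then show "a + p * b \<in> {0..<p * q}" using ab assms by (simp add: algebra_simps)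
  qed
qed (use assms in \<open>auto simp: pos_imp_zdiv_nonneg_iff intro: int_div_less\<close>)

text \<open>The lifted set is invariant under translation by \<open>p\<close>, so its transform
  lives on the annihilator of the multiples of \<open>p\<close>, namely the multiples of
  \<open>q\<close>.\<close>

lemma ft_pullback:
  fixes p q :: int
  assumes "p > 0" "q > 0" "R0 \<subseteq> {0..<p}"
  defines "R \<equiv> {x \<in> {0..<p * q}. x mod p \<in> R0}"
  shows "ft (p * q) (ind R) k = (if q dvd k then of_int q * ft p (ind R0) (k div q) else 0)"
proof -
  have ee1: "ee (p * q) (k * (a + p * b)) = ee (p * q) (k * a) * ee q (b * k)" for a b
  proof -
    have "ee (p * q) (p * (k * b)) = ee q (b * k)" using assms(1) by (simp add: ee_def mult_ac)
    then show ?thesis by (simp add: ring_distribs ee_add mult.left_commute[of k p])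
  qed
  have "ft (p * q) (ind R) k = (\<Sum>(a, b)\<in>{0..<p} \<times> {0..<q}. of_real (ind R (a + p * b)) * ee (p * q) (k * (a + p * b)))"
    unfolding ft_def sum.reindex_bij_betw[OF bij_betw_mixed_radix[OF assms(1,2)], symmetric]
    by (intro sum.cong) auto
  also have "\<dots> = (\<Sum>(a, b)\<in>{0..<p} \<times> {0..<q}. of_real (ind R0 a) * ee (p * q) (k * a) * ee q (b * k))"
  proof (intro sum.cong refl, clarify)
    fix a b assume ab: "a \<in> {0..<p}" "b \<in> {0..<q}"
    then have "a + p * b \<in> {0..<p * q}"
      using bij_betw_apply[OF bij_betw_mixed_radix[OF assms(1,2)], of "(a, b)"] by simp
    moreover have "(a + p * b) mod p = a" using ab by simp
    ultimately have "ind R (a + p * b) = ind R0 a" by (simp add: R_def ind_def indicator_def)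
    then show "of_real (ind R (a + p * b)) * ee (p * q) (k * (a + p * b)) = of_real (ind R0 a) * ee (p * q) (k * a) * ee q (b * k)"
      by (simp add: ee1)
  qed
  also have "\<dots> = (\<Sum>a\<in>{0..<p}. of_real (ind R0 a) * ee (p * q) (k * a) * (\<Sum>b\<in>{0..<q}. ee q (b * k)))"
    by (simp add: sum.cartesian_product[symmetric] sum_distrib_left)
  also have "\<dots> = (if q dvd k then of_int q * ft p (ind R0) (k div q) else 0)"
  proof (cases "q dvd k")
    case True
    then obtain j where j: "k = q * j" by blast
    have "ee (p * q) (k * a) = ee p (j * a)" for a
      using assms(2) by (simp add: ee_def j field_simps)
    then show ?thesis using j assms(2) by (simp add: sum_ee ft_def sum_distrib_left algebra_simps)
  qed (simp add: sum_ee assms(2))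
  finally show ?thesis .
qed

text \<open>Frequency zero of the preceding formula.\<close>

lemma card_pullback:
  fixes p q :: int
  assumes "p > 0" "q > 0" "R0 \<subseteq> {0..<p}"
  shows "real (card {x \<in> {0..<p * q}. x mod p \<in> R0}) = of_int q * real (card R0)"
proof -
  define R where "R = {x \<in> {0..<p * q}. x mod p \<in> R0}"
  have "ft (p * q) (ind R) 0 = of_int q * ft p (ind R0) 0"
    using ft_pullback[OF assms, of 0] by (simp add: R_def)
  moreover have "(\<Sum>x\<in>{0..<p * q}. ind R x) = real (card R)" by (rule sum_ind) (auto simp: R_def)
  moreover have "(\<Sum>x\<in>{0..<p}. ind R0 x) = real (card R0)" by (rule sum_ind) (use assms in auto)
  ultimately have "complex_of_real (real (card R)) = of_real (of_int q * real (card R0))"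
    unfolding ft_0 by simp
  then show ?thesis unfolding R_def of_real_eq_iff .
qed

text \<open>Both bounds are measured against \<open>card R\<close>, the coefficient at frequency 0.
  With this normalisation the Chinese remainder theorem multiplies the constants \<open>A\<close>
  and preserves a common \<open>\<delta>\<close>.\<close>

definition pseudorandom :: "int \<Rightarrow> int set \<Rightarrow> real \<Rightarrow> real \<Rightarrow> bool" where
  "pseudorandom N R A \<delta> \<longleftrightarrow> R \<subseteq> {0..<N} \<and> R \<noteq> {} \<and>
    kbound {0..<N} (\<lambda>k l. norm (ft N (ind R) (k - l))) (A * real (card R)) \<and>
    (\<forall>k\<in>{1..<N}. norm (ft N (ind R) k) \<le> \<delta> * real (card R))"

text \<open>One constant absorbs two losses at \<open>p\<close>: the restriction constant, and the
  ratio of the number of squares to the size of the subset retained.\<close>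

abbreviation local_factor :: "real \<Rightarrow> real" where
  "local_factor p \<equiv> 1 + 12 * 60 powr (7/2) * p powr (-5/4)"

text \<open>Frequencies are written \<open>c + q * j\<close>. The kernel vanishes unless
  \<open>c = c'\<close>, and then it is at most \<open>card R\<close> on the diagonal and
  \<open>\<beta> * card R\<close> off it: the identity in \<open>c\<close> tensored with the local
  kernel in \<open>j\<close>. A prime power therefore costs no more than its prime.\<close>

lemma pseudorandom_pullback:
  fixes p q :: int
  assumes p: "p > 0" "120 powr 18 \<le> real_of_int p" and q: "q > 0"
    and R0: "R0 \<subseteq> {0..<p}" "of_int p \<le> 3 * real (card R0)"
    and le: "\<And>k. \<not> p dvd k \<Longrightarrow> norm (ft p (ind R0) k) \<le> sqrt (of_int p)"
  shows "pseudorandom (p * q) {x \<in> {0..<p * q}. x mod p \<in> R0} (local_factor p) (3 / sqrt (of_int p))"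
proof -
  define R where "R = {x \<in> {0..<p * q}. x mod p \<in> R0}"
  define \<beta> where "\<beta> = 3 / sqrt (of_int p)"
  have \<beta>0: "\<beta> > 0" using p by (simp add: \<beta>_def)
  have card: "real (card R) = of_int q * real (card R0)"
    unfolding R_def by (rule card_pullback[OF p(1) q R0(1)])
  have pos: "real (card R0) > 0" using R0(2) p(1) by linarith
  then have cardpos: "real (card R) > 0" using q by (simp add: card)
  have sub: "R \<subseteq> {0..<p * q}" by (auto simp: R_def)
  \<comment> \<open>The 3 in \<open>\<beta>\<close> comes from \<open>R0\<close> having at least p/3
    elements.\<close>
  have sqrt_le: "sqrt (of_int p) \<le> \<beta> * real (card R0)"
  proof -
    have "sqrt (of_int p) * sqrt (of_int p) = of_int p" using p by simp
    then show ?thesis using R0(2) p by (simp add: \<beta>_def field_simps)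
  qed
  have ft: "ft (p * q) (ind R) k = (if q dvd k then of_int q * ft p (ind R0) (k div q) else 0)" for k
    unfolding R_def by (rule ft_pullback[OF p(1) q R0(1)])
  have bound: "norm (ft (p * q) (ind R) k) \<le> \<beta> * real (card R)" if "\<not> p * q dvd k" for k
  proof (cases "q dvd k")
    case True
    then obtain j where j: "k = q * j" by blast
    then have "\<not> p dvd j" using that by (auto simp: mult.commute[of p])
    then have "of_int q * norm (ft p (ind R0) j) \<le> of_int q * (\<beta> * real (card R0))"
      using le sqrt_le q by (intro mult_left_mono) (auto intro: order_trans)
    then show ?thesis using True q by (simp add: ft j card norm_mult algebra_simps)
  next
    case False
    then show ?thesis using \<beta>0 by (simp add: ft)
  qed
  have "kbound {0..<p * q} (\<lambda>k l. norm (ft (p * q) (ind R) (k - l))) (real (card R) * (local_factor p * 1))"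
  proof (rule kbound_reindex)
    have "kbound {0..<p} (\<lambda>x y. if x = y then 1 else \<beta>) (local_factor p)"
      unfolding \<beta>_def using p by (intro kbound_local) auto
    then show "kbound ({0..<p} \<times> {0..<q}) (\<lambda>z z'. real (card R) * (\<lambda>(x, y) (x', y').
        (if x = x' then 1 else \<beta>) * (if y = y' then 1 else 0)) z z')
        (real (card R) * (local_factor p * 1))"
      by (intro kbound_cmult kbound_tensor kbound_identity) (auto intro!: add_nonneg_nonneg)
    have swap: "bij_betw prod.swap ({0..<p} \<times> {0..<q}) ({0..<q} \<times> {0..<p})"
      by (rule bij_betw_byWitness[where f' = prod.swap]) auto
    have "bij_betw ((\<lambda>(c, j). c + q * j) \<circ> prod.swap) ({0..<p} \<times> {0..<q}) {0..<q * p}"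
      by (rule bij_betw_trans[OF swap bij_betw_mixed_radix[OF q p(1)]])
    then show "bij_betw (\<lambda>(j, c). c + q * j) ({0..<p} \<times> {0..<q}) {0..<p * q}"
      by (simp add: mult.commute o_def case_prod_unfold)
    fix z z' assume "z \<in> {0..<p} \<times> {0..<q}" "z' \<in> {0..<p} \<times> {0..<q}"
    then obtain j c j' c' where z: "z = (j, c)" "z' = (j', c')"
      "j \<in> {0..<p}" "j' \<in> {0..<p}" "c \<in> {0..<q}" "c' \<in> {0..<q}" by auto
    have diff: "c + q * j - (c' + q * j') = (c - c') + q * (j - j')" by (simp add: algebra_simps)
    have "q dvd (c - c') + q * (j - j') \<longleftrightarrow> q dvd c - c'" by (simp add: dvd_add_left_iff)
    also have "\<dots> \<longleftrightarrow> c = c'" using z by (auto simp: mod_eq_dvd_iff[symmetric])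
    finally have qd: "q dvd (c - c') + q * (j - j') \<longleftrightarrow> c = c'" .
    have "norm (ft (p * q) (ind R) ((c - c') + q * (j - j')))
        \<le> real (card R) * ((if j = j' then 1 else \<beta>) * (if c = c' then 1 else 0))"
    proof (cases "c = c'")
      case True
      show ?thesis
      proof (cases "j = j'")
        case eq: True
        have "norm (ft (p * q) (ind R) 0) \<le> real (card R)"
          using norm_ft_le[of "ind R" "p * q" 0] sub by (simp add: sum_ind)
        then show ?thesis using True eq by simp
      next
        case False
        then have "\<not> p dvd j - j'" using z by (auto simp: mod_eq_dvd_iff[symmetric])
        then have "\<not> p * q dvd q * (j - j')" using q by (simp add: mult.commute[of p])
        then show ?thesis using bound[of "q * (j - j')"] True False by (simp add: mult.commute)
      qed
    next
      case False
      then have "ft (p * q) (ind R) ((c - c') + q * (j - j')) = 0" using qd by (simp only: ft if_False)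
      then show ?thesis using False by simp
    qed
    then show "norm (ft (p * q) (ind R) ((\<lambda>(j, c). c + q * j) z - (\<lambda>(j, c). c + q * j) z'))
        \<le> real (card R) * (\<lambda>(x, y) (x', y'). (if x = x' then 1 else \<beta>) * (if y = y' then 1 else 0)) z z'"
      by (simp only: z(1,2) prod.case diff)
  qed
  moreover have "norm (ft (p * q) (ind R) k) \<le> \<beta> * real (card R)" if "k \<in> {1..<p * q}" for k
    using bound[of k] that zdvd_imp_le[of "p * q" k] by auto
  moreover have "R \<noteq> {}" using cardpos by auto
  ultimately show ?thesis
    unfolding pseudorandom_def R_def[symmetric] \<beta>_def[symmetric] using sub by (simp add: mult.commute)
qed

text \<open>A Newton step: with \<open>x - z^2 = p ^ n * t\<close>, the root is corrected to
  \<open>z + p ^ n * u\<close> where \<open>2 * z * u\<close> is congruent to \<open>t\<close>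
  modulo \<open>p\<close>. Such a \<open>u\<close> exists because \<open>p\<close> is odd and does
  not divide \<open>z\<close>.\<close>

lemma hensel_square:
  fixes p x :: int
  assumes "prime p" "odd p" "\<not> p dvd x" "[x = y\<^sup>2] (mod p)" "n \<ge> 1"
  shows "\<exists>z. [x = z\<^sup>2] (mod p ^ n)"
  using assms(5)
proof (induction n rule: dec_induct)
  case base
  then show ?case using assms(4) by auto
next
  case (step n)
  then obtain z where "[x = z\<^sup>2] (mod p ^ n)" by blast
  then obtain t where t: "x - z\<^sup>2 = p ^ n * t" by (auto simp: cong_iff_dvd_diff)
  have "p dvd p ^ n" using step by (simp add: dvd_power)
  have "\<not> p dvd z"
  proof
    assume "p dvd z"
    then have "p dvd z\<^sup>2 + p ^ n * t" using \<open>p dvd p ^ n\<close> by (simp add: power2_eq_square)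
    moreover have "z\<^sup>2 + p ^ n * t = x" using t by simp
    ultimately show False using assms(3) by simp
  qed
  moreover have "\<not> p dvd 2" using assms(1,2) by (metis dvd_refl prime_int_numeral_eq primes_dvd_imp_eq two_is_prime_nat)
  ultimately have "\<not> p dvd 2 * z" using assms(1) by (simp add: prime_dvd_mult_iff)
  then have "coprime (2 * z) p" using assms(1) by (metis coprime_commute prime_imp_coprime)
  then obtain v where v: "[2 * z * v = 1] (mod p)" using cong_solve_coprime_int by blast
  define u where "u = v * t"
  have "[2 * z * v * t = 1 * t] (mod p)" by (intro cong_mult v cong_refl)
  then have "p dvd t - 2 * z * u" by (simp add: u_def cong_iff_dvd_diff mult.assoc dvd_diff_commute)
  then have "p ^ n * p dvd p ^ n * (t - 2 * z * u)" by (intro mult_dvd_mono) auto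
  moreover have "p ^ n * p dvd p ^ n * (p ^ n * u\<^sup>2)" using \<open>p dvd p ^ n\<close> by (intro mult_dvd_mono) auto
  ultimately have "p ^ n * p dvd p ^ n * (t - 2 * z * u) - p ^ n * (p ^ n * u\<^sup>2)" by (rule dvd_diff)
  moreover have "x - (z + p ^ n * u)\<^sup>2 = p ^ n * (t - 2 * z * u) - p ^ n * (p ^ n * u\<^sup>2)"
    using t by (simp add: power2_eq_square algebra_simps)
  ultimately have "[x = (z + p ^ n * u)\<^sup>2] (mod p ^ Suc n)" by (simp add: cong_iff_dvd_diff mult.commute)
  then show ?case by blast
qed

text \<open>For \<open>n \<ge> 2\<close> the set consists of the unit squares, at a relative cost of \<open>O(p powr (-2))\<close>. For \<open>n = 1\<close>
  the zero class has to be kept, since its relative size of order \<open>1 / p\<close> is not summable over primes.\<close>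

lemma pseudorandom_squares_prime_power:
  fixes p :: int
  assumes "prime p" "120 powr 18 \<le> real_of_int p" "n \<ge> 1"
  shows "\<exists>R. R \<subseteq> sq (p ^ n) \<and> real (card (sq (p ^ n))) \<le> local_factor p * real (card R) \<and>
    pseudorandom (p ^ n) R (local_factor p) (3 / sqrt (of_int p))"
proof -
  have "(1::real) \<le> 120 powr 18" by (rule ge_one_powr_ge_zero) auto
  have "(120::real) powr 1 \<le> 120 powr 18" by (rule powr_mono) auto
  then have p120: "p \<ge> 120" using assms(2) by simp
  then have p: "p > 0" "p \<noteq> 0" by auto
  have odd: "odd p" using p120 prime_odd_int[OF assms(1)] by simp
  note cnt = card_nonzero_squares[OF assms(1) odd]
  have "0 \<in> sq p" using p by (auto simp: sq_def intro: exI[of _ 0])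
  then have cnt0: "real (card (sq p)) = real (card (sq p - {0})) + 1"
    using card.remove[OF finite_sq, of 0 p] by simp
  define q where "q = p ^ (n - 1)"
  have q: "q > 0" "p ^ n = p * q" using p assms(3) by (simp_all add: q_def flip: power_Suc)
  have prn: "pseudorandom (p * q) {x \<in> {0..<p * q}. x mod p \<in> R0} (local_factor p) (3 / sqrt (of_int p))"
    if "R0 = sq p \<or> R0 = sq p - {0}" for R0
  proof (rule pseudorandom_pullback[OF p(1) assms(2) q(1)])
    show "R0 \<subseteq> {0..<p}" using that sq_subset by auto
    have "of_int p \<ge> (120::real)" using p120 by simp
    then show "of_int p \<le> 3 * real (card R0)" using that cnt cnt0 by auto
    show "norm (ft p (ind R0) k) \<le> sqrt (of_int p)" if "\<not> p dvd k" for k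
      by (rule norm_ft_squares_le[OF assms(1) odd that \<open>R0 = sq p \<or> R0 = sq p - {0}\<close>])
  qed
  show ?thesis
  proof (cases "n = 1")
    case True
    have e1: "{x \<in> {0..<p}. x mod p \<in> sq p} = sq p"
      by (auto simp: sq_def)
    have e2: "p * q = p" "p ^ n = p" using True by (simp_all add: q_def)
    have "pseudorandom (p ^ n) (sq p) (local_factor p) (3 / sqrt (of_int p))"
      using prn[OF disjI1[OF refl]] unfolding e2 e1 .
    moreover have "1 * real (card (sq p)) \<le> local_factor p * real (card (sq p))"
      by (rule mult_right_mono) simp_all
    ultimately show ?thesis unfolding e2 by (intro exI[of _ "sq p"]) simp
  next
    case False
    then have n2: "n \<ge> 2" using assms(3) by simp
    define R where "R = {x \<in> {0..<p * q}. x mod p \<in> sq p - {0}}"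
    have "R \<subseteq> sq (p ^ n)"
    proof
      fix x assume x: "x \<in> R"
      then obtain y where "[x mod p = y\<^sup>2] (mod p)" "x mod p \<noteq> 0" by (auto simp: R_def sq_def)
      then have "[x = y\<^sup>2] (mod p)" "\<not> p dvd x" by (auto simp: Cong.cong_def dvd_eq_mod_eq_0)
      then obtain z where "[x = z\<^sup>2] (mod p ^ n)"
        using hensel_square[OF assms(1) odd] assms(3) by blast
      then show "x \<in> sq (p ^ n)" using x by (auto simp: R_def sq_def q)
    qed
    have cardR: "real (card R) = of_int q * real (card (sq p - {0}))"
      unfolding R_def using sq_subset by (intro card_pullback p q) auto
    \<comment> \<open>A square divisible by \<open>p\<close> is divisible by \<open>p^2\<close>,
      since its root is divisible by \<open>p\<close> and \<open>n \<ge> 2\<close>.\<close>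
    have "sq (p ^ n) \<subseteq> R \<union> {x \<in> {0..<p ^ n}. p\<^sup>2 dvd x}"
    proof
      fix x assume "x \<in> sq (p ^ n)"
      then obtain y where x: "x \<in> {0..<p ^ n}" and y: "p ^ n dvd x - y\<^sup>2"
        by (auto simp: sq_def cong_iff_dvd_diff)
      show "x \<in> R \<union> {x \<in> {0..<p ^ n}. p\<^sup>2 dvd x}"
      proof (cases "p dvd x")
        case True
        have "p dvd p ^ n" using n2 by (simp add: dvd_power)
        then have "p dvd x - y\<^sup>2" using y dvd_trans by blast
        then have "p dvd y\<^sup>2" using True by (metis dvd_diff_right_iff)
        then have "p dvd y" using assms(1) prime_dvd_power by blast
        then have "p\<^sup>2 dvd y\<^sup>2" by (simp add: dvd_power_same)
        moreover have "p\<^sup>2 dvd x - y\<^sup>2" using y n2 by (meson dvd_trans le_imp_power_dvd)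
        ultimately have "p\<^sup>2 dvd (x - y\<^sup>2) + y\<^sup>2" by (intro dvd_add)
        then show ?thesis using x by simp
      next
        case False
        have "p dvd p ^ n" using n2 by (simp add: dvd_power)
        then have "p dvd x - y\<^sup>2" using y dvd_trans by blast
        then have "x mod p = y\<^sup>2 mod p" by (simp add: mod_eq_dvd_iff)
        then have "[x mod p = y\<^sup>2] (mod p)" by (simp add: Cong.cong_def)
        then have "x mod p \<in> sq p - {0}" using False p by (auto simp: sq_def dvd_eq_mod_eq_0)
        then show ?thesis using x by (auto simp: R_def q)
      qed
    qed
    moreover have "finite (R \<union> {x \<in> {0..<p ^ n}. p\<^sup>2 dvd x})"
      by (rule finite_subset[of _ "{0..<p ^ n}"]) (auto simp: R_def q)
    ultimately have "card (sq (p ^ n)) \<le> card (R \<union> {x \<in> {0..<p ^ n}. p\<^sup>2 dvd x})"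
      by (intro card_mono)
    also have "\<dots> \<le> card R + card {x \<in> {0..<p ^ n}. p\<^sup>2 dvd x}" by (rule card_Un_le)
    finally have "real (card (sq (p ^ n))) \<le> real (card R) + real (card {x \<in> {0..<p ^ n}. p\<^sup>2 dvd x})" by linarith
    also have "real (card {x \<in> {0..<p ^ n}. p\<^sup>2 dvd x}) \<le> of_int (p ^ n) / of_int (p\<^sup>2)"
      using p n2 by (intro card_residue_class_le[where c = 0]) (auto simp: le_imp_power_dvd)
    \<comment> \<open>The decay \<open>p powr (-2)\<close> is weakened to
      \<open>p powr (-5/4)\<close> so that the same \<open>local_factor\<close> bounds the loss in
      cardinality.\<close>
    also have "of_int (p ^ n) / of_int (p\<^sup>2) \<le> 12 * 60 powr (7/2) * of_int p powr (-5/4) * real (card R)"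
    proof -
      have pr: "of_int p > (0::real)" "of_int p \<ge> (1::real)" using p120 by auto
      have "of_int p \<le> 3 * real (card (sq p - {0}))" using cnt p120 by simp
      then have *: "real_of_int (p ^ n) \<le> 3 * real (card R)" using q by (simp add: cardR mult_le_cancel_left_pos)
      have "(1::real) \<le> 60 powr (7/2)" by (rule ge_one_powr_ge_zero) auto
      then have c: "(3::real) \<le> 12 * 60 powr (7/2)" by linarith
      have "1 / real_of_int (p\<^sup>2) = of_int p powr (-2)" using pr by (simp add: powr_minus_divide)
      also have "\<dots> \<le> of_int p powr (-5/4)" using pr by (intro powr_mono) auto
      finally have i: "1 / real_of_int (p\<^sup>2) \<le> of_int p powr (-5/4)" .
      have "of_int (p ^ n) / real_of_int (p\<^sup>2) = real_of_int (p ^ n) * (1 / of_int (p\<^sup>2))" by simp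
      also have "\<dots> \<le> (3 * real (card R)) * (of_int p powr (-5/4))" using * i by (intro mult_mono) auto
      also have "\<dots> = 3 * (of_int p powr (-5/4) * real (card R))" by simp
      also have "\<dots> \<le> 12 * 60 powr (7/2) * (of_int p powr (-5/4) * real (card R))"
        using c by (intro mult_right_mono) auto
      finally show ?thesis by (simp only: mult.assoc)
    qed
    finally have "real (card (sq (p ^ n))) \<le> local_factor p * real (card R)"
      by (simp add: ring_distribs)
    moreover have "pseudorandom (p ^ n) R (local_factor p) (3 / sqrt (of_int p))"
      using prn[of "sq p - {0}"] unfolding q(2) R_def by blast
    ultimately show ?thesis using \<open>R \<subseteq> sq (p ^ n)\<close> by blast
  qed
qed

section \<open>The Chinese remainder theorem\<close>

lemma bij_betw_crt:
  fixes N1 N2 :: int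
  assumes "N1 > 0" "N2 > 0" "coprime N1 N2"
  shows "bij_betw (\<lambda>x. (x mod N1, x mod N2)) {0..<N1 * N2} ({0..<N1} \<times> {0..<N2})"
proof -
  have inj: "inj_on (\<lambda>x. (x mod N1, x mod N2)) {0..<N1 * N2}"
  proof (rule inj_onI)
    fix x y assume xy: "x \<in> {0..<N1 * N2}" "y \<in> {0..<N1 * N2}" "(x mod N1, x mod N2) = (y mod N1, y mod N2)"
    then have "N1 dvd x - y" "N2 dvd x - y" by (simp_all add: mod_eq_dvd_iff)
    then have "N1 * N2 dvd x - y" using assms(3) by (rule divides_mult)
    then have "x mod (N1 * N2) = y mod (N1 * N2)" by (simp add: mod_eq_dvd_iff)
    then show "x = y" using xy by simp
  qed
  moreover have "(\<lambda>x. (x mod N1, x mod N2)) ` {0..<N1 * N2} = {0..<N1} \<times> {0..<N2}"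
  proof (rule card_subset_eq)
    show "card ((\<lambda>x. (x mod N1, x mod N2)) ` {0..<N1 * N2}) = card ({0..<N1} \<times> {0..<N2})"
      using assms by (simp add: card_image[OF inj] card_cartesian_product nat_mult_distrib)
  qed (use assms in auto)
  ultimately show ?thesis by (simp add: bij_betw_def)
qed

text \<open>Frequencies are parametrised differently from residues: the character at
  \<open>N2 * a + N1 * b\<close> modulo \<open>N1 * N2\<close> is the product of the characters at
  \<open>a\<close> and at \<open>b\<close>, and the parametrisation is additive, so differences of
  frequencies split as well.\<close>

lemma bij_betw_crt_dual:
  fixes N1 N2 :: int
  assumes "N1 > 0" "N2 > 0" "coprime N1 N2"
  shows "bij_betw (\<lambda>(a, b). (N2 * a + N1 * b) mod (N1 * N2)) ({0..<N1} \<times> {0..<N2}) {0..<N1 * N2}"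
proof -
  let ?h = "\<lambda>(a, b). (N2 * a + N1 * b) mod (N1 * N2)"
  have inj: "inj_on ?h ({0..<N1} \<times> {0..<N2})"
  proof (rule inj_onI, clarify)
    fix a b a' b' assume ab: "a \<in> {0..<N1}" "b \<in> {0..<N2}" "a' \<in> {0..<N1}" "b' \<in> {0..<N2}"
      "(N2 * a + N1 * b) mod (N1 * N2) = (N2 * a' + N1 * b') mod (N1 * N2)"
    then have *: "N1 * N2 dvd N2 * (a - a') + N1 * (b - b')" by (simp add: mod_eq_dvd_iff algebra_simps)
    then have "N1 dvd N2 * (a - a') + N1 * (b - b')" "N2 dvd N2 * (a - a') + N1 * (b - b')"
      using dvd_mult_left dvd_mult_right by blast+
    then have "N1 dvd N2 * (a - a')" "N2 dvd N1 * (b - b')"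
      by (metis dvd_add_left_iff dvd_triv_left, metis dvd_add_right_iff dvd_triv_left)
    then have "N1 dvd a - a'" "N2 dvd b - b'"
      using assms(3) by (simp_all add: coprime_dvd_mult_right_iff coprime_commute)
    then show "a = a' \<and> b = b'" using ab by (auto simp flip: mod_eq_dvd_iff)
  qed
  moreover have "?h ` ({0..<N1} \<times> {0..<N2}) = {0..<N1 * N2}"
  proof (rule card_subset_eq)
    show "card (?h ` ({0..<N1} \<times> {0..<N2})) = card {0..<N1 * N2}"
      using assms by (simp add: card_image[OF inj] card_cartesian_product nat_mult_distrib)
  qed (use assms in auto)
  ultimately show ?thesis by (simp add: bij_betw_def)
qed

lemma ft_crt:
  fixes N1 N2 :: int
  assumes "N1 > 0" "N2 > 0" "coprime N1 N2"
  shows "ft (N1 * N2) (ind {x \<in> {0..<N1 * N2}. x mod N1 \<in> R1 \<and> x mod N2 \<in> R2}) (N2 * a + N1 * b)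
    = ft N1 (ind R1) a * ft N2 (ind R2) b"
proof -
  have ee: "ee (N1 * N2) ((N2 * a + N1 * b) * x) = ee N1 (a * x) * ee N2 (b * x)" for x
  proof -
    have "ee (N1 * N2) (N2 * (a * x)) = ee N1 (a * x)" "ee (N1 * N2) (N1 * (b * x)) = ee N2 (b * x)"
      using assms by (simp_all add: ee_def field_simps)
    then show ?thesis by (simp add: ring_distribs ee_add mult.assoc)
  qed
  let ?R = "{x \<in> {0..<N1 * N2}. x mod N1 \<in> R1 \<and> x mod N2 \<in> R2}"
  have "ft (N1 * N2) (ind ?R) (N2 * a + N1 * b)
      = (\<Sum>x\<in>{0..<N1 * N2}. (\<lambda>(u, v). of_real (ind R1 u) * ee N1 (a * u) * (of_real (ind R2 v) * ee N2 (b * v))) (x mod N1, x mod N2))"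
    unfolding ft_def
  proof (rule sum.cong[OF refl])
    fix x assume "x \<in> {0..<N1 * N2}"
    then have "ind ?R x = ind R1 (x mod N1) * ind R2 (x mod N2)" by (simp add: ind_def indicator_def)
    then show "of_real (ind ?R x) * ee (N1 * N2) ((N2 * a + N1 * b) * x)
        = (\<lambda>(u, v). of_real (ind R1 u) * ee N1 (a * u) * (of_real (ind R2 v) * ee N2 (b * v))) (x mod N1, x mod N2)"
      using assms by (simp add: ee ee_mult_mod)
  qed
  also have "\<dots> = (\<Sum>(u, v)\<in>{0..<N1} \<times> {0..<N2}. of_real (ind R1 u) * ee N1 (a * u) * (of_real (ind R2 v) * ee N2 (b * v)))"
    by (rule sum.reindex_bij_betw[OF bij_betw_crt[OF assms]])
  also have "\<dots> = ft N1 (ind R1) a * ft N2 (ind R2) b"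
    unfolding ft_def sum_product by (rule sum.cartesian_product[symmetric])
  finally show ?thesis .
qed

lemma norm_ft_ind_le: "R \<subseteq> {0..<N} \<Longrightarrow> norm (ft N (ind R) k) \<le> real (card R)"
  using norm_ft_le[of "ind R" N k] by (simp add: sum_ind)

text \<open>Frequency zero of the product formula for the transform.\<close>

lemma card_crt:
  fixes N1 N2 :: int
  assumes "N1 > 0" "N2 > 0" "coprime N1 N2" "R1 \<subseteq> {0..<N1}" "R2 \<subseteq> {0..<N2}"
  shows "card {x \<in> {0..<N1 * N2}. x mod N1 \<in> R1 \<and> x mod N2 \<in> R2} = card R1 * card R2"
proof -
  let ?R = "{x \<in> {0..<N1 * N2}. x mod N1 \<in> R1 \<and> x mod N2 \<in> R2}"
  have R: "(\<Sum>x\<in>{0..<N1 * N2}. ind ?R x) = real (card ?R)" by (rule sum_ind) auto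
  have "complex_of_real (real (card ?R)) = of_real (real (card R1) * real (card R2))"
    using ft_crt[OF assms(1-3), of R1 R2 0 0] assms(4,5)
    by (simp only: mult_zero_right add_0 ft_0 R sum_ind[OF finite_atLeastLessThan_int] of_real_mult)
  then have "real (card ?R) = real (card R1) * real (card R2)" using of_real_eq_iff by blast
  then show ?thesis by (simp flip: of_nat_mult)
qed

text \<open>The kernel is the tensor product of the two kernels. A nonzero frequency has a nonzero
  component; that one supplies \<open>\<delta>\<close>, and the other is bounded trivially.\<close>

lemma pseudorandom_crt:
  fixes N1 N2 :: int
  assumes N: "N1 > 0" "N2 > 0" "coprime N1 N2" and "A1 \<ge> 0"
    and 1: "pseudorandom N1 R1 A1 \<delta>" and 2: "pseudorandom N2 R2 A2 \<delta>"
  shows "pseudorandom (N1 * N2) {x \<in> {0..<N1 * N2}. x mod N1 \<in> R1 \<and> x mod N2 \<in> R2} (A1 * A2) \<delta>"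
proof -
  define R where "R = {x \<in> {0..<N1 * N2}. x mod N1 \<in> R1 \<and> x mod N2 \<in> R2}"
  note 1 = 1[unfolded pseudorandom_def] and 2 = 2[unfolded pseudorandom_def]
  have sub: "R1 \<subseteq> {0..<N1}" "R2 \<subseteq> {0..<N2}" using 1 2 by auto
  have card: "real (card R) = real (card R1) * real (card R2)"
    unfolding R_def using card_crt[OF N sub] by simp
  have ft: "ft (N1 * N2) (ind R) (N2 * a + N1 * b) = ft N1 (ind R1) a * ft N2 (ind R2) b" for a b
    unfolding R_def by (rule ft_crt[OF N])
  define h where "h = (\<lambda>(a, b). (N2 * a + N1 * b) mod (N1 * N2))"
  have h: "bij_betw h ({0..<N1} \<times> {0..<N2}) {0..<N1 * N2}"
    unfolding h_def by (rule bij_betw_crt_dual[OF N])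
  have "kbound {0..<N1 * N2} (\<lambda>k l. norm (ft (N1 * N2) (ind R) (k - l))) (A1 * real (card R1) * (A2 * real (card R2)))"
  proof (rule kbound_reindex[OF _ h])
    show "kbound ({0..<N1} \<times> {0..<N2}) (\<lambda>(a, b) (a', b'). norm (ft N1 (ind R1) (a - a')) * norm (ft N2 (ind R2) (b - b')))
        (A1 * real (card R1) * (A2 * real (card R2)))"
      using 1 2 assms(4) by (intro kbound_tensor) auto
    fix z z' assume "z \<in> {0..<N1} \<times> {0..<N2}" "z' \<in> {0..<N1} \<times> {0..<N2}"
    obtain a b a' b' where z: "z = (a, b)" "z' = (a', b')" by (cases z, cases z') auto
    have "ft (N1 * N2) (ind R) (h z - h z') = ft (N1 * N2) (ind R) ((h z - h z') mod (N1 * N2))"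
      using N by (intro ft_mod[symmetric]) auto
    also have "(h z - h z') mod (N1 * N2) = (N2 * (a - a') + N1 * (b - b')) mod (N1 * N2)"
      unfolding z h_def prod.case mod_diff_eq by (rule arg_cong[of _ _ "\<lambda>u. u mod _"]) (simp add: algebra_simps)
    also have "ft (N1 * N2) (ind R) \<dots> = ft N1 (ind R1) (a - a') * ft N2 (ind R2) (b - b')"
      using N by (subst ft_mod) (auto simp: ft)
    finally show "norm (ft (N1 * N2) (ind R) (h z - h z'))
        \<le> (\<lambda>(a, b) (a', b'). norm (ft N1 (ind R1) (a - a')) * norm (ft N2 (ind R2) (b - b'))) z z'"
      by (simp add: z norm_mult)
  qed
  moreover have "norm (ft (N1 * N2) (ind R) k) \<le> \<delta> * real (card R)" if k: "k \<in> {1..<N1 * N2}" for k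
  proof -
    have "k \<in> h ` ({0..<N1} \<times> {0..<N2})" using h k by (simp add: bij_betw_def)
    then obtain a b where ab: "k = (N2 * a + N1 * b) mod (N1 * N2)" "a \<in> {0..<N1}" "b \<in> {0..<N2}"
      by (auto simp: h_def)
    have "ft (N1 * N2) (ind R) k = ft N1 (ind R1) a * ft N2 (ind R2) b"
      unfolding ab(1) using N by (subst ft_mod) (auto simp: ft)
    then have eq: "norm (ft (N1 * N2) (ind R) k) = norm (ft N1 (ind R1) a) * norm (ft N2 (ind R2) b)"
      by (simp add: norm_mult)
    show ?thesis
    proof (cases "a = 0")
      case False
      then have "norm (ft N1 (ind R1) a) \<le> \<delta> * real (card R1)" using 1 ab by auto
      then have "norm (ft N1 (ind R1) a) * norm (ft N2 (ind R2) b) \<le> \<delta> * real (card R1) * real (card R2)"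
        using norm_ft_ind_le[OF sub(2), of b] by (intro mult_mono) (auto intro: order_trans[OF norm_ge_zero])
      then show ?thesis by (simp add: eq card)
    next
      case True
      then have "b \<noteq> 0" using ab k by auto
      then have "norm (ft N2 (ind R2) b) \<le> \<delta> * real (card R2)" using 2 ab by auto
      then have "norm (ft N1 (ind R1) a) * norm (ft N2 (ind R2) b) \<le> real (card R1) * (\<delta> * real (card R2))"
        using norm_ft_ind_le[OF sub(1), of a] by (intro mult_mono) auto
      then show ?thesis by (simp add: eq card algebra_simps)
    qed
  qed
  moreover have "R \<noteq> {}"
  proof -
    have "finite R1" "finite R2" using sub finite_subset by blast+
    then have "card R1 * card R2 > 0" using 1 2 by (simp add: card_gt_0_iff)
    then have "real (card R) > 0" unfolding card by (simp flip: of_nat_mult)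
    then show ?thesis by auto
  qed
  ultimately show ?thesis
    unfolding pseudorandom_def R_def[symmetric] by (auto simp: card algebra_simps) (auto simp: R_def)
qed

lemma sq_crt:
  fixes N1 N2 :: int
  assumes "N1 > 0" "N2 > 0" "coprime N1 N2"
  shows "sq (N1 * N2) = {x \<in> {0..<N1 * N2}. x mod N1 \<in> sq N1 \<and> x mod N2 \<in> sq N2}"
proof (intro equalityI subsetI)
  fix x assume "x \<in> sq (N1 * N2)"
  then obtain y where x: "x \<in> {0..<N1 * N2}" "[x = y\<^sup>2] (mod N1 * N2)" by (auto simp: sq_def)
  then have "[x = y\<^sup>2] (mod N1)" "[x = y\<^sup>2] (mod N2)"
    by (auto simp: cong_iff_dvd_diff intro: dvd_mult_left dvd_mult_right)
  then have "[x mod N1 = y\<^sup>2] (mod N1)" "[x mod N2 = y\<^sup>2] (mod N2)" by auto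
  then show "x \<in> {x \<in> {0..<N1 * N2}. x mod N1 \<in> sq N1 \<and> x mod N2 \<in> sq N2}"
    using x assms by (auto simp: sq_def)
next
  fix x assume x: "x \<in> {x \<in> {0..<N1 * N2}. x mod N1 \<in> sq N1 \<and> x mod N2 \<in> sq N2}"
  then obtain u v where uv: "[x = u\<^sup>2] (mod N1)" "[x = v\<^sup>2] (mod N2)" by (auto simp: sq_def)
  obtain y where y: "[y = u] (mod N1)" "[y = v] (mod N2)"
    using binary_chinese_remainder_int[OF assms(3)] by blast
  have "[x = y\<^sup>2] (mod N1)" "[x = y\<^sup>2] (mod N2)"
    using uv y by (meson cong_pow cong_sym cong_trans)+
  then have "[x = y\<^sup>2] (mod N1 * N2)" using assms(3) by (simp add: cong_iff_dvd_diff divides_mult)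
  then show "x \<in> sq (N1 * N2)" using x by (auto simp: sq_def)
qed

section \<open>Representations by squares\<close>

lemma local_factor_ge_1: "local_factor p \<ge> 1"
  by simp

lemma pseudorandom_mono:
  assumes "pseudorandom N R A \<delta>" "A \<le> A'" "\<delta> \<le> \<delta>'"
  shows "pseudorandom N R A' \<delta>'"
proof -
  have "norm (ft N (ind R) k) \<le> \<delta>' * real (card R)" if "k \<in> {1..<N}" for k
  proof -
    have "norm (ft N (ind R) k) \<le> \<delta> * real (card R)"
      using assms(1) that by (simp add: pseudorandom_def)
    also have "\<dots> \<le> \<delta>' * real (card R)" using assms(3) by (rule mult_right_mono) simp
    finally show ?thesis .
  qed
  moreover have "kbound {0..<N} (\<lambda>k l. norm (ft N (ind R) (k - l))) (A' * real (card R))"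
  proof (rule kbound_mono)
    show "kbound {0..<N} (\<lambda>k l. norm (ft N (ind R) (k - l))) (A * real (card R))"
      using assms(1) by (simp add: pseudorandom_def)
    show "A * real (card R) \<le> A' * real (card R)" using assms(2) by (rule mult_right_mono) simp
  qed
  ultimately show ?thesis using assms(1) by (simp add: pseudorandom_def)
qed

text \<open>Induction splits off the full power of one prime. The restriction constant and the ratio
  of squares to \<open>R\<close> each gain a factor depending on that prime but not on its exponent,
  while the decay stays at the worst local value, at most \<open>3 / sqrt M\<close>.\<close>

lemma pseudorandom_squares:
  fixes W :: nat and M :: real
  assumes "W > 0" "120 powr 18 \<le> M" "\<And>p. p \<in> prime_factors W \<Longrightarrow> M \<le> real p"
  shows "\<exists>R. R \<subseteq> sq (int W) \<and>
    real (card (sq (int W))) \<le> (\<Prod>p\<in>prime_factors W. local_factor p) * real (card R) \<and>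
    pseudorandom (int W) R (\<Prod>p\<in>prime_factors W. local_factor p) (3 / sqrt M)"
  using assms(1,3)
proof (induction W rule: less_induct)
  case (less W)
  show ?case
  proof (cases "W = 1")
    case True
    have 01: "{0..<1::int} = {0}" by auto
    have sq1: "sq 1 = {0}" by (auto simp: sq_def)
    have "kbound {0} (\<lambda>k l. norm (ft 1 (ind {0}) (k - l))) 1"
      by (rule kbound_reindex[OF kbound_identity bij_betw_id]) (auto simp: ft_def ind_def)
    then have "pseudorandom 1 {0} 1 (3 / sqrt M)"
      by (simp add: pseudorandom_def 01)
    then show ?thesis using True sq1 by (intro exI[of _ "{0}"]) simp
  next
    case False
    then obtain p where p: "prime p" "p dvd W" using prime_factor_nat by blast
    define n where "n = multiplicity p W"
    obtain V where V: "W = p ^ n * V" "\<not> p dvd V"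
      unfolding n_def using less.prems(1) p(1) by (metis multiplicity_decompose' not_prime_unit neq0_conv)
    have n: "n \<ge> 1" using V p by (cases n) auto
    have pos: "p > 0" "V > 0" using p(1) prime_gt_0_nat V less.prems by (auto intro!: Nat.gr0I)
    have cop: "coprime p V" using p(1) V(2) by (simp add: prime_imp_coprime)
    then have copn: "coprime (p ^ n) V" by simp
    have pf: "prime_factors W = insert p (prime_factors V)"
      using V pos p(1) n by (simp add: prime_factors_product prime_factors_power prime_prime_factors)
    have pnotin: "p \<notin> prime_factors V" using V(2) by auto
    have "p ^ n > 1" using prime_gt_1_nat[OF p(1)] n by (intro one_less_power) auto
    then have "V < W" using V pos by simp
    moreover have "M \<le> real q" if "q \<in> prime_factors V" for q using less.prems(2) that pf by auto
    ultimately obtain R2 where R2: "R2 \<subseteq> sq (int V)"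
      "real (card (sq (int V))) \<le> (\<Prod>p\<in>prime_factors V. local_factor p) * real (card R2)"
      "pseudorandom (int V) R2 (\<Prod>p\<in>prime_factors V. local_factor p) (3 / sqrt M)"
      using less.IH[of V] pos by blast
    have Mp: "M \<le> real p" using less.prems(2) pf by auto
    obtain R1 where R1: "R1 \<subseteq> sq (int p ^ n)"
      "real (card (sq (int p ^ n))) \<le> local_factor p * real (card R1)"
      "pseudorandom (int p ^ n) R1 (local_factor p) (3 / sqrt (of_int (int p)))"
      using pseudorandom_squares_prime_power[of "int p" n] p(1) n assms(2) Mp by auto
    have "(1::real) \<le> 120 powr 18" by (rule ge_one_powr_ge_zero) auto
    then have "M > 0" using assms(2) by linarith
    then have "3 / sqrt (real p) \<le> 3 / sqrt M" using Mp by (intro divide_left_mono) auto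
    then have R1': "pseudorandom (int p ^ n) R1 (local_factor p) (3 / sqrt M)"
      by (intro pseudorandom_mono[OF R1(3)]) simp_all
    have N: "int p ^ n > 0" "int V > 0" "coprime (int p ^ n) (int V)"
      using pos copn by (simp_all add: coprime_int_iff flip: of_nat_power)
    have W: "int W = int p ^ n * int V" by (simp add: V(1))
    define R where "R = {x \<in> {0..<int p ^ n * int V}. x mod int p ^ n \<in> R1 \<and> x mod int V \<in> R2}"
    have prod: "(\<Prod>p\<in>prime_factors W. local_factor p) = local_factor p * (\<Prod>p\<in>prime_factors V. local_factor p)"
      unfolding pf using pnotin by simp
    have prod0: "(\<Prod>p\<in>prime_factors V. local_factor p) \<ge> 0"
      by (intro prod_nonneg) (auto intro: add_nonneg_nonneg)
    have "pseudorandom (int W) R (\<Prod>p\<in>prime_factors W. local_factor p) (3 / sqrt M)"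
      unfolding W prod R_def using local_factor_ge_1[of p] by (intro pseudorandom_crt N R1' R2(3)) linarith
    moreover have "R \<subseteq> sq (int W)" unfolding W sq_crt[OF N] R_def using R1(1) R2(1) by blast
    moreover have "real (card (sq (int W))) \<le> (\<Prod>p\<in>prime_factors W. local_factor p) * real (card R)"
    proof -
      have "card R = card R1 * card R2"
        unfolding R_def using R1(1) R2(1) sq_subset by (intro card_crt[OF N]) blast+
      moreover have "card (sq (int W)) = card (sq (int p ^ n)) * card (sq (int V))"
        unfolding W sq_crt[OF N] by (intro card_crt[OF N] sq_subset)
      moreover have "real (card (sq (int p ^ n))) * real (card (sq (int V)))
          \<le> (local_factor p * real (card R1)) * ((\<Prod>p\<in>prime_factors V. local_factor p) * real (card R2))"
        using local_factor_ge_1[of p] by (intro mult_mono R1 R2) auto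
      ultimately show ?thesis unfolding prod by (simp add: algebra_simps)
    qed
    ultimately show ?thesis by blast
  qed
qed

text \<open>By 1 + x \<le> exp x the product is controlled by a tail of the series of p powr (-5/4)
  over all natural numbers, so nothing about the distribution of primes is needed.\<close>

lemma local_factor_prod_le:
  fixes \<epsilon> :: real
  assumes "\<epsilon> > 0"
  obtains M0 where "\<And>F. finite F \<Longrightarrow> (\<And>p. p \<in> F \<Longrightarrow> M0 \<le> p) \<Longrightarrow> (\<Prod>p\<in>F. local_factor (real p)) \<le> 1 + \<epsilon>"
proof -
  define f where "f p = 12 * 60 powr (7/2) * real p powr (-5/4)" for p :: nat
  have f0: "f p \<ge> 0" for p by (simp add: f_def)
  have "summable f"
    unfolding f_def by (intro summable_mult) (simp add: summable_real_powr_iff)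
  moreover have "ln (1 + \<epsilon>) > 0" using assms by simp
  ultimately obtain M0 where M0: "norm (\<Sum>i. f (i + M0)) < ln (1 + \<epsilon>)"
    using suminf_exist_split by blast
  show ?thesis
  proof
    fix F assume F: "finite F" "\<And>p. p \<in> F \<Longrightarrow> M0 \<le> p"
    have "(\<Prod>p\<in>F. local_factor (real p)) \<le> (\<Prod>p\<in>F. exp (f p))"
      by (intro prod_mono conjI add_nonneg_nonneg) (simp_all add: f_def)
    also have "\<dots> = exp (\<Sum>p\<in>F. f p)" by (simp add: exp_sum F(1))
    also have "(\<Sum>p\<in>F. f p) = (\<Sum>i\<in>(\<lambda>p. p - M0) ` F. f (i + M0))"
    proof -
      have "inj_on (\<lambda>p. p - M0) F" by (rule inj_onI) (metis F(2) le_add_diff_inverse2)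
      then show ?thesis using F(2) by (simp add: sum.reindex)
    qed
    also have "\<dots> \<le> (\<Sum>i. f (i + M0))"
      using F(1) \<open>summable f\<close> f0 by (intro sum_le_suminf) (auto simp: summable_iff_shift)
    also have "\<dots> \<le> ln (1 + \<epsilon>)" using M0 by simp
    finally show "(\<Prod>p\<in>F. local_factor (real p)) \<le> 1 + \<epsilon>" using assms by simp
  qed
qed

text \<open>Induction on the last coordinate: \<open>x s\<close> is the summation variable of the
  outer convolution, and the other coordinates represent \<open>y - x s\<close>. Resetting
  \<open>x s\<close> to \<open>undefined\<close> returns to the extensional functions on
  \<open>{..<s}\<close>, so tuples are counted once each.\<close>

lemma card_representations_mod:
  assumes "W > 0" "A \<subseteq> {..<W}" "y < W"
  shows "real (card (representations_mod W A s y)) = cpow (int W) (ind (int ` A)) s (int y)"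
  using assms(3)
proof (induction s arbitrary: y)
  case 0
  have "[y = 0] (mod W) \<longleftrightarrow> y = 0" using 0 by (auto simp: Cong.cong_def)
  \<comment> \<open>Without coordinates the only extensional function is constantly
    \<open>undefined\<close>, and the empty sum represents only 0.\<close>
  then have "representations_mod W A 0 y = (if y = 0 then {\<lambda>_. undefined} else {})"
    by (auto simp: representations_mod_def)
  then show ?case by auto
next
  case (Suc s)
  define z where "z a = nat ((int y - int a) mod int W)" for a
  have z: "z a < W" "int (z a) = (int y - int a) mod int W" for a
    using assms(1) by (simp_all add: z_def nat_less_iff)
  have cong: "[y = m + a] (mod W) \<longleftrightarrow> [z a = m] (mod W)" for m a
  proof -
    have "[y = m + a] (mod W) \<longleftrightarrow> [int y = int m + int a] (mod int W)" by (simp flip: cong_int_iff)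
    also have "\<dots> \<longleftrightarrow> [int (z a) = int m] (mod int W)"
      unfolding z(2) Cong.cong_def mod_mod_trivial mod_eq_dvd_iff by (simp add: algebra_simps)
    finally show ?thesis by (simp add: cong_int_iff)
  qed
  have fin: "finite A" using assms(2) finite_subset by blast
  have "bij_betw (\<lambda>(a, x). x(s := a)) (SIGMA a:A. representations_mod W A s (z a)) (representations_mod W A (Suc s) y)"
  proof (rule bij_betw_byWitness[where f' = "\<lambda>x. (x s, x(s := undefined))"])
    show "\<forall>x\<in>representations_mod W A (Suc s) y. (\<lambda>(a, x). x(s := a)) (x s, x(s := undefined)) = x"
      by simp
    show "\<forall>u\<in>SIGMA a:A. representations_mod W A s (z a).
        (\<lambda>x. (x s, x(s := undefined))) ((\<lambda>(a, x). x(s := a)) u) = u"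
    proof
      fix u assume "u \<in> (SIGMA a:A. representations_mod W A s (z a))"
      then obtain a x where u: "u = (a, x)" and x: "x \<in> representations_mod W A s (z a)" by blast
      have "x \<in> {..<s} \<rightarrow>\<^sub>E A" using x by (simp add: representations_mod_def)
      then have "x s = undefined" by (rule PiE_arb) simp
      then show "(\<lambda>x. (x s, x(s := undefined))) ((\<lambda>(a, x). x(s := a)) u) = u"
        by (simp add: u fun_upd_idem)
    qed
    show "(\<lambda>(a, x). x(s := a)) ` (SIGMA a:A. representations_mod W A s (z a)) \<subseteq> representations_mod W A (Suc s) y"
    proof safe
      fix a x assume a: "a \<in> A" and x: "x \<in> representations_mod W A s (z a)"
      have "(\<Sum>i<s. (x(s := a)) i) = (\<Sum>i<s. x i)" by (intro sum.cong) auto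
      then have "[y = (\<Sum>i<Suc s. (x(s := a)) i)] (mod W)"
        using x by (simp add: representations_mod_def cong)
      moreover have "x(s := a) \<in> {..<Suc s} \<rightarrow>\<^sub>E A"
        unfolding lessThan_Suc using x a by (intro PiE_fun_upd) (simp_all add: representations_mod_def)
      ultimately show "x(s := a) \<in> representations_mod W A (Suc s) y"
        by (simp add: representations_mod_def)
    qed
    show "(\<lambda>x. (x s, x(s := undefined))) ` representations_mod W A (Suc s) y \<subseteq> (SIGMA a:A. representations_mod W A s (z a))"
    proof safe
      fix x assume x: "x \<in> representations_mod W A (Suc s) y"
      then have xE: "x \<in> {..<Suc s} \<rightarrow>\<^sub>E A" by (simp add: representations_mod_def)
      then show "x s \<in> A" by (rule PiE_mem) simp
      have "(\<Sum>i<s. (x(s := undefined)) i) = (\<Sum>i<s. x i)" by (intro sum.cong) auto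
      then have "[z (x s) = (\<Sum>i<s. (x(s := undefined)) i)] (mod W)"
        using x by (simp add: representations_mod_def cong)
      moreover have "x(s := undefined) \<in> {..<s} \<rightarrow>\<^sub>E A"
        using xE unfolding lessThan_Suc by (rule fun_upd_in_PiE[rotated]) simp
      ultimately show "x(s := undefined) \<in> representations_mod W A s (z (x s))"
        by (simp add: representations_mod_def)
    qed
  qed
  then have "card (representations_mod W A (Suc s) y) = card (SIGMA a:A. representations_mod W A s (z a))"
    by (simp add: bij_betw_same_card)
  also have "\<dots> = (\<Sum>a\<in>A. card (representations_mod W A s (z a)))"
  proof (intro card_SigmaI fin ballI)
    fix a
    have "finite ({..<s} \<rightarrow>\<^sub>E A)" using fin by (intro finite_PiE) auto
    then show "finite (representations_mod W A s (z a))"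
      by (rule finite_subset[rotated]) (auto simp: representations_mod_def)
  qed
  finally have "real (card (representations_mod W A (Suc s) y)) = (\<Sum>a\<in>A. cpow (int W) (ind (int ` A)) s ((int y - int a) mod int W))"
    using Suc.IH z by simp
  also have "\<dots> = (\<Sum>a\<in>int ` A. cpow (int W) (ind (int ` A)) s ((int y - a) mod int W))"
    by (simp add: sum.reindex)
  also have "\<dots> = cpow (int W) (ind (int ` A)) (Suc s) (int y)"
    unfolding cpow.simps conv_def using assms(2) fin
    by (intro sum.mono_neutral_cong_left) (auto simp: ind_def)
  finally show ?case .
qed

lemma image_squares_mod: "int ` squares_mod W = sq (int W)"
proof (intro equalityI subsetI)
  fix x assume "x \<in> int ` squares_mod W"
  then obtain a y where "x = int a" "a < W" "[a = y ^ 2] (mod W)" by (auto simp: squares_mod_def)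
  then have "[x = (int y)\<^sup>2] (mod int W)" using cong_int_iff[of a "y ^ 2" W] by simp
  then show "x \<in> sq (int W)" using \<open>x = int a\<close> \<open>a < W\<close> by (auto simp: sq_def)
next
  fix x assume "x \<in> sq (int W)"
  then obtain y where x: "x \<in> {0..<int W}" "[x = y\<^sup>2] (mod int W)" by (auto simp: sq_def)
  then have W: "int W > 0" by auto
  define b where "b = nat (y mod int W)"
  have b: "int b = y mod int W" "b < W" using W by (simp_all add: b_def nat_less_iff)
  have "[x = (y mod int W)\<^sup>2] (mod int W)" using x(2) by (simp add: Cong.cong_def power_mod)
  then have "[int (nat x) = int (b ^ 2)] (mod int W)" using x b by simp
  then have "[nat x = b ^ 2] (mod W)" by (simp only: cong_int_iff)
  then have "nat x \<in> squares_mod W" using x b by (auto simp: squares_mod_def nat_less_iff)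
  then show "x \<in> int ` squares_mod W" using x by (intro image_eqI[of _ _ "nat x"]) auto
qed

theorem theorem1p1:
  fixes s :: nat and \<theta> :: real
  assumes "s \<ge> 5" and "1 / real s < \<theta>" and "\<theta> \<le> 1"
  shows "\<exists>(M::real) (c::real). M > 0 \<and> c > 0 \<and>
    (\<forall>(W::nat) (A::nat set).
      W > 0 \<longrightarrow> (\<forall>p\<in>prime_factors W. real p \<ge> M) \<longrightarrow>
      A \<subseteq> squares_mod W \<longrightarrow>
      real (card A) \<ge> \<theta> * real (card (squares_mod W)) \<longrightarrow>
      (\<forall>y\<in>{..<W}.
        (\<exists>x \<in> {..<s} \<rightarrow> A. [y = (\<Sum>i<s. x i)] (mod W)) \<and>
        real (card (representations_mod W A s y))
          \<ge> c * (1 / real W) * real (card (squares_mod W)) ^ s))"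
proof -
  define \<alpha> where "\<alpha> = (\<theta> + 1 / real s) / 2"
  define \<epsilon> where "\<epsilon> = \<theta> - \<alpha>"
  have \<alpha>: "1 / real s < \<alpha>" "\<alpha> \<le> 1" "\<epsilon> > 0"
  proof -
    have "x < (t + x) / 2 \<and> (t + x) / 2 \<le> 1 \<and> t - (t + x) / 2 > 0" if "x < t" "t \<le> 1" for x t :: real
      using that by auto
    from this[OF assms(2,3)] show "1 / real s < \<alpha>" "\<alpha> \<le> 1" "\<epsilon> > 0" by (simp_all only: \<alpha>_def \<epsilon>_def)
  qed
  have "1 / real s > 0" using assms(1) by simp
  then have \<theta>: "\<theta> > 0" and \<epsilon>1: "\<epsilon> \<le> 1"
    using \<alpha>(1) assms(2,3) unfolding \<epsilon>_def by linarith+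
  \<comment> \<open>The moment constant \<open>2 powr (9/4)\<close> is what restriction yields once
    the product of local constants is known to be at most 2.\<close>
  obtain c \<delta> P where c: "c > 0" and \<delta>: "\<delta> > 0" and P: "P > (0::real)"
    and transfer: "\<And>(N::int) R f y. N > 0 \<Longrightarrow> R \<subseteq> {0..<N} \<Longrightarrow> R \<noteq> {} \<Longrightarrow> P \<le> of_int N \<Longrightarrow>
      (\<And>p. prime p \<Longrightarrow> p dvd N \<Longrightarrow> P \<le> of_int p) \<Longrightarrow>
      (\<And>k. k \<in> {1..<N} \<Longrightarrow> norm (ft N (ind R) k) \<le> \<delta> * real (card R)) \<Longrightarrow>
      (\<And>x. 0 \<le> f x) \<Longrightarrow> (\<And>x. f x \<le> ind R x) \<Longrightarrow>
      (\<Sum>k\<in>{0..<N}. norm (ft N f k) powr (9/2)) \<le> 2 powr (9/4) * real (card R) powr (9/2) \<Longrightarrow>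
      \<alpha> * real (card R) \<le> (\<Sum>x\<in>{0..<N}. f x) \<Longrightarrow> y \<in> {0..<N} \<Longrightarrow>
      c * real (card R) ^ s \<le> of_int N * cpow N f s y"
    using transference[OF assms(1) \<alpha>(1,2), of "2 powr (9/4)"] by auto
  obtain M0 where M0: "\<And>F. finite F \<Longrightarrow> (\<And>p. p \<in> F \<Longrightarrow> M0 \<le> p) \<Longrightarrow> (\<Prod>p\<in>F. local_factor (real p)) \<le> 1 + \<epsilon>"
    using local_factor_prod_le[OF \<alpha>(3)] by blast
  \<comment> \<open>The four entries serve, in order, the local kernel bound, Pollard's theorem, the
    decay \<open>3 / sqrt M \<le> \<delta>\<close>, and the tail of the product of local
    constants.\<close>
  define M where "M = Max {120 powr 18, P, (3 / \<delta>)\<^sup>2, real M0}"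
  have M: "120 powr 18 \<le> M" "P \<le> M" "(3 / \<delta>)\<^sup>2 \<le> M" "real M0 \<le> M"
    unfolding M_def by (rule Max_ge; simp)+
  have Mpos: "M > 0" using M(2) P by linarith
  \<comment> \<open>The cap at 1 is for the trivial modulus; \<open>2 ^ s\<close> pays for returning
    from \<open>R\<close> to all squares, of which there are at most
    \<open>2 * card R\<close>.\<close>
  define c' where "c' = min 1 (c / 2 ^ s)"
  have c': "c' > 0" using c by (simp add: c'_def)
  have count: "c' * (1 / real W) * real (card (squares_mod W)) ^ s \<le> real (card (representations_mod W A s y))"
    and sq_pos: "card (squares_mod W) > 0"
    if W: "W > 0" "\<forall>p\<in>prime_factors W. real p \<ge> M" and A: "A \<subseteq> squares_mod W"
      "real (card A) \<ge> \<theta> * real (card (squares_mod W))" and y: "y < W" for W A y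
  proof -
    define S where "S = sq (int W)"
    define A' where "A' = int ` A"
    have S: "real (card S) = real (card (squares_mod W))"
      unfolding S_def image_squares_mod[symmetric] by (simp add: card_image)
    have A': "A' \<subseteq> S" "real (card A') = real (card A)"
      using A(1) unfolding S_def A'_def image_squares_mod[symmetric] by (auto simp: card_image)
    have AW: "A \<subseteq> {..<W}" using A(1) by (auto simp: squares_mod_def)
    define E where "E = (\<Prod>p\<in>prime_factors W. local_factor p)"
    have E: "E \<le> 1 + \<epsilon>" unfolding E_def
    proof (rule M0)
      show "M0 \<le> p" if "p \<in> prime_factors W" for p
      proof -
        have "real M0 \<le> real p" using W(2) that M(4) by (meson order_trans)
        then show ?thesis by simp
      qed
    qed simp
    then have E2: "E \<le> 2" using \<epsilon>1 by simp
    obtain R where R: "R \<subseteq> S" "real (card S) \<le> E * real (card R)" "pseudorandom (int W) R E (3 / sqrt M)"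
      using pseudorandom_squares[OF W(1) M(1)] W(2) unfolding S_def E_def by blast
    have subR: "R \<subseteq> {0..<int W}" and "R \<noteq> {}" using R(3) by (auto simp: pseudorandom_def)
    have finR: "finite R" using subR finite_subset by blast
    have cardR: "real (card R) > 0" using \<open>R \<noteq> {}\<close> finR by (simp add: card_gt_0_iff)
    have finS: "finite S" by (simp add: S_def)
    have RS: "card R \<le> card S" using R(1) finS by (intro card_mono)
    show "card (squares_mod W) > 0" using S RS cardR by linarith
    show "c' * (1 / real W) * real (card (squares_mod W)) ^ s \<le> real (card (representations_mod W A s y))"
    proof (cases "W = 1")
      \<comment> \<open>The trivial modulus has no prime factor, so nothing forces
        \<open>P \<le> W\<close>, and the count is made directly.\<close>
      case True
      have "squares_mod 1 = {0}" by (auto simp: squares_mod_def)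
      moreover have "card A > 0"
      proof -
        have "0 < \<theta> * real (card (squares_mod W))"
          using \<theta> \<open>card (squares_mod W) > 0\<close> by simp
        with A(2) have "0 < real (card A)" by linarith
        then show ?thesis by simp
      qed
      then have "A \<noteq> {}" by auto
      ultimately have A0: "A = {0}" "card (squares_mod W) = 1" using A(1) True by auto
      have "representations_mod W A s y = {..<s} \<rightarrow>\<^sub>E {0}"
        unfolding representations_mod_def A0 by (auto simp: True)
      then have "card (representations_mod W A s y) = 1" by (simp add: card_PiE)
      then show ?thesis using True A0 by (simp add: c'_def)
    next
      case False
      then obtain q where q: "prime q" "q dvd W" using prime_factor_nat by blast
      have primes: "P \<le> of_int p" if "prime p" "p dvd int W" for p :: int
      proof -
        have "p > 0" using that prime_gt_0_int by blast
        then obtain n where n: "p = int n" using zero_less_imp_eq_int by blast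
        then have "n \<in> prime_factors W" using that W(1) by (simp add: in_prime_factors_iff)
        then show ?thesis using W(2) M(2) n by force
      qed
      have "q \<le> W" using q W(1) by (simp add: dvd_imp_le)
      moreover have "P \<le> real q" using primes[of "int q"] q by simp
      ultimately have PW: "P \<le> real W" by linarith
      define f where "f = ind (A' \<inter> R)"
      have f: "0 \<le> f x" "f x \<le> ind R x" for x by (auto simp: f_def ind_def indicator_def)
      have sumf: "(\<Sum>x\<in>{0..<int W}. f x) = real (card (A' \<inter> R))"
        unfolding f_def using subR by (intro sum_ind) auto
      \<comment> \<open>Inclusion-exclusion inside \<open>S\<close>: as
        \<open>card S \<le> (1 + \<epsilon>) * card R\<close>, at most
        \<open>\<epsilon> * card R\<close> of the density is lost, which leaves
        \<open>\<theta> - \<epsilon> = \<alpha>\<close>.\<close>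
      have "card A' + card R \<le> card (A' \<inter> R) + card S"
      proof -
        have "finite A'" using A'(1) finS finite_subset by blast
        then have "card A' + card R = card (A' \<union> R) + card (A' \<inter> R)" using finR by (rule card_Un_Int)
        moreover have "card (A' \<union> R) \<le> card S" using A'(1) R(1) finS by (intro card_mono) auto
        ultimately show ?thesis by simp
      qed
      moreover have "\<theta> * real (card R) \<le> \<theta> * real (card S)"
        using RS \<theta> by (intro mult_left_mono) auto
      moreover have "real (card S) \<le> (1 + \<epsilon>) * real (card R)"
        using R(2) mult_right_mono[OF E, of "real (card R)"] by linarith
      ultimately have dens: "\<alpha> * real (card R) \<le> (\<Sum>x\<in>{0..<int W}. f x)"
        using A(2) A'(2) S unfolding sumf by (simp add: \<epsilon>_def algebra_simps)
      have kb: "kbound {0..<int W} (\<lambda>k l. norm (ft (int W) (ind R) (k - l))) (2 * real (card R))"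
        using pseudorandom_mono[OF R(3) E2 order_refl] by (simp add: pseudorandom_def)
      have M\<delta>: "3 / sqrt M \<le> \<delta>"
      proof -
        have "3 / \<delta> = sqrt ((3 / \<delta>)\<^sup>2)" using \<delta> by simp
        also have "\<dots> \<le> sqrt M" by (rule real_sqrt_le_mono[OF M(3)])
        finally show ?thesis using \<delta> Mpos by (simp add: field_simps)
      qed
      have "c * real (card R) ^ s \<le> of_int (int W) * cpow (int W) f s (int y)"
      proof (rule transfer[OF _ subR \<open>R \<noteq> {}\<close> _ primes _ f _ dens])
        show "(\<Sum>k\<in>{0..<int W}. norm (ft (int W) f k) powr (9/2)) \<le> 2 powr (9/4) * real (card R) powr (9/2)"
          using W(1) by (intro restriction_estimate subR kb f) auto
        show "norm (ft (int W) (ind R) k) \<le> \<delta> * real (card R)" if "k \<in> {1..<int W}" for k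
          using pseudorandom_mono[OF R(3) order_refl M\<delta>] that by (simp add: pseudorandom_def)
      qed (use W(1) PW y in auto)
      also have "cpow (int W) f s (int y) \<le> cpow (int W) (ind A') s (int y)"
        using f by (intro cpow_mono) (auto simp: f_def ind_def indicator_def)
      also have "cpow (int W) (ind A') s (int y) = real (card (representations_mod W A s y))"
        unfolding A'_def using card_representations_mod[OF W(1) AW y] by simp
      finally have "c * real (card R) ^ s \<le> real W * real (card (representations_mod W A s y))"
        using W(1) by (simp add: mult_left_mono)
      moreover have "c' * real (card S) ^ s \<le> c * real (card R) ^ s"
      proof -
        have "real (card S) \<le> 2 * real (card R)" using R(2) E2 mult_right_mono[OF E2, of "real (card R)"] by linarith
        then have "real (card S) ^ s \<le> (2 * real (card R)) ^ s" by (intro power_mono) auto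
        then have "c' * real (card S) ^ s \<le> c / 2 ^ s * (2 * real (card R)) ^ s"
          using c' by (intro mult_mono) (auto simp: c'_def)
        then show ?thesis by (simp add: power_mult_distrib)
      qed
      ultimately have "c' * real (card S) ^ s \<le> real W * real (card (representations_mod W A s y))" by linarith
      then show ?thesis using W(1) by (simp add: S field_simps)
    qed
  qed
  show ?thesis
  proof (rule exI[of _ M], rule exI[of _ c'], intro conjI Mpos c' allI impI ballI)
    fix W y :: nat and A :: "nat set"
    assume W: "W > 0" "\<forall>p\<in>prime_factors W. real p \<ge> M" and A: "A \<subseteq> squares_mod W"
      "real (card A) \<ge> \<theta> * real (card (squares_mod W))" and "y \<in> {..<W}"
    then have y: "y < W" by simp
    note cnt = count[OF W A y]
    show "c' * (1 / real W) * real (card (squares_mod W)) ^ s \<le> real (card (representations_mod W A s y))"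
      by (rule cnt)
    have "0 < c' * (1 / real W) * real (card (squares_mod W)) ^ s"
      using c' W(1) sq_pos[OF W A y] by simp
    then have "card (representations_mod W A s y) \<noteq> 0" using cnt by auto
    then obtain x where "x \<in> representations_mod W A s y" by fastforce
    then show "\<exists>x \<in> {..<s} \<rightarrow> A. [y = (\<Sum>i<s. x i)] (mod W)"
      by (auto simp: representations_mod_def PiE_def)
  qed
qed

end
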